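(* Let $0<c_0<1$, $c=\{s\in\mathbb{C}:\operatorname{Re}s=c_0\}$, let $\nu\in\mathbb{R}$ with $\nu>c_0-1$, and let $f\in\mathcal{M}^{-1}_{1/2,\nu}(L_c)$. Then for all $x>0$ the expansion $$f(x)=\frac{e^{x/2}}{\pi^2x}\int_{-\infty}^{\infty}\tau\sinh(\pi\tau)\,K_{i\tau}\left(\frac x2\right)\left(\int_0^\infty e^{-y/2}K_{i\tau}\left(\frac y2\right)f(y)\,dy\right)d\tau$$ holds, where the integral with respect to $y$ is absolutely convergent and the integral with respect to $\tau$ exists in the Riemann improper sense.
   Context: For real $c_0$ let $c=\{s\in\mathbb{C}:\operatorname{Re}s=c_0\}$, and let $L_1(c)$ be the space of integrable functions on this vertical line. For $c_1,c_2\in\mathbb{R}$ with $2\operatorname{sign}c_1+\operatorname{sign}c_2\ge0$, $\mathcal{M}^{-1}_{c_1,c_2}(L_c)$ denotes the space of functions $f(x)$, $x>0$, representable in the form $$f(x)=\frac{1}{2\pi i}\int_c f^*(s)x^{-s}\,ds,$$ where $s^{c_2}e^{\pi c_1|s|}f^*(s)\in L_1(c)$. $K_{\mu}$ denotes the modified Bessel function of the second kind (Macdonald function) of order $\mu$. *)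

theory Defs
  imports "HOL-Analysis.Analysis"
begin

text \<open>Principal branch of the power; \<^const>\<open>rGamma\<close> is the entire function equal to 1/Gamma.\<close>

definition bessel_I :: "complex \<Rightarrow> complex \<Rightarrow> complex" where
  "bessel_I \<mu> z = (z / 2) powr \<mu> *
     (\<Sum>k. (z / 2) ^ (2 * k) * rGamma (\<mu> + of_nat k + 1) / fact k)"

text \<open>Macdonald function; at integer orders the defining quotient is 0/0 and is replaced by its
  limit in the order.\<close>

definition bessel_K :: "complex \<Rightarrow> complex \<Rightarrow> complex" where
  "bessel_K \<mu> z =
     (let Q = (\<lambda>w. of_real pi / 2 * (bessel_I (- w) z - bessel_I w z) / sin (of_real pi * w))
      in if \<mu> \<in> \<int> then Lim (at \<mu>) Q else Q \<mu>)"

text \<open>Integrability and integral on the vertical line \<open>Re s = c0\<close>, oriented upwards and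
  parametrised by \<open>s = c0 + i t\<close>, so that \<open>ds = i dt\<close>.\<close>

definition L1_vline :: "real \<Rightarrow> (complex \<Rightarrow> complex) \<Rightarrow> bool" where
  "L1_vline c0 g \<longleftrightarrow> integrable lebesgue (\<lambda>t. g (Complex c0 t))"

definition vline_integral :: "real \<Rightarrow> (complex \<Rightarrow> complex) \<Rightarrow> complex" where
  "vline_integral c0 g = \<i> * (LINT t|lebesgue. g (Complex c0 t))"

text \<open>The space is considered for parameters with \<open>2 * sgn c1 + sgn c2 \<ge> 0\<close> only. Its members are
  functions on the positive half-line: values at \<open>x \<le> 0\<close> are irrelevant.\<close>

definition inv_mellin_space :: "real \<Rightarrow> real \<Rightarrow> real \<Rightarrow> (real \<Rightarrow> complex) set" where
  "inv_mellin_space c1 c2 c0 =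
     {f. \<exists>F. L1_vline c0 (\<lambda>s. s powr of_real c2 * of_real (exp (pi * c1 * norm s)) * F s) \<and>
          (\<forall>x>0. f x = 1 / (2 * of_real pi * \<i>) *
                     vline_integral c0 (\<lambda>s. F s * of_real x powr (- s)))}"

text \<open>The proper Riemann integral: the definition of the Henstock-Kurzweil integral
  with the gauge restricted to balls of constant radius.\<close>

definition has_Riemann_integral ::
  "(real \<Rightarrow> complex) \<Rightarrow> real \<Rightarrow> real \<Rightarrow> complex \<Rightarrow> bool" where
  "has_Riemann_integral g a b I \<longleftrightarrow>
     (\<forall>e>0. \<exists>d>0. \<forall>p. p tagged_division_of {a..b} \<and> (\<lambda>x. ball x d) fine p \<longrightarrow>
        norm ((\<Sum>(x, k)\<in>p. measure lborel k *\<^sub>R g x) - I) < e)"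

text \<open>Improper integral over the real line; both endpoints tend to infinity independently.\<close>

definition has_improper_Riemann_integral ::
  "(real \<Rightarrow> complex) \<Rightarrow> complex \<Rightarrow> bool" where
  "has_improper_Riemann_integral g J \<longleftrightarrow>
     (\<exists>G. (\<forall>a b. a \<le> b \<longrightarrow> has_Riemann_integral g a b (G a b)) \<and>
          ((\<lambda>(a, b). G a b) \<longlongrightarrow> J) (at_bot \<times>\<^sub>F at_top))"

end

theory Submission
  imports Defs "HOL-Complex_Analysis.Complex_Analysis" "HOL-Probability.Distributions"
begin

text \<open>Write \<open>K(\<tau>, y)\<close> for the Macdonald function of order \<open>\<i> \<tau>\<close>, which is half the integral of
\<open>exp (- y cosh u) exp (\<i> \<tau> u)\<close> over the real line. A member of the space is a superposition
\<open>f(y) = (1 / 2 \<pi>) \<integral> F(t) y^(-s) dt\<close>, \<open>s = c0 + \<i> t\<close>, of powers. The expansion is therefore proved for a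
single power, and then integrated over \<open>t\<close>.

For the power \<open>y^(-s)\<close> put \<open>z = 1 - s\<close>. The inner integral is the Mellin transform \<open>G(z, \<tau>)\<close> of
\<open>exp (- y / 2) K(\<tau>, y / 2)\<close>. Inserting the integral for \<open>K\<close> and integrating over \<open>y\<close> first, one finds
\<open>Gamma z / 2\<close> times the Fourier transform of \<open>cosh (u / 2)^(-2 z)\<close>. Representing this power again by a
Gamma integral gives \<open>Gamma (2 z) G(z, \<tau>) = 2 Gamma z \<integral> a^(2 z - 1) K(2 \<tau>, a) da\<close>
(lemma \<open>kl_mellin_doubling\<close>). This step decides the convergence: \<open>K(\<tau>, y)\<close> decays almost like
\<open>exp (- \<pi> \<bar>\<tau>\<bar> / 2)\<close> and \<open>K(2 \<tau>, a)\<close> almost like \<open>exp (- \<pi> \<bar>\<tau>\<bar>)\<close>, which together beat the factor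
\<open>\<tau> sinh (\<pi> \<tau>)\<close> of the outer integral. All integrals become absolutely convergent, and the outer
one reduces to the integral of \<open>\<tau> sinh (\<pi> \<tau>) K(\<tau>, y) K(2 \<tau>, a)\<close> over \<open>\<tau>\<close>.

The last integral is elementary (lemma \<open>integral_kl_kl_double\<close>). Moving the lines of integration for both
kernels to \<open>Im = \<pi> / 3\<close> absorbs the exponential growth of \<open>sinh (\<pi> \<tau>)\<close>; Fourier inversion removes the
integral over \<open>\<tau>\<close>, and moving the remaining line to \<open>Im = \<pi> / 2\<close> turns the integrand into a Gaussian
in \<open>sinh v\<close>. A final Gamma integral over \<open>a\<close> and the duplication formula yield
\<open>\<pi>^2 (2 y)^z exp (- y)\<close> (lemma \<open>index_integral_kl_mellin\<close>), which at \<open>y = x / 2\<close> is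
\<open>\<pi>^2 x exp (- x / 2)\<close> times \<open>x^(-s)\<close>.

The interchange of the integrals over \<open>\<tau>\<close> and \<open>t\<close> needs the growth of \<open>G(1 - s, \<tau>)\<close> in \<open>t\<close>. By the
duplication formula it is the growth of \<open>1 / Gamma (z + 1/2)\<close>, namely \<open>\<bar>t\<bar>^(c0 - 1) exp (\<pi> \<bar>t\<bar> / 2)\<close>
(lemmas \<open>norm_Gamma_lower_bound\<close> and \<open>kl_mellin_bound\<close>). The function \<open>s^\<nu> exp (\<pi> \<bar>s\<bar> / 2) F\<close>
is integrable, and \<open>\<nu> > c0 - 1\<close> says that this weight controls that growth.

The series that defines the Bessel functions is linked to the integral in \<open>bessel_K_imaginary\<close>. The
integral satisfies a Volterra equation in \<open>y^2 / 4\<close>, and Picard iteration of this equation produces exactly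
the two power series. This works for orders with real part strictly between \<open>-1\<close> and \<open>0\<close>; continuity in
the order carries the identity to the imaginary axis, including the limit that defines order zero.

The integrand of the outer integral is continuous and absolutely integrable, so its integral exists as an
improper Riemann integral.\<close>

section \<open>Integrals over the real line\<close>

text \<open>Every interchange of integrals below concerns an integrand that is dominated by a product of integrable
functions of the separate variables. In this form Fubini's theorem asks only for a pointwise estimate.\<close>

lemma fubini_dominated_by_product:
  fixes f :: "real \<Rightarrow> real \<Rightarrow> complex" and p q :: "real \<Rightarrow> real"
  assumes meas: "case_prod f \<in> borel_measurable (lborel \<Otimes>\<^sub>M lborel)"
    and p: "integrable lborel p" and q: "integrable lborel q"
    and le: "\<And>x y. norm (f x y) \<le> p x * q y"
  shows "(LINT y|lborel. LINT x|lborel. f x y) = (LINT x|lborel. LINT y|lborel. f x y)"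
    and "integrable lborel (\<lambda>x. LINT y|lborel. f x y)"
    and "integrable lborel (\<lambda>y. LINT x|lborel. f x y)"
proof -
  have "integrable (lborel \<Otimes>\<^sub>M lborel) (\<lambda>(x, y). p x * q y)"
    using lborel_pair.integrable_product_swap_iff p q
    by (intro lborel_pair.Fubini_integrable)
       (auto simp: case_prod_beta norm_mult integrable_mult_left integrable_mult_right abs_mult)
  then have int: "integrable (lborel \<Otimes>\<^sub>M lborel) (case_prod f)"
    by (rule Bochner_Integration.integrable_bound[OF _ meas])
       (auto intro!: AE_I2 order.trans[OF le] simp: case_prod_beta)
  show "(LINT y|lborel. LINT x|lborel. f x y) = (LINT x|lborel. LINT y|lborel. f x y)"
    by (rule lborel_pair.Fubini_integral[OF int])
  show "integrable lborel (\<lambda>x. LINT y|lborel. f x y)"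
    by (rule lborel_pair.integrable_fst[OF int])
  show "integrable lborel (\<lambda>y. LINT x|lborel. f x y)"
    by (rule lborel_pair.integrable_snd[OF int])
qed

lemma continuous_on_integral_dominated:
  fixes f :: "'a::metric_space \<Rightarrow> real \<Rightarrow> complex"
  assumes meas: "\<And>w. w \<in> A \<Longrightarrow> f w \<in> borel_measurable lborel"
    and p: "integrable lborel p"
    and le: "\<And>w x. w \<in> A \<Longrightarrow> norm (f w x) \<le> p x"
    and cont: "\<And>x. continuous_on A (\<lambda>w. f w x)"
  shows "continuous_on A (\<lambda>w. LINT x|lborel. f w x)"
  unfolding continuous_on_sequentially
proof (intro allI ballI impI)
  fix s a assume a: "a \<in> A" and s: "(\<forall>n. s n \<in> A) \<and> s \<longlonglongrightarrow> a"
  have "(\<lambda>n. LINT x|lborel. f (s n) x) \<longlonglongrightarrow> (LINT x|lborel. f a x)"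
  proof (rule integral_dominated_convergence[where w = p])
    show "AE x in lborel. (\<lambda>n. f (s n) x) \<longlonglongrightarrow> f a x"
      using cont a s unfolding continuous_on_sequentially comp_def by (intro AE_I2) blast
  qed (use meas p le a s in \<open>auto intro!: AE_I2\<close>)
  then show "((\<lambda>w. LINT x|lborel. f w x) \<circ> s) \<longlonglongrightarrow> (LINT x|lborel. f a x)"
    by (simp add: comp_def)
qed

lemma integrable_exp_minus_abs:
  fixes c :: real assumes "c > 0"
  shows "integrable lborel (\<lambda>x. exp (- (c * \<bar>x\<bar>)))"
proof -
  have 1: "set_integrable lborel {0..} (\<lambda>x. exp (- (c * \<bar>x\<bar>)))"
  proof -
    have "(\<lambda>x::real. exp (-c * x)) integrable_on {0..}"
      by (rule integrable_on_exp_minus_to_infinity[OF assms])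
    then have "(\<lambda>x::real. exp (-c * x)) absolutely_integrable_on {0..}"
      by (intro nonnegative_absolutely_integrable_1) auto
    then have "set_integrable lborel {0..} (\<lambda>x::real. exp (-c * x))"
      unfolding set_integrable_def by (subst (asm) integrable_completion) auto
    then show ?thesis
      by (subst set_integrable_cong[where f' = "\<lambda>x::real. exp (-c * x)"]) auto
  qed
  have 2: "set_integrable lborel {..0} (\<lambda>x. exp (- (c * \<bar>x\<bar>)))"
    using lborel_integrable_real_affine[OF 1[unfolded set_integrable_def], of "-1" 0]
    unfolding set_integrable_def
    by (rule Bochner_Integration.integrable_cong[THEN iffD1, rotated 2]) (auto simp: indicator_def)
  have "set_integrable lborel ({0..} \<union> {..0}) (\<lambda>x. exp (- (c * \<bar>x\<bar>)))"
    by (rule set_integrable_Un[OF 1 2]) auto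
  moreover have "{0..} \<union> {..0} = (UNIV :: real set)" by auto
  ultimately show ?thesis by (simp add: set_integrable_def)
qed

lemma integrable_dominated_by_exp_abs:
  fixes g :: "real \<Rightarrow> complex"
  assumes "g \<in> borel_measurable lborel" and "c > 0"
      and "\<And>x. norm (g x) \<le> C * exp (- (c * \<bar>x\<bar>))"
  shows "integrable lborel g"
  by (rule Bochner_Integration.integrable_bound[OF
        integrable_mult_right[OF integrable_exp_minus_abs[OF assms(2)], of C] assms(1)])
     (auto intro!: AE_I2 order.trans[OF assms(3)])

lemma tendsto_integral_symmetric:
  fixes g :: "real \<Rightarrow> complex"
  assumes "integrable lborel g"
  shows "(\<lambda>n. LINT x:{- real n..real n}|lborel. g x) \<longlonglongrightarrow> (LINT x|lborel. g x)"
proof -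
  have "\<exists>n. x \<in> {- real n..real n}" for x
    using real_arch_simple[of "\<bar>x\<bar>"] by (force simp: abs_le_iff)
  then have U: "(\<Union>n. {- real n..real n}) = UNIV" by blast
  have "(\<lambda>n. LINT x:{- real n..real n}|lborel. g x) \<longlonglongrightarrow>
          (LINT x:(\<Union>n. {- real n..real n})|lborel. g x)"
  proof (rule set_integral_cont_up)
    show "set_integrable lborel (\<Union>n. {- real n..real n}) g"
      unfolding U using assms by (simp add: set_integrable_def)
  qed (auto simp: incseq_def)
  then show ?thesis unfolding U by (simp add: set_lebesgue_integral_def)
qed

lemma exp_abs_tendsto:
  "(\<lambda>n. C * exp (- \<bar>real n\<bar>)) \<longlonglongrightarrow> 0"
proof -
  have "(\<lambda>n. C * exp (- real n)) \<longlonglongrightarrow> C * 0"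
    by (intro tendsto_intros filterlim_compose[OF exp_at_bot] filterlim_compose[OF filterlim_uminus_at_bot_at_top]
        filterlim_real_sequentially)
  then show ?thesis by simp
qed

text \<open>Integration by parts over the whole line: exponential decay removes the boundary terms.\<close>

lemma integral_derivative_eq_zero:
  fixes f f' :: "real \<Rightarrow> complex"
  assumes deriv: "\<And>x. (f has_vector_derivative f' x) (at x)"
    and cont: "continuous_on UNIV f'" and int: "integrable lborel f'"
    and le: "\<And>x. norm (f x) \<le> C * exp (- \<bar>x\<bar>)"
  shows "(LINT x|lborel. f' x) = 0"
proof (rule LIMSEQ_unique[OF tendsto_integral_symmetric[OF int]])
  have eq: "(LINT x:{- real n..real n}|lborel. f' x) = f (real n) - f (- real n)" for n
    unfolding set_lebesgue_integral_def
    by (rule integral_FTC_Icc)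
       (auto intro!: has_vector_derivative_at_within[OF deriv] continuous_on_subset[OF cont])
  have "(\<lambda>n. f (real n) - f (- real n)) \<longlonglongrightarrow> 0 - 0"
    by (intro tendsto_diff Lim_null_comparison[OF _ exp_abs_tendsto[of C]] always_eventually allI)
       (use le[of "real _"] le[of "- real _"] in auto)
  then show "(\<lambda>n. LINT x:{- real n..real n}|lborel. f' x) \<longlonglongrightarrow> 0"
    by (simp add: eq)
qed

text \<open>Cauchy's theorem for an infinite strip. An entire function has a primitive, so truncated integrals over the
two lines differ by increments of the primitive along the vertical ends, which vanish together with the
integrand.\<close>

lemma integral_horizontal_shift:
  fixes f :: "complex \<Rightarrow> complex"
  assumes holo: "f holomorphic_on UNIV" and ab: "\<alpha> \<le> \<beta>"
    and le: "\<And>u \<theta>. \<alpha> \<le> \<theta> \<Longrightarrow> \<theta> \<le> \<beta>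
        \<Longrightarrow> norm (f (Complex u \<theta>)) \<le> C * exp (- \<bar>u\<bar>)"
  shows "(LINT u|lborel. f (Complex u \<alpha>)) = (LINT u|lborel. f (Complex u \<beta>))"
proof -
  obtain g where g: "\<And>z. (g has_field_derivative f z) (at z)"
    using holomorphic_convex_primitive'[OF convex_UNIV open_UNIV holo] by auto
  have contf: "continuous_on UNIV f" using holo by (rule holomorphic_on_imp_continuous_on)
  have CE: "(\<lambda>u. Complex u \<theta>) = (\<lambda>u. of_real u + \<i> * of_real \<theta>)" for \<theta>
    by (auto simp: complex_eq_iff)
  have contC: "continuous_on A (\<lambda>u. f (Complex u \<theta>))" for A \<theta>
    by (rule continuous_on_compose2[OF contf]) (auto simp: CE intro!: continuous_intros)
  have int: "integrable lborel (\<lambda>u. f (Complex u \<theta>))"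
      if "\<alpha> \<le> \<theta>" "\<theta> \<le> \<beta>" for \<theta>
    by (rule integrable_dominated_by_exp_abs[of _ 1 C])
       (use le that in \<open>auto intro!: borel_measurable_continuous_onI contC\<close>)
  have FTC: "(LINT u:{- real n..real n}|lborel. f (Complex u \<theta>))
          = g (Complex (real n) \<theta>) - g (Complex (- real n) \<theta>)" for n \<theta>
    unfolding set_lebesgue_integral_def
  proof (rule integral_FTC_Icc)
    fix x :: real
    have "((\<lambda>u. g (of_real u + \<i> * of_real \<theta>))
        has_vector_derivative (1 * f (of_real x + \<i> * of_real \<theta>))) (at x within {- real n..real n})"
      by (rule field_vector_diff_chain_within[unfolded o_def])
         (auto intro!: derivative_eq_intros has_field_derivative_at_within[OF g])
    then show "((\<lambda>u. g (Complex u \<theta>))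
        has_vector_derivative f (Complex x \<theta>)) (at x within {- real n..real n})"
      by (simp add: CE Complex_eq)
  qed (auto intro!: contC)
  have vert: "norm (g (Complex u \<alpha>) - g (Complex u \<beta>))
      \<le> (\<beta> - \<alpha>) * C * exp (- \<bar>u\<bar>)" for u
  proof -
    have "norm (g (Complex u \<alpha>) - g (Complex u \<beta>))
        \<le> (C * exp (- \<bar>u\<bar>)) * norm (Complex u \<alpha> - Complex u \<beta>)"
    proof (rule field_differentiable_bound)
      show "convex (closed_segment (Complex u \<alpha>) (Complex u \<beta>))" by simp
      show "(g has_field_derivative f z) (at z within closed_segment (Complex u \<alpha>) (Complex u \<beta>))" for z
        by (rule has_field_derivative_at_within[OF g])
      show "norm (f z) \<le> C * exp (- \<bar>u\<bar>)"
          if z: "z \<in> closed_segment (Complex u \<alpha>) (Complex u \<beta>)" for z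
      proof -
        from z obtain s where s: "0 \<le> s" "s \<le> 1" "z
            = (1 - s) *\<^sub>R Complex u \<alpha> + s *\<^sub>R Complex u \<beta>"
          by (auto simp: closed_segment_def)
        have "z = Complex u (\<alpha> + s * (\<beta> - \<alpha>))" by (auto simp: s(3) complex_eq_iff algebra_simps)
        moreover have "s * (\<beta> - \<alpha>) \<ge> 0" using s ab by simp
        moreover have "s * (\<beta> - \<alpha>) \<le> \<beta> - \<alpha>"
          using ab s mult_right_mono[of s 1 "\<beta> - \<alpha>"] by simp
        ultimately show ?thesis using le[of "\<alpha> + s * (\<beta> - \<alpha>)" u] by simp
      qed
    qed auto
    also have "norm (Complex u \<alpha> - Complex u \<beta>) = \<beta> - \<alpha>"
      using ab by (simp add: cmod_def)
    finally show ?thesis by (simp add: mult_ac)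
  qed
  have "(\<lambda>n. (g (Complex (real n) \<alpha>) - g (Complex (real n) \<beta>))
      - (g (Complex (- real n) \<alpha>) - g (Complex (- real n) \<beta>))) \<longlonglongrightarrow> 0 - 0"
    by (intro tendsto_diff Lim_null_comparison[OF _ exp_abs_tendsto[of "(\<beta> - \<alpha>) * C"]] always_eventually
        allI)
       (use vert[of "real _"] vert[of "- real _"] in auto)
  then have "(\<lambda>n. (LINT u:{- real n..real n}|lborel. f (Complex u \<alpha>))
      - (LINT u:{- real n..real n}|lborel. f (Complex u \<beta>))) \<longlonglongrightarrow> 0"
    by (simp add: FTC algebra_simps)
  moreover have "(\<lambda>n. (LINT u:{- real n..real n}|lborel. f (Complex u \<alpha>))
      - (LINT u:{- real n..real n}|lborel. f (Complex u \<beta>))) \<longlonglongrightarrow>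
      (LINT u|lborel. f (Complex u \<alpha>)) - (LINT u|lborel. f (Complex u \<beta>))"
    using ab by (intro tendsto_diff tendsto_integral_symmetric int) auto
  ultimately have "(LINT u|lborel. f (Complex u \<alpha>)) - (LINT u|lborel. f (Complex u \<beta>)) = 0"
    by (rule LIMSEQ_unique[rotated])
  then show ?thesis by simp
qed

lemma integral_change_of_variables:
  fixes f :: "real \<Rightarrow> complex" and g h :: "real \<Rightarrow> real"
  assumes der: "\<And>x. (g has_field_derivative h x) (at x)" and pos: "\<And>x. h x > 0"
    and meas: "h \<in> borel_measurable borel" "f \<in> borel_measurable borel"
    and rg: "range g = A" and A: "A \<in> sets borel"
  shows "set_integrable lborel A f \<longleftrightarrow> integrable lborel (\<lambda>x. of_real (h x) * f (g x))"
    and "integrable lborel (\<lambda>x. of_real (h x) * f (g x)) \<Longrightarrow>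
        (LINT y:A|lborel. f y) = (LINT x|lborel. of_real (h x) * f (g x))"
proof -
  have contg: "continuous_on UNIV g" using der by (meson DERIV_isCont continuous_at_imp_continuous_on)
  have [measurable]: "g \<in> borel_measurable borel" by (rule borel_measurable_continuous_onI[OF contg])
  note [measurable] = meas A
  have inj: "inj g"
  proof (rule injI)
    fix x y assume eq: "g x = g y"
    have "g a < g b" if "a < b" for a b
      by (rule DERIV_pos_imp_increasing[OF that]) (use der pos in blast)
    then show "x = y" using eq by (metis less_irrefl neqE)
  qed
  have eqf: "(\<lambda>x. \<bar>h x\<bar> *\<^sub>R f (g x)) = (\<lambda>x. of_real (h x) * f (g x))"
    using pos by (auto simp: scaleR_conv_of_real abs_of_pos)
  have c1: "f absolutely_integrable_on A \<longleftrightarrow> set_integrable lborel A f"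
    unfolding set_integrable_def by (rule integrable_completion) measurable
  have c2: "(\<lambda>x. of_real (h x)
      * f (g x)) absolutely_integrable_on UNIV \<longleftrightarrow> integrable lborel
          (\<lambda>x. of_real (h x) * f (g x))"
    unfolding set_integrable_def by (subst integrable_completion) auto
  show *: "set_integrable lborel A f \<longleftrightarrow> integrable lborel (\<lambda>x. of_real (h x) * f (g x))"
    using absolutely_integrable_change_of_variables_real[of UNIV g h f] der inj
    unfolding eqf c1[symmetric] c2[symmetric] rg by simp
  assume int: "integrable lborel (\<lambda>x. of_real (h x) * f (g x))"
  have "integral A f = integral UNIV (\<lambda>x. of_real (h x) * f (g x))"
    using has_absolute_integral_change_of_variables_real[of UNIV g h f "integral UNIV (\<lambda>x. of_real (h x)
        * f (g x))"] der inj int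
    unfolding eqf rg c2[symmetric] by auto
  then show "(LINT y:A|lborel. f y) = (LINT x|lborel. of_real (h x) * f (g x))"
    using int * by (simp add: set_borel_integral_eq_integral integral_lborel)
qed

lemma integral_exp_substitution:
  fixes f :: "real \<Rightarrow> complex"
  assumes "f \<in> borel_measurable borel" and "integrable lborel (\<lambda>x. of_real (exp x) * f (exp x))"
  shows "set_integrable lborel {0<..} f"
    and "(LINT y:{0<..}|lborel. f y) = (LINT x|lborel. of_real (exp x) * f (exp x))"
proof -
  have r: "range exp = ({0<..} :: real set)" by (auto simp: image_iff) (metis exp_ln)
  show "set_integrable lborel {0<..} f"
    using integral_change_of_variables(1)[of exp exp f "{0<..}"] assms r by (auto intro!: DERIV_exp)
  show "(LINT y:{0<..}|lborel. f y) = (LINT x|lborel. of_real (exp x) * f (exp x))"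
    using integral_change_of_variables(2)[of exp exp f "{0<..}"] assms r by (auto intro!: DERIV_exp)
qed

lemma integral_sinh_substitution:
  fixes f :: "real \<Rightarrow> complex"
  assumes "f \<in> borel_measurable borel" and "integrable lborel f"
  shows "(LINT x|lborel. of_real (cosh x) * f (sinh x)) = (LINT y|lborel. f y)"
proof -
  have r: "range sinh = (UNIV :: real set)"
    by (metis surj_def sinh_arsinh_real)
  have d: "(sinh has_field_derivative cosh x) (at x)" for x :: real
    by (auto intro!: derivative_eq_intros)
  have m: "cosh \<in> borel_measurable (borel :: real measure)"
    by (intro borel_measurable_continuous_onI continuous_intros)
  have i: "integrable lborel (\<lambda>x. of_real (cosh x) * f (sinh x))"
    using integral_change_of_variables(1)[OF d cosh_real_pos m assms(1) r] assms(2)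
    by (simp add: set_integrable_def)
  show ?thesis
    using integral_change_of_variables(2)[OF d cosh_real_pos m assms(1) r _ i]
    by (simp add: set_lebesgue_integral_def)
qed

section \<open>Fourier inversion and the Riemann integral\<close>

lemma gaussian_le_exp_abs:
  fixes p u :: real assumes "p > 0"
  shows "exp (- (p * u\<^sup>2)) \<le> exp (1 / (4 * p)) * exp (- \<bar>u\<bar>)"
proof -
  have "0 \<le> p * (\<bar>u\<bar> - 1 / (2 * p))\<^sup>2" using assms by simp
  also have "\<dots> = p * u\<^sup>2 - \<bar>u\<bar> + 1 / (4 * p)"
    using assms by (simp add: power2_eq_square field_simps)
  finally show ?thesis by (simp add: exp_add[symmetric])
qed

lemma integrable_gaussian:
  fixes p q :: real assumes p: "p > 0"
  shows "integrable lborel (\<lambda>r. exp (\<i> * of_real (q * r) - of_real (p * r\<^sup>2)))"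
proof (rule integrable_dominated_by_exp_abs[of _ 1 "exp (1 / (4 * p))"])
  show "norm (exp (\<i> * of_real (q * r) - of_real (p * r\<^sup>2)))
      \<le> exp (1 / (4 * p)) * exp (- (1 * \<bar>r\<bar>))" for r
    using gaussian_le_exp_abs[OF p, of r] by simp
qed (auto intro!: borel_measurable_continuous_onI continuous_intros)

lemma integral_gaussian:
  fixes p :: real assumes p: "p > 0"
  shows "(LINT r|lborel. exp (- complex_of_real (p * r\<^sup>2))) = of_real (sqrt (pi / p))"
proof -
  define s where "s = sqrt (1 / (2 * p))"
  have s: "s > 0" "s\<^sup>2 = 1 / (2 * p)" using p by (auto simp: s_def)
  have e: "exp (- (p * r\<^sup>2)) = sqrt (pi / p) * normal_density 0 s r" for r
  proof -
    have "2 * pi * s\<^sup>2 = pi / p" and "- r\<^sup>2 / (2 * s\<^sup>2) = - (p * r\<^sup>2)"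
      using p by (simp_all add: s(2) field_simps)
    then show ?thesis using p by (simp add: normal_density_def real_sqrt_divide)
  qed
  have "(LINT r|lborel. exp (- (p * r\<^sup>2))) = sqrt (pi / p)"
    unfolding e using s integral_normal_density[of s 0] by simp
  then have "complex_of_real (LINT r|lborel. exp (- (p * r\<^sup>2))) = of_real (sqrt (pi / p))" by simp
  then show ?thesis
    by (subst (asm) integral_complex_of_real[symmetric]) (simp flip: exp_of_real)
qed

text \<open>Completing the square turns the integrand into a Gaussian on a parallel to the real axis, which is then
shifted back.\<close>

lemma fourier_transform_gaussian:
  fixes p q :: real assumes p: "p > 0"
  shows "(LINT r|lborel. exp (\<i> * of_real (q * r) - of_real (p * r\<^sup>2)))
         = of_real (sqrt (pi / p) * exp (- q\<^sup>2 / (4 * p)))"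
proof -
  define \<theta> where "\<theta> = - q / (2 * p)"
  define f where "f = (\<lambda>w::complex. exp (- (of_real p * w\<^sup>2)))"
  have holo: "f holomorphic_on UNIV" unfolding f_def by (intro holomorphic_intros)
  have bound: "norm (f (Complex u t)) \<le> (exp (p * \<theta>\<^sup>2) * exp (1 / (4 * p))) * exp (- \<bar>u\<bar>)"
    if "\<bar>t\<bar> \<le> \<bar>\<theta>\<bar>" for u t
  proof -
    have "norm (f (Complex u t)) = exp (p * t\<^sup>2) * exp (- (p * u\<^sup>2))"
      by (simp add: f_def norm_exp_eq_Re Re_power2 exp_add[symmetric] algebra_simps)
    also have "\<dots> \<le> exp (p * \<theta>\<^sup>2) * (exp (1 / (4 * p)) * exp (- \<bar>u\<bar>))"
      using p that by (intro mult_mono gaussian_le_exp_abs) (auto simp: abs_le_square_iff)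
    finally show ?thesis by (simp add: mult_ac)
  qed
  have shift: "(LINT u|lborel. f (Complex u \<theta>)) = (LINT u|lborel. f (Complex u 0))"
  proof (cases "\<theta> \<ge> 0")
    case True
    show ?thesis by (rule integral_horizontal_shift[OF holo True bound, symmetric]) auto
  next
    case False
    then have "\<theta> \<le> 0" by simp
    then show ?thesis by (rule integral_horizontal_shift[OF holo _ bound]) auto
  qed
  have e: "exp (\<i> * of_real (q * r) - of_real (p * r\<^sup>2))
      = of_real (exp (- q\<^sup>2 / (4 * p))) * f (Complex r \<theta>)" for r
  proof -
    have *: "\<i> * of_real (q * r) - of_real (p * r\<^sup>2)
        = of_real (- q\<^sup>2 / (4 * p)) - of_real p * (Complex r \<theta>)\<^sup>2"
      using p by (simp add: complex_eq_iff Re_power2 Im_power2 \<theta>_def field_simps power2_eq_square)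
    show ?thesis unfolding * f_def by (simp only: diff_conv_add_uminus exp_add exp_of_real)
  qed
  have f0: "f (Complex u 0) = exp (- complex_of_real (p * u\<^sup>2))" for u
    by (simp add: f_def complex_of_real_def[symmetric])
  show ?thesis
    unfolding e by (simp only: integral_mult_right_zero shift f0 integral_gaussian[OF p]) (simp add: mult.commute)
qed

text \<open>Gaussian summability. With a factor \<open>exp (- \<epsilon> \<tau>^2)\<close> under the outer integral the order of integration
can be exchanged, and the result is an average of \<open>h\<close> with Gaussian weights that concentrate at \<open>v\<close> as
\<open>\<epsilon>\<close> tends to zero.\<close>

lemma fourier_inversion:
  fixes h :: "real \<Rightarrow> complex"
  defines "H \<equiv> \<lambda>\<tau>. LINT u|lborel. h u * exp (\<i> * of_real (\<tau> * u))"
  assumes cont: "continuous_on UNIV h" and int: "integrable lborel h"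
    and bdd: "\<And>u. norm (h u) \<le> B" and int': "integrable lborel H"
  shows "(LINT \<tau>|lborel. H \<tau> * exp (- (\<i> * of_real (\<tau> * v)))) = 2 * of_real pi * h v"
proof -
  \<comment> \<open>the parameters of the Gaussian factors, tending to zero\<close>
  define e where "e = (\<lambda>n::nat. 1 / (2 * real (Suc n)))"
  have e: "e n > 0" for n by (simp add: e_def)
  have e0: "e \<longlonglongrightarrow> 0" unfolding e_def by real_asymp
  define A where "A = (\<lambda>n. LINT \<tau>|lborel. H \<tau> * exp (- (\<i> * of_real (\<tau> * v)))
      * exp (- of_real (e n * \<tau>\<^sup>2)))"
  have [measurable]: "h \<in> borel_measurable borel" using cont by (rule borel_measurable_continuous_onI)
  have [measurable]: "H \<in> borel_measurable borel" using borel_measurable_integrable[OF int'] by simp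
  have lim1: "A \<longlonglongrightarrow> (LINT \<tau>|lborel. H \<tau> * exp (- (\<i> * of_real (\<tau> * v))))"
    unfolding A_def
  proof (rule integral_dominated_convergence[where w = "\<lambda>\<tau>. norm (H \<tau>)"])
    show "AE \<tau> in lborel. (\<lambda>n. H \<tau> * exp (- (\<i> * of_real (\<tau> * v)))
        * exp (- of_real (e n * \<tau>\<^sup>2)))
             \<longlonglongrightarrow> H \<tau> * exp (- (\<i> * of_real (\<tau> * v)))"
    proof (rule AE_I2)
      fix \<tau> :: real
      have "(\<lambda>n. H \<tau> * exp (- (\<i> * of_real (\<tau> * v))) * exp (- of_real (e n * \<tau>\<^sup>2)))
             \<longlonglongrightarrow> H \<tau> * exp (- (\<i> * of_real (\<tau> * v))) * exp
                 (- of_real (0 * \<tau>\<^sup>2))"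
        by (intro tendsto_intros e0)
      then show "(\<lambda>n. H \<tau> * exp (- (\<i> * of_real (\<tau> * v)))
          * exp (- of_real (e n * \<tau>\<^sup>2)))
             \<longlonglongrightarrow> H \<tau> * exp (- (\<i> * of_real (\<tau> * v)))" by simp
    qed
    show "AE \<tau> in lborel. norm (H \<tau> * exp (- (\<i> * of_real (\<tau> * v)))
        * exp (- of_real (e n * \<tau>\<^sup>2))) \<le> norm (H \<tau>)" for n
      using e[of n] by (intro AE_I2) (auto simp: norm_mult intro!: mult_left_le)
  qed (use int' in \<open>auto intro!: integrable_norm\<close>)
  have A_eq: "A n = of_real (sqrt pi * 2)
      * (LINT r|lborel. h (v + 2 * sqrt (e n) * r) * of_real (exp (- r\<^sup>2)))" for n
  proof -
    have "A n = (LINT \<tau>|lborel. LINT u|lborel. h u * exp (\<i> * of_real ((u - v) * \<tau>)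
        - of_real (e n * \<tau>\<^sup>2)))"
    proof -
      have "h u * exp (\<i> * of_real ((u - v) * \<tau>) - of_real (e n * \<tau>\<^sup>2))
            = h u * exp (\<i> * of_real (\<tau> * u)) * exp (- (\<i> * of_real (\<tau> * v))) * exp
                (- of_real (e n * \<tau>\<^sup>2))" for u \<tau>
        by (simp add: exp_add[symmetric] mult.assoc) (simp add: algebra_simps)
      then show ?thesis unfolding A_def H_def by (simp only: integral_mult_left_zero)
    qed
    also have "\<dots> = (LINT u|lborel. LINT \<tau>|lborel. h u * exp (\<i> * of_real ((u - v) * \<tau>)
        - of_real (e n * \<tau>\<^sup>2)))"
    proof (rule fubini_dominated_by_product(1)[where p = "\<lambda>u. norm (h u)" and q =
        "\<lambda>\<tau>. norm (exp (- complex_of_real (e n * \<tau>\<^sup>2)))"])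
      show "integrable lborel (\<lambda>\<tau>. norm (exp (- complex_of_real (e n * \<tau>\<^sup>2))))"
        using integrable_norm[OF integrable_gaussian[OF e, of 0 n]] by simp
    qed (use int in \<open>auto simp: norm_mult\<close>)
    also have "\<dots> = (LINT u|lborel. h u * of_real (sqrt (pi / e n) * exp (- (u - v)\<^sup>2 / (4 * e n))))"
      by (simp only: integral_mult_right_zero fourier_transform_gaussian[OF e])
    also have "\<dots> = of_real \<bar>2 * sqrt (e n)\<bar> *
        (LINT r|lborel. h (v + 2 * sqrt (e n) * r) * of_real
            (sqrt (pi / e n) * exp (- (v + 2 * sqrt (e n) * r - v)\<^sup>2 / (4 * e n))))"
      using e[of n] by (subst lborel_integral_real_affine[where c = "2 * sqrt (e n)" and t = v])
          (auto simp: scaleR_conv_of_real)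
    also have "\<dots> = of_real \<bar>2 * sqrt (e n)\<bar> *
        (LINT r|lborel. of_real (sqrt (pi / e n)) * (h (v + 2 * sqrt (e n) * r) * of_real (exp (- r\<^sup>2))))"
      using e[of n] by (simp add: power_mult_distrib mult_ac less_imp_le)
    also have "\<dots> = of_real (\<bar>2 * sqrt (e n)\<bar> * sqrt (pi / e n)) *
        (LINT r|lborel. h (v + 2 * sqrt (e n) * r) * of_real (exp (- r\<^sup>2)))"
      by (simp only: integral_mult_right_zero of_real_mult mult.assoc)
    also have "\<bar>2 * sqrt (e n)\<bar> * sqrt (pi / e n) = sqrt pi * 2"
      using e[of n] by (simp add: real_sqrt_divide)
    finally show ?thesis .
  qed
  have int_g: "integrable lborel (\<lambda>r::real. exp (- r\<^sup>2))"
    using integrable_norm[OF integrable_gaussian[of 1 0]] by simp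
  have "(\<lambda>n. LINT r|lborel. h (v + 2 * sqrt (e n) * r) * of_real (exp (- r\<^sup>2)))
          \<longlonglongrightarrow> (LINT r|lborel. h v * of_real (exp (- r\<^sup>2)))"
  proof (rule integral_dominated_convergence[where w = "\<lambda>r. B * exp (- r\<^sup>2)"])
    show "AE r in lborel. (\<lambda>n. h (v + 2 * sqrt (e n) * r) * of_real (exp (- r\<^sup>2)))
        \<longlonglongrightarrow> h v * of_real (exp (- r\<^sup>2))"
    proof (rule AE_I2)
      fix r :: real
      have "(\<lambda>n. v + 2 * sqrt (e n) * r) \<longlonglongrightarrow> v + 2 * sqrt 0 * r"
        by (intro tendsto_intros e0)
      then have "(\<lambda>n. h (v + 2 * sqrt (e n) * r)) \<longlonglongrightarrow> h v"
        using continuous_on_tendsto_compose[OF cont, of "\<lambda>n. v + 2 * sqrt (e n) * r" v sequentially] by simp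
      then show "(\<lambda>n. h (v + 2 * sqrt (e n) * r) * of_real (exp (- r\<^sup>2)))
          \<longlonglongrightarrow> h v * of_real (exp (- r\<^sup>2))"
        by (intro tendsto_intros)
    qed
    show "AE r in lborel. norm (h (v + 2 * sqrt (e n) * r) * of_real (exp (- r\<^sup>2)))
        \<le> B * exp (- r\<^sup>2)" for n
      using bdd by (intro AE_I2) (auto simp: norm_mult intro!: mult_right_mono)
  qed (use int_g in auto)
  then have "A \<longlonglongrightarrow> of_real (sqrt pi * 2) * (LINT r|lborel. h v * of_real (exp (- r\<^sup>2)))"
    unfolding A_eq by (intro tendsto_mult tendsto_const)
  also have "(LINT r|lborel. h v * of_real (exp (- r\<^sup>2)))
      = h v * (LINT r|lborel. exp (- complex_of_real (1 * r\<^sup>2)))"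
    by (simp add: exp_of_real[symmetric])
  also have "\<dots> = h v * of_real (sqrt pi)" by (subst integral_gaussian) auto
  also have "of_real (sqrt pi * 2) * (h v * of_real (sqrt pi)) = of_real (sqrt pi * sqrt pi) * 2 * h v"
    unfolding of_real_mult by (simp add: mult_ac)
  also have "\<dots> = 2 * of_real pi * h v" by simp
  finally show ?thesis using lim1 LIMSEQ_unique by blast
qed

text \<open>Uniform continuity provides one radius for all tags, which is the gauge that the proper Riemann integral
asks for.\<close>

lemma has_Riemann_integral_continuous:
  fixes g :: "real \<Rightarrow> complex"
  assumes cont: "continuous_on {a..b} g" and ab: "a \<le> b"
  shows "has_Riemann_integral g a b (integral {a..b} g)"
  unfolding has_Riemann_integral_def
proof (intro allI impI)
  fix e :: real assume e: "e > 0"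
  define e' where "e' = e / (b - a + 1)"
  have e': "e' > 0" using e ab by (simp add: e'_def)
  have "uniformly_continuous_on {a..b} g"
    using compact_uniformly_continuous[OF cont] by simp
  then obtain d where d: "d > 0"
      and dg: "\<And>x y. x \<in> {a..b} \<Longrightarrow> y \<in> {a..b} \<Longrightarrow> dist y x < d
          \<Longrightarrow> dist (g y) (g x) < e'"
    unfolding uniformly_continuous_on_def using e' by metis
  show "\<exists>d>0. \<forall>p. p tagged_division_of {a..b} \<and> (\<lambda>x. ball x d) fine p \<longrightarrow>
          norm ((\<Sum>(x, k)\<in>p. measure lborel k *\<^sub>R g x) - integral {a..b} g) < e"
  proof (intro exI[of _ d] conjI allI impI d)
    fix p assume "p tagged_division_of {a..b} \<and> (\<lambda>x. ball x d) fine p"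
    then have p: "p tagged_division_of cbox a b" and fine: "(\<lambda>x. ball x d) fine p"
        by (auto simp: cbox_interval)
    have gi: "g integrable_on cbox a b" using cont by (simp add: integrable_continuous_interval cbox_interval)
    have "integral {a..b} g = (\<Sum>(x, k)\<in>p. integral k g)"
      using integral_combine_tagged_division_topdown[OF gi p] by (simp add: cbox_interval)
    then have "norm ((\<Sum>(x, k)\<in>p. measure lborel k *\<^sub>R g x) - integral {a..b} g)
        = norm (\<Sum>(x, k)\<in>p. measure lborel k *\<^sub>R g x - integral k g)"
      by (simp add: sum_subtractf case_prod_beta)
    also have "\<dots> \<le> (\<Sum>(x, k)\<in>p. measure lborel k * e')"
    proof (rule sum_norm_le, clarify)
      fix x k assume xk: "(x, k) \<in> p"
      obtain c d' where k: "k = cbox c d'" using tagged_division_ofD(4)[OF p xk] by blast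
      have x: "x \<in> k" and sub: "k \<subseteq> {a..b}" using tagged_division_ofD(2,3)[OF p xk]
          by (auto simp: cbox_interval)
      have kb: "k \<subseteq> ball x d" using fine xk by (auto simp: fine_def)
      have gk: "g integrable_on k" using integrable_on_subcbox[OF gi] sub k by (simp add: cbox_interval)
      have "((\<lambda>y. g x - g y) has_integral (measure lborel k *\<^sub>R g x - integral k g)) k"
        using has_integral_diff[OF has_integral_const[of "g x" c d'] integrable_integral[OF gk[unfolded k]]] k by simp
      then have "norm (measure lborel k *\<^sub>R g x - integral k g) \<le> e' * measure lborel k"
        unfolding k
      proof (rule has_integral_bound[rotated])
        show "norm (g x - g y) \<le> e'" if "y \<in> cbox c d'" for y
          using dg[of y x] that x sub kb k by (auto simp: dist_norm dist_commute subset_iff less_imp_le)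
      qed (use e' in simp)
      then show "norm (measure lborel k *\<^sub>R g x - integral k g) \<le> measure lborel k * e'"
          by (simp add: mult.commute)
    qed
    also have "\<dots> = e' * (b - a)"
      using additive_content_tagged_division[OF p] ab
          by (simp add: sum_distrib_left[symmetric] case_prod_beta cbox_interval mult.commute)
    also have "\<dots> < e" using e ab by (simp add: e'_def field_simps)
    finally show "norm ((\<Sum>(x, k)\<in>p. measure lborel k *\<^sub>R g x) - integral {a..b} g) < e" .
  qed
qed

lemma has_improper_Riemann_integral_absolutely:
  fixes g :: "real \<Rightarrow> complex"
  assumes cont: "continuous_on UNIV g" and int: "integrable lborel g"
  shows "has_improper_Riemann_integral g (LINT x|lborel. g x)"
  unfolding has_improper_Riemann_integral_def
proof (intro exI[of _ "\<lambda>a b. integral {a..b} g"] conjI allI impI)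
  show "has_Riemann_integral g a b (integral {a..b} g)" if "a \<le> b" for a b
    using has_Riemann_integral_continuous[OF continuous_on_subset[OF cont] that] by simp
  have abs: "g absolutely_integrable_on UNIV"
    using int borel_measurable_integrable[OF int] unfolding set_integrable_def by (subst integrable_completion) auto
  have cb: "(g has_integral (LINT x|lborel. g x)) UNIV"
    using has_integral_integral_lborel[OF int] by simp
  show "((\<lambda>(a, b). integral {a..b} g) \<longlongrightarrow> (LINT x|lborel. g x)) (at_bot \<times>\<^sub>F at_top)"
    unfolding tendsto_iff
  proof (intro allI impI)
    fix e :: real assume e: "e > 0"
    from cb[unfolded has_integral_alt'] e obtain B where B: "B > 0"
      "\<And>a b. ball 0 B \<subseteq> cbox a b
          \<Longrightarrow> norm (integral (cbox a b) (\<lambda>x. if x \<in> UNIV then g x else 0) -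
              (LINT x|lborel. g x)) < e"
      by metis
    show "\<forall>\<^sub>F x in at_bot \<times>\<^sub>F at_top. dist (case x of (a, b) \<Rightarrow> integral {a..b} g) (LINT x|lborel. g x) < e"
      unfolding eventually_prod_filter
    proof (rule exI[of _ "\<lambda>a. a \<le> - B"], rule exI[of _ "\<lambda>b. b \<ge> B"], intro conjI allI impI)
      fix a b assume "a \<le> - B" "B \<le> b"
      then have "ball 0 B \<subseteq> cbox a b" by (auto simp: cbox_interval dist_real_def)
      from B(2)[OF this] show "dist (case (a, b) of (a, b) \<Rightarrow> integral {a..b} g) (LINT x|lborel. g x) < e"
        by (simp add: dist_norm cbox_interval)
    qed (auto intro: eventually_le_at_bot eventually_ge_at_top)
  qed
qed

section \<open>The Gamma function on vertical lines\<close>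

text \<open>Euler's integral in the variable \<open>x = ln t\<close>. Integrals over the positive half-line are written in this
variable from here on, because dilations become translations of the real line.\<close>

lemma
  fixes z :: complex assumes z: "Re z > 0"
  shows integrable_Gamma_exp: "integrable lborel (\<lambda>x. exp (z * of_real x - of_real (exp x)))"
    and integral_Gamma_exp: "(LINT x|lborel. exp (z * of_real x - of_real (exp x))) = Gamma z"
proof -
  define f where "f = (\<lambda>t::real. if t > 0 then exp ((z - 1) * of_real (ln t))
      * exp (- of_real t) else 0 :: complex)"
  have [measurable]: "f \<in> borel_measurable borel" unfolding f_def by measurable
  have feq: "of_real t powr (z - 1) / of_real (exp (1 * t)) = f t" if "t > 0" for t :: real
    using that by (simp add: f_def powr_def Ln_of_real exp_minus divide_inverse exp_of_real)
  have "f absolutely_integrable_on {0<..}"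
    using absolutely_integrable_Gamma_integral[OF z, of 1]
    by (subst set_integrable_cong[OF refl refl, where f' = "\<lambda>t. of_real t powr (z
        - 1) / of_real (exp (1 * t))"])
       (use feq in auto)
  then have int: "set_integrable lborel {0<..} f"
    unfolding set_integrable_def by (subst (asm) integrable_completion) auto
  have r: "range exp = ({0<..} :: real set)" by (auto simp: image_iff) (metis exp_ln)
  have e: "of_real (exp x) * f (exp x) = exp (z * of_real x - of_real (exp x))" for x :: real
    by (simp add: f_def exp_of_real[symmetric] exp_add[symmetric] algebra_simps)
  show i: "integrable lborel (\<lambda>x. exp (z * of_real x - of_real (exp x)))"
    using integral_change_of_variables(1)[of exp exp f "{0<..}"] int r unfolding e by (auto intro!: DERIV_exp)
  have "(LINT x|lborel. exp (z * of_real x - of_real (exp x))) = (LINT y:{0<..}|lborel. f y)"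
    using integral_exp_substitution(2)[of f] i unfolding e by simp
  also have "\<dots> = integral {0<..} f" using int by (rule set_borel_integral_eq_integral)
  also have "\<dots> = integral {0<..} (\<lambda>t. of_real t powr (z - 1) / of_real (exp t))"
    by (rule integral_cong) (use feq in auto)
  also have "\<dots> = integral {0..} (\<lambda>t. of_real t powr (z - 1) / of_real (exp t))"
    by (rule integral_spike_set) (auto intro: negligible_subset[of "{0::real}"])
  also have "\<dots> = Gamma z" using Gamma_integral_complex[OF z] by (rule integral_unique)
  finally show "(LINT x|lborel. exp (z * of_real x - of_real (exp x))) = Gamma z" .
qed

lemma
  fixes z :: complex and c :: real assumes z: "Re z > 0" and c: "c > 0"
  shows integrable_Gamma_exp_scaled: "integrable lborel (\<lambda>x. exp (z * of_real x - of_real (c * exp x)))"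
    and integral_Gamma_exp_scaled:
      "(LINT x|lborel. exp (z * of_real x - of_real (c * exp x))) = Gamma z * exp (- (z * of_real (ln c)))"
proof -
  have e: "exp (z * of_real x - of_real (c * exp x)) =
      exp (- (z * of_real (ln c))) * exp (z * of_real (ln c + 1 * x) - of_real (exp (ln c + 1 * x)))" for x
  proof -
    have "c * exp x = exp (ln c + 1 * x)" using c by (simp add: exp_add)
    then show ?thesis by (simp add: exp_add[symmetric] algebra_simps)
  qed
  show "integrable lborel (\<lambda>x. exp (z * of_real x - of_real (c * exp x)))"
    unfolding e
    by (intro integrable_mult_right lborel_integrable_real_affine[OF integrable_Gamma_exp[OF z]]) simp
  show "(LINT x|lborel. exp (z * of_real x - of_real (c * exp x))) = Gamma z * exp (- (z * of_real (ln c)))"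
    unfolding e integral_mult_right_zero integral_Gamma_exp[OF z, symmetric]
    by (subst (2) lborel_integral_real_affine[where c = 1 and t = "ln c"]) auto
qed

lemma integrable_exp_minus_exp:
  fixes a c :: real assumes "a > 0" "c > 0"
  shows "integrable lborel (\<lambda>x. exp (a * x - c * exp x))"
  using integrable_norm[OF integrable_Gamma_exp_scaled[of "of_real a" c]] assms by simp

text \<open>The function is \<open>ln (1 + t^2 / x^2)\<close>, twice the negative logarithm of the factor \<open>x / \<bar>x + \<i> t\<bar>\<close> of the
product in the next lemma.\<close>

lemma convex_on_ln_one_plus_inverse_square:
  fixes t :: real
  shows "convex_on {0<..} (\<lambda>x. ln (x\<^sup>2 + t\<^sup>2) - 2 * ln x)"
proof (rule f''_ge0_imp_convex[where f' = "\<lambda>x. 2 * x / (x\<^sup>2 + t\<^sup>2) - 2 / x"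
      and f'' = "\<lambda>x. 2 * (t\<^sup>2 - x\<^sup>2) / (x\<^sup>2 + t\<^sup>2)\<^sup>2 + 2 / x\<^sup>2"])
  fix x :: real assume "x \<in> {0<..}"
  then have x: "x > 0" by simp
  then have pos: "x\<^sup>2 + t\<^sup>2 > 0" by (simp add: add_pos_nonneg)
  show "((\<lambda>x. ln (x\<^sup>2 + t\<^sup>2) - 2 * ln x) has_real_derivative 2 * x / (x\<^sup>2 + t\<^sup>2)
      - 2 / x) (at x)"
    using x pos by (auto intro!: derivative_eq_intros)
  show "((\<lambda>x. 2 * x / (x\<^sup>2 + t\<^sup>2) - 2 / x) has_real_derivative 2 * (t\<^sup>2
      - x\<^sup>2) / (x\<^sup>2 + t\<^sup>2)\<^sup>2 + 2 / x\<^sup>2) (at x)"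
    using x pos by (auto intro!: derivative_eq_intros simp: power2_eq_square algebra_simps)
  have "2 * x\<^sup>2 / (x\<^sup>2 + t\<^sup>2)\<^sup>2 \<le> 2 / x\<^sup>2"
  proof -
    have "x\<^sup>2 * x\<^sup>2 \<le> (x\<^sup>2 + t\<^sup>2)\<^sup>2"
        unfolding power2_eq_square[of "x\<^sup>2 + t\<^sup>2"] by (intro mult_mono) auto
    then show ?thesis using x pos by (simp add: field_simps)
  qed
  moreover have "2 * t\<^sup>2 / (x\<^sup>2 + t\<^sup>2)\<^sup>2 \<ge> 0" by simp
  ultimately show "2 * (t\<^sup>2 - x\<^sup>2) / (x\<^sup>2 + t\<^sup>2)\<^sup>2 + 2 / x\<^sup>2 \<ge> 0"
    unfolding right_diff_distrib diff_divide_distrib by linarith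
qed auto

text \<open>By Euler's limit formula \<open>\<bar>Gamma (x + \<i> t)\<bar> / Gamma x\<close> is a limit of products of the factors
\<open>(x + k) / \<bar>x + k + \<i> t\<bar>\<close>. Each of them is log-concave in \<open>x\<close>, hence so is the limit.\<close>

lemma Gamma_ratio_interpolation:
  fixes \<rho> t :: real
  assumes \<rho>: "0 < \<rho>" "\<rho> < 1"
  defines "R \<equiv> \<lambda>x::real. norm (Gamma (Complex x t)) / Gamma x"
  shows "R (1/2) powr (1 - \<rho>) * R (3/2) powr \<rho> \<le> R (1/2 + \<rho>)"
proof -
  define r where "r = (\<lambda>n x::real. \<Prod>k\<le>n. (x + real k) / norm (Complex x t + of_nat k))"
  have q: "(x + real k) / norm (Complex x t + of_nat k)
      = exp (- (1/2) * (ln ((x + real k)\<^sup>2 + t\<^sup>2) - 2 * ln (x + real k)))"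
    if "x > 0" for x k
  proof -
    have x: "x + real k > 0" using that by simp
    then have pos: "(x + real k)\<^sup>2 + t\<^sup>2 > 0" by (simp add: add_pos_nonneg)
    have "norm (Complex x t + of_nat k) = sqrt ((x + real k)\<^sup>2 + t\<^sup>2)" by (simp add: cmod_def)
    also have "\<dots> = exp (1/2 * ln ((x + real k)\<^sup>2 + t\<^sup>2))"
      using pos x by (auto simp: powr_half_sqrt[symmetric] powr_def)
    finally have n: "norm (Complex x t + of_nat k) = exp (1/2 * ln ((x + real k)\<^sup>2 + t\<^sup>2))" .
    have "- (1/2) * (ln ((x + real k)\<^sup>2 + t\<^sup>2) - 2 * ln (x + real k))
        = ln (x + real k) - 1/2 * ln ((x + real k)\<^sup>2 + t\<^sup>2)"
      by (simp add: field_simps)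
    then show ?thesis using x unfolding n by (simp only: exp_diff exp_ln)
  qed
  have r_exp: "r n x = exp (- (1/2) * (\<Sum>k\<le>n. ln ((x + real k)\<^sup>2 + t\<^sup>2) - 2 * ln (x + real k)))"
      if "x > 0" for n x
    unfolding r_def by (simp only: q[OF that] exp_sum[symmetric] sum_distrib_left finite_atMost)
  have lim: "(\<lambda>n. r n x) \<longlonglongrightarrow> R x" if x: "x > 0" for x
  proof -
    have "(\<lambda>n. norm (Gamma_series (Complex x t) n) / Gamma_series x n) \<longlonglongrightarrow> R x"
      unfolding R_def using Gamma_real_pos[OF x] by (intro tendsto_intros) (metis less_irrefl)
    moreover have "norm (Gamma_series (Complex x t) n) / Gamma_series x n = r n x" for n
    proof -
      have p: "pochhammer x (Suc n) > 0" using x by (rule pochhammer_pos)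
      have "norm (pochhammer (Complex x t) (Suc n)) = (\<Prod>k\<le>n. norm (Complex x t + of_nat k))"
        by (simp add: pochhammer_prod prod_norm atLeast0AtMost lessThan_Suc_atMost atLeast0LessThan)
      moreover have "pochhammer x (Suc n) = (\<Prod>k\<le>n. x + real k)"
        by (simp add: pochhammer_prod atLeast0AtMost lessThan_Suc_atMost atLeast0LessThan)
      ultimately show ?thesis using p
        by (simp add: Gamma_series_def norm_mult norm_divide r_def prod_dividef)
    qed
    ultimately show ?thesis by simp
  qed
  have ineq: "r n (1/2) powr (1 - \<rho>) * r n (3/2) powr \<rho> \<le> r n (1/2 + \<rho>)" for n
  proof -
    define S where "S = (\<lambda>x. \<Sum>k\<le>n. ln ((x + real k)\<^sup>2 + t\<^sup>2) - 2 * ln (x + real k))"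
    have "S (1/2 + \<rho>) \<le> (1 - \<rho>) * S (1/2) + \<rho> * S (3/2)"
      unfolding S_def sum_distrib_left sum.distrib[symmetric]
    proof (rule sum_mono)
      fix k
      have eq: "(1 - \<rho>) *\<^sub>R (1/2 + real k) + \<rho> *\<^sub>R (3/2 + real k) = 1/2 + \<rho> + real k"
        by (simp add: field_simps)
      show "ln ((1/2 + \<rho> + real k)\<^sup>2 + t\<^sup>2) - 2 * ln (1/2 + \<rho> + real k)
        \<le> (1 - \<rho>) * (ln ((1/2 + real k)\<^sup>2 + t\<^sup>2) - 2 * ln (1/2 + real k))
          + \<rho> * (ln ((3/2 + real k)\<^sup>2 + t\<^sup>2) - 2 * ln (3/2 + real k))"
        using convex_onD[OF convex_on_ln_one_plus_inverse_square[of t], of \<rho> "1/2 + real k" "3/2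
            + real k"] \<rho>
        unfolding eq by simp
    qed
    then have "exp (- (1/2) * ((1 - \<rho>) * S (1/2) + \<rho> * S (3/2))) \<le> exp (- (1/2) * S (1/2 + \<rho>))"
        by simp
    moreover have rS: "r n x = exp (- (1/2) * S x)" if "x > 0" for x
      unfolding S_def by (rule r_exp[OF that])
    ultimately show ?thesis using \<rho>
      by (simp add: rS exp_powr_real exp_add[symmetric] field_simps)
  qed
  have pos: "R x > 0" if "x > 0" for x
  proof -
    have "Complex x t \<notin> \<int>\<^sub>\<le>\<^sub>0" using that
        by (auto elim!: nonpos_Ints_cases simp: complex_eq_iff)
    then show ?thesis unfolding R_def using that Gamma_real_pos[OF that] by (simp add: Gamma_eq_zero_iff)
  qed
  show ?thesis
  proof (rule LIMSEQ_le[OF _ lim])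
    show "(\<lambda>n. r n (1/2) powr (1 - \<rho>) * r n (3/2) powr \<rho>)
        \<longlonglongrightarrow> R (1/2) powr (1 - \<rho>) * R (3/2) powr \<rho>"
      using pos[of "1/2"] pos[of "3/2"] by (intro tendsto_intros lim) auto
  qed (use ineq \<rho> in auto)
qed

text \<open>The reflection formula gives \<open>\<bar>Gamma (1/2 + \<i> t)\<bar>^2 = \<pi> / cosh (\<pi> t)\<close>.\<close>

lemma norm_Gamma_one_half_plus_imaginary:
  "norm (Gamma (Complex (1/2) t)) \<ge> sqrt pi * exp (- pi * \<bar>t\<bar> / 2)"
proof -
  have "Gamma (Complex (1/2) t) * Gamma (1 - Complex (1/2) t) = of_real pi / sin (of_real pi * Complex (1/2) t)"
    by (rule Gamma_reflection_complex)
  also have "1 - Complex (1/2) t = cnj (Complex (1/2) t)" by (simp add: complex_eq_iff)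
  finally have "norm (Gamma (Complex (1/2) t) * cnj (Gamma (Complex (1/2) t)))
      = pi / norm (sin (of_real pi * Complex (1/2) t))"
    by (simp add: cnj_Gamma norm_divide)
  then have sq: "norm (Gamma (Complex (1/2) t)) ^ 2 = pi / norm (sin (of_real pi * Complex (1/2) t))"
    by (simp add: norm_mult power2_eq_square)
  have "norm (sin (of_real pi * Complex (1/2) t)) = norm (cosh (pi * t))"
  proof -
    have "of_real pi * Complex (1/2) t = of_real pi / 2 + \<i> * of_real (pi * t)" by (simp add: complex_eq_iff)
    then have "sin (of_real pi * Complex (1/2) t) = cos (\<i> * of_real (pi * t))"
      by (simp add: sin_add sin_of_real[symmetric] flip: of_real_divide)
    also have "\<dots> = cosh (of_real (pi * t))" by (simp add: cosh_conv_cos)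
    also have "\<dots> = of_real (cosh (pi * t))" by (simp add: cosh_def exp_of_real[symmetric] scaleR_conv_of_real)
    finally show ?thesis by simp
  qed
  also have "\<dots> \<le> exp (pi * \<bar>t\<bar>)"
  proof -
    have "pi * t \<le> pi * \<bar>t\<bar>" "pi * - t \<le> pi * \<bar>t\<bar>"
      by (intro mult_left_mono; simp)+
    then have "exp (pi * t) \<le> exp (pi * \<bar>t\<bar>)" "exp (- (pi * t)) \<le> exp (pi * \<bar>t\<bar>)"
      by simp_all
    moreover have "(A + B) / 2 \<le> C" if "A \<le> C" "B \<le> C" for A B C :: real using that by simp
    ultimately have "cosh (pi * t) \<le> exp (pi * \<bar>t\<bar>)" unfolding cosh_field_def by blast
    then show ?thesis by simp
  qed
  finally have le: "norm (sin (of_real pi * Complex (1/2) t)) \<le> exp (pi * \<bar>t\<bar>)" .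
  have "norm (sin (of_real pi * Complex (1/2) t)) > 0"
  proof -
    have "Complex (1/2) t \<notin> \<int>\<^sub>\<le>\<^sub>0" by (auto elim!: nonpos_Ints_cases simp: complex_eq_iff)
    then have "Gamma (Complex (1/2) t) \<noteq> 0" by (simp add: Gamma_eq_zero_iff)
    then have "norm (Gamma (Complex (1/2) t)) ^ 2 > 0" by simp
    then show ?thesis unfolding sq by (simp add: zero_less_divide_iff)
  qed
  then have "pi / exp (pi * \<bar>t\<bar>) \<le> norm (Gamma (Complex (1/2) t)) ^ 2"
    unfolding sq using le by (intro divide_left_mono mult_pos_pos) auto
  also have "pi / exp (pi * \<bar>t\<bar>) = (sqrt pi * exp (- pi * \<bar>t\<bar> / 2))\<^sup>2"
  proof -
    have "(exp (- pi * \<bar>t\<bar> / 2))\<^sup>2 = exp (- (pi * \<bar>t\<bar>))"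
      unfolding power2_eq_square exp_add[symmetric] by simp
    moreover have "pi / exp (pi * \<bar>t\<bar>) = pi * exp (- (pi * \<bar>t\<bar>))"
      by (simp only: exp_minus divide_inverse)
    ultimately show ?thesis by (simp only: power_mult_distrib real_sqrt_pow2 pi_ge_zero)
  qed
  finally have "(sqrt pi * exp (- pi * \<bar>t\<bar> / 2))\<^sup>2 \<le> norm (Gamma (Complex (1/2) t)) ^ 2" .
  then show ?thesis by (rule power2_le_imp_le) simp
qed

text \<open>This has the exact order of growth of Stirling's formula. It is obtained without asymptotic expansions: the
modulus is known at real part \<open>1/2\<close>, hence by the functional equation at \<open>3/2\<close>, and log-concavity
interpolates between the two lines.\<close>

lemma norm_Gamma_lower_bound:
  fixes \<rho> :: real
  assumes \<rho>: "0 < \<rho>" "\<rho> < 1"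
  obtains C where "C > 0"
    "\<And>t. C * (norm (Complex (1/2) t) powr \<rho> * exp (- pi * \<bar>t\<bar> / 2))
        \<le> norm (Gamma (Complex (1/2 + \<rho>) t))"
proof -
  define a where "a = Gamma (1/2 :: real)"
  define b where "b = Gamma (3/2 :: real)"
  have ab: "a > 0" "b > 0" by (auto simp: a_def b_def)
  define C where "C = Gamma (1/2 + \<rho>) * a powr (\<rho> - 1) * b powr (-\<rho>) * sqrt pi"
  show ?thesis
  proof (rule that[of C])
    show "C > 0" using ab \<rho> by (simp add: C_def Gamma_real_pos)
    fix t :: real
    define A where "A = norm (Gamma (Complex (1/2) t))"
    define w where "w = norm (Complex (1/2) t)"
    have w: "w > 0" by (simp add: w_def complex_eq_iff)
    have A: "A \<ge> sqrt pi * exp (- pi * \<bar>t\<bar> / 2)"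
      unfolding A_def by (rule norm_Gamma_one_half_plus_imaginary)
    then have A0: "A > 0" by (smt (verit) exp_gt_zero mult_pos_pos pi_gt_zero real_sqrt_gt_zero)
    have "Complex (3/2) t = Complex (1/2) t + 1" by (simp add: complex_eq_iff)
    then have "Gamma (Complex (3/2) t) = Complex (1/2) t * Gamma (Complex (1/2) t)"
      using A0 by (simp add: Gamma_plus1 A_def Gamma_eq_zero_iff)
    then have n32: "norm (Gamma (Complex (3/2) t)) = w * A" by (simp add: norm_mult w_def A_def)
    have "(A / a) powr (1 - \<rho>) * (w * A / b) powr \<rho>
        \<le> norm (Gamma (Complex (1/2 + \<rho>) t)) / Gamma (1/2 + \<rho>)"
      using Gamma_ratio_interpolation[OF \<rho>, of t] by (simp add: A_def[symmetric] n32 a_def b_def)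
    also have "(A / a) powr (1 - \<rho>) * (w * A / b) powr \<rho>
        = w powr \<rho> * A * (a powr (\<rho> - 1) * b powr (- \<rho>))"
      using A0 ab w \<rho> by (simp add: powr_divide powr_mult powr_diff powr_minus field_simps)
    finally have "Gamma (1/2 + \<rho>) * (w powr \<rho> * A * (a powr (\<rho> - 1) * b powr (- \<rho>)))
        \<le> norm (Gamma (Complex (1/2 + \<rho>) t))"
      using Gamma_real_pos[of "1/2 + \<rho>"] \<rho> by (simp add: field_simps)
    moreover have "C * (w powr \<rho> * exp (- pi * \<bar>t\<bar> / 2))
        \<le> Gamma (1/2 + \<rho>) * (w powr \<rho> * A * (a powr (\<rho> - 1) * b powr (- \<rho>)))"
    proof -
      have "C * (w powr \<rho> * exp (- pi * \<bar>t\<bar> / 2))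
          = (Gamma (1/2 + \<rho>) * w powr \<rho> * (a powr (\<rho> - 1) * b powr (- \<rho>))) *
              (sqrt pi * exp (- pi * \<bar>t\<bar> / 2))"
        by (simp add: C_def)
      also have "\<dots> \<le> (Gamma (1/2 + \<rho>) * w powr \<rho> * (a powr (\<rho> - 1) * b powr (- \<rho>))) * A"
        using \<rho> ab by (intro mult_left_mono A) (auto intro!: mult_nonneg_nonneg less_imp_le[OF Gamma_real_pos])
      finally show ?thesis by (simp add: mult_ac)
    qed
    ultimately show "C * (norm (Complex (1/2) t) powr \<rho> * exp (- pi * \<bar>t\<bar> / 2))
        \<le> norm (Gamma (Complex (1/2 + \<rho>) t))"
      by (simp add: w_def)
  qed
qed

section \<open>The integral representation of the Macdonald function\<close>

text \<open>The integral representation of the Macdonald function of order \<open>w\<close> for \<open>y > 0\<close>. All analysis below is based on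
it; \<open>bessel_K_imaginary\<close> connects it with the definition by series.\<close>

definition macdonald :: "complex \<Rightarrow> real \<Rightarrow> complex" where
  "macdonald w y = (LINT u|lborel. exp (w * of_real u - of_real (y * cosh u))) / 2"

text \<open>The hyperbolic cosine beats every linear rate \<open>m\<close>. The constant comes from \<open>u^2 / 4 \<le> cosh u\<close> by
completing the square.\<close>

lemma exp_minus_cosh_le:
  fixes y u m :: real assumes y: "y > 0"
  shows "exp (- (y * cosh u)) \<le> exp (m\<^sup>2 / y) * exp (- (m * \<bar>u\<bar>))"
proof -
  have "1 + \<bar>u\<bar> + \<bar>u\<bar>\<^sup>2 / 2 \<le> exp \<bar>u\<bar>"
      by (rule exp_lower_Taylor_quadratic) simp
  moreover have "exp \<bar>u\<bar> \<le> 2 * cosh \<bar>u\<bar>" by (simp add: cosh_field_def)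
  ultimately have "u\<^sup>2 / 4 \<le> cosh u" by (simp add: power2_abs)
  then have "y * (u\<^sup>2 / 4) \<le> y * cosh u" using y by (intro mult_left_mono) auto
  moreover have "0 \<le> y / 4 * (\<bar>u\<bar> - 2 * m / y)\<^sup>2" using y by simp
  moreover have "y / 4 * (\<bar>u\<bar> - 2 * m / y)\<^sup>2
      = y * (u\<^sup>2 / 4) - m * \<bar>u\<bar> + m\<^sup>2 / y"
    using y by (simp add: power2_eq_square field_simps)
  ultimately have "- (y * cosh u) \<le> m\<^sup>2 / y + - (m * \<bar>u\<bar>)" by linarith
  then show ?thesis by (simp add: exp_add[symmetric])
qed

lemma macdonald_integrand_bound:
  assumes y: "y > 0" and w: "\<bar>Re w\<bar> \<le> m"
  shows "norm (exp (w * of_real u - of_real (y * cosh u))) \<le> exp ((m + 1)\<^sup>2 / y) * exp (- \<bar>u\<bar>)"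
proof -
  have "Re w * u \<le> \<bar>Re w\<bar> * \<bar>u\<bar>" by (simp add: abs_mult[symmetric])
  also have "\<dots> \<le> m * \<bar>u\<bar>" using w by (intro mult_right_mono) auto
  finally have "norm (exp (w * of_real u - of_real (y * cosh u)))
      \<le> exp (m * \<bar>u\<bar>) * exp (- (y * cosh u))"
    by (simp add: exp_add[symmetric])
  also have "\<dots> \<le> exp (m * \<bar>u\<bar>) * (exp ((m + 1)\<^sup>2 / y) * exp (- ((m + 1) * \<bar>u\<bar>)))"
    by (intro mult_left_mono exp_minus_cosh_le y) simp
  also have "\<dots> = exp ((m + 1)\<^sup>2 / y) * exp (- \<bar>u\<bar>)"
    by (simp add: exp_add[symmetric] algebra_simps)
  finally show ?thesis .
qed

lemma integrable_macdonald:
  fixes w :: complex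
  assumes y: "y > 0"
  shows "integrable lborel (\<lambda>u. exp (w * of_real u - of_real (y * cosh u)))"
proof (rule integrable_dominated_by_exp_abs[of _ 1])
  show "norm (exp (w * of_real u - of_real (y * cosh u)))
      \<le> exp ((\<bar>Re w\<bar> + 1)\<^sup>2 / y) * exp (- (1 * \<bar>u\<bar>))" for u
    using macdonald_integrand_bound[OF y, of w "\<bar>Re w\<bar>"] by simp
qed (auto intro!: borel_measurable_continuous_onI continuous_intros)

lemma macdonald_minus: "macdonald (- w) y = macdonald w y"
  unfolding macdonald_def
  by (subst lborel_integral_real_affine[where c = "-1" and t = 0]) auto

lemma continuous_on_macdonald:
  assumes y: "y > 0"
  shows "continuous_on {w. \<bar>Re w\<bar> \<le> m} (\<lambda>w. macdonald w y)"
  unfolding macdonald_def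
proof (intro continuous_intros continuous_on_integral_dominated[where p = "\<lambda>u. exp ((m + 1)\<^sup>2 / y)
    * exp (- \<bar>u\<bar>)"])
  show "integrable lborel (\<lambda>u. exp ((m + 1)\<^sup>2 / y) * exp (- \<bar>u\<bar>))"
    using integrable_exp_minus_abs[of 1] by simp
  show "norm (exp (w * of_real u - of_real (y * cosh u))) \<le> exp ((m + 1)\<^sup>2 / y) * exp (- \<bar>u\<bar>)"
    if "w \<in> {w. \<bar>Re w\<bar> \<le> m}" for w u
    using macdonald_integrand_bound[OF y] that by simp
qed (auto intro!: borel_measurable_continuous_onI continuous_intros)

text \<open>The Macdonald integral as a function of \<open>a = y^2 / 4\<close>, up to the power \<open>a^(w / 2)\<close>. This normalisation leads
to an integral equation whose kernels are pure powers.\<close>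

definition bessel_phi :: "complex \<Rightarrow> real \<Rightarrow> complex" where
  "bessel_phi w a = (LINT x|lborel. exp (- w * of_real x - of_real (exp x + a * exp (- x))))"

lemma bessel_phi_eq_macdonald:
  assumes b: "b > 0"
  shows "bessel_phi w b = 2 * exp (- w * of_real (ln b / 2)) * macdonald w (2 * sqrt b)"
proof -
  have "bessel_phi w b = (LINT u|lborel. exp (- w * of_real (ln b / 2)) * exp (- w * of_real u
      - of_real (2 * sqrt b * cosh u)))"
  proof -
    define F where "F = (\<lambda>x. exp (- w * of_real x - of_real (exp x + b * exp (- x))))"
    have "bessel_phi w b = (LINT u|lborel. F (ln b / 2 + 1 * u))"
      using lborel_integral_real_affine[of 1 F "ln b / 2"] by (simp add: bessel_phi_def F_def)
    moreover have "F (ln b / 2 + 1 * u)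
        = exp (- w * of_real (ln b / 2)) * exp (- w * of_real u - of_real (2 * sqrt b * cosh u))" for u
    proof -
    have s: "exp (ln b / 2) = sqrt b" using b by (simp add: powr_half_sqrt[symmetric] powr_def)
    have s': "b * exp (- (ln b / 2)) = sqrt b"
      unfolding exp_minus s using b by (simp add: real_sqrt_divide field_simps)
    have "exp (ln b / 2 + u) + b * exp (- (ln b / 2) - u)
        = exp (ln b / 2) * exp u + b * exp (- (ln b / 2)) * exp (- u)"
      unfolding diff_conv_add_uminus exp_add by simp
    also have "\<dots> = 2 * sqrt b * cosh u"
      unfolding s s' by (simp add: cosh_field_def algebra_simps)
    finally have *: "exp (ln b / 2 + u) + b * exp (- (ln b / 2) - u) = 2 * sqrt b * cosh u" .
    have **: "exp (ln b / 2 + 1 * u) + b * exp (- (ln b / 2 + 1 * u)) = 2 * sqrt b * cosh u"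
      using * by simp
    show ?thesis unfolding F_def ** by (simp add: exp_add[symmetric] algebra_simps)
    qed
    ultimately show ?thesis by simp
  qed
  also have "\<dots> = 2 * exp (- w * of_real (ln b / 2)) * macdonald (- w) (2 * sqrt b)"
    unfolding macdonald_def by simp
  finally show ?thesis by (simp add: macdonald_minus)
qed

lemma bessel_phi_reflect:
  assumes b: "b > 0"
  shows "bessel_phi w b = of_real b powr (- w) * bessel_phi (- w) b"
proof -
  have "of_real b powr (- w) = exp (- w * of_real (ln b / 2)) * exp (- w * of_real (ln b / 2))"
    using b by (simp add: powr_def Ln_of_real exp_add[symmetric] algebra_simps)
  then show ?thesis
    unfolding bessel_phi_eq_macdonald[OF b] macdonald_minus by (simp add: exp_minus field_simps)
qed

lemma exp_minus_le_powr:
  fixes v \<epsilon> :: real assumes "v > 0" "0 \<le> \<epsilon>" "\<epsilon> \<le> 1"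
  shows "exp (- v) \<le> v powr (- \<epsilon>)"
proof -
  have "v powr \<epsilon> \<le> exp v"
  proof (cases "v \<ge> 1")
    case True
    then have "v powr \<epsilon> \<le> v powr 1" using assms by (intro powr_mono) auto
    also have "\<dots> \<le> exp v"
    proof -
      have "1 + v \<le> exp v" by (rule exp_ge_add_one_self)
      then have "v \<le> exp v" by linarith
      then show ?thesis using assms by simp
    qed
    finally show ?thesis .
  next
    case False
    then have "v powr \<epsilon> \<le> 1" using assms by (intro powr_le1) auto
    also have "1 \<le> exp v" using assms by simp
    finally show ?thesis .
  qed
  then show ?thesis using assms by (simp add: powr_minus exp_minus le_imp_inverse_le)
qed

lemma integrable_bessel_phi_zero:
  assumes "Re w < 0" shows "integrable lborel (\<lambda>x. exp (- w * of_real x - of_real (exp x)))"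
  using integrable_Gamma_exp[of "- w"] assms by simp

lemma norm_bessel_phi_le:
  assumes w: "Re w < 0" and a: "a \<ge> 0"
  shows "norm (bessel_phi w a) \<le> (LINT x|lborel. exp (- Re w * x - exp x))"
  unfolding bessel_phi_def
proof (rule Bochner_Integration.integral_norm_bound_integral)
  have i: "integrable lborel (\<lambda>x. exp (- Re w * x - exp x))"
    using integrable_exp_minus_exp[of "- Re w" 1] w by simp
  then show "integrable lborel (\<lambda>x. exp (- Re w * x - exp x))" .
  have le: "norm (exp (- w * of_real x - of_real (exp x + a * exp (- x)))) \<le> exp (- Re w * x - exp x)" for x
    using a by simp
  show "integrable lborel (\<lambda>x. exp (- w * of_real x - of_real (exp x + a * exp (- x))))"
    by (rule Bochner_Integration.integrable_bound[OF i]) (use le in \<open>auto intro!: AE_I2\<close>)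
  show "norm (exp (- w * of_real x - of_real (exp x + a * exp (- x)))) \<le> exp (- Re w * x - exp x)" for x
    by (rule le)
qed

lemma integral_exp_minus_linear:
  fixes k a :: real assumes "k > 0" "a \<ge> 0"
  shows "(LINT b|lborel. indicator {0<..<a} b * exp (- (b * k))) = (1 - exp (- (a * k))) / k"
proof -
  have hi: "((\<lambda>b. exp (- (b * k))) has_integral (- exp (- (a * k)) / k - - exp (- (0 * k)) / k)) {0..a}"
    using assms by (intro fundamental_theorem_of_calculus)
      (auto intro!: derivative_eq_intros simp flip: has_real_derivative_iff_has_vector_derivative)
  have "set_integrable lborel {0..a} (\<lambda>b. exp (- (b * k)))"
    by (rule borel_integrable_atLeastAtMost') (auto intro!: continuous_intros)
  then have "set_integrable lborel {0<..<a} (\<lambda>b. exp (- (b * k)))"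
    by (rule set_integrable_subset) auto
  from set_borel_integral_eq_integral(2)[OF this]
  have "(LINT b|lborel. indicator {0<..<a} b * exp (- (b * k))) = integral {0<..<a} (\<lambda>b. exp (- (b * k)))"
    by (simp add: set_lebesgue_integral_def)
  also have "\<dots> = integral {0..a} (\<lambda>b. exp (- (b * k)))" by (simp add: integral_open_interval_real)
  also have "\<dots> = (1 - exp (- (a * k))) / k" using integral_unique[OF hi] assms by (simp add: field_simps)
  finally show ?thesis .
qed

text \<open>Integrate \<open>exp (- a k) = 1 - \<integral>\<^sub>0\<^sup>a k exp (- b k) db\<close>, \<open>k = exp (- x)\<close>, against the remaining factor of
the integrand. The result is \<open>Gamma (- w)\<close> minus the integral of \<open>bessel_phi (w + 1)\<close>; reflecting the order
replaces \<open>w + 1\<close> by \<open>- w - 1\<close>, which lies in the strip \<open>-1 < Re < 0\<close> again. The relation can thus be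
iterated, and two applications form a Volterra equation for \<open>bessel_phi w\<close>.\<close>

lemma has_integral_bessel_phi:
  assumes w: "- 1 < Re w" "Re w < 0" and a: "a > 0"
  shows "((\<lambda>b. of_real b powr (- w - 1) * bessel_phi (- w - 1) b)
      has_integral (Gamma (- w) - bessel_phi w a)) {0..a}"
proof -
  \<comment> \<open>\<open>exp (- b exp (- x))\<close> will be bounded by \<open>(b exp (- x))^(- \<epsilon>)\<close>: \<open>\<epsilon> < 1\<close> makes this integrable at \<open>b = 0\<close>,
      \<open>Re w + 1 < \<epsilon>\<close> makes the resulting exponential integrable as \<open>x\<close> tends to minus infinity\<close>
  define \<epsilon> where "\<epsilon> = (Re w + 2) / 2"
  have \<epsilon>: "Re w + 1 < \<epsilon>" "\<epsilon> < 1" "0 < \<epsilon>" using w by (auto simp: \<epsilon>_def)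
  define f :: "real \<Rightarrow> real \<Rightarrow> complex" where
    "f = (\<lambda>b x. indicator {0<..<a} b * exp (- (w + 1) * of_real x - of_real (exp x + b * exp (- x))))"
  have mf [measurable]: "case_prod f \<in> borel_measurable (lborel \<Otimes>\<^sub>M lborel)"
    unfolding f_def by measurable
  have ip: "integrable lborel (\<lambda>b. indicator {0<..<a} b * b powr (- \<epsilon>))"
  proof -
    have "((\<lambda>b. b powr (- \<epsilon>)) has_integral (a powr (- \<epsilon> + 1) / (- \<epsilon> + 1))) {0..a}"
      using \<epsilon> a by (intro has_integral_powr_from_0) auto
    then have "(\<lambda>b. b powr (- \<epsilon>)) absolutely_integrable_on {0<..<a}"
      unfolding has_integral_Icc_iff_Ioo by (intro nonnegative_absolutely_integrable_1) auto
    then show ?thesis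
      unfolding set_integrable_def by (subst (asm) integrable_completion) auto
  qed
  have iq: "integrable lborel (\<lambda>x. exp ((\<epsilon> - Re w - 1) * x - 1 * exp x))"
    using \<epsilon> by (intro integrable_exp_minus_exp) auto
  have le: "norm (f b x) \<le> (indicator {0<..<a} b * b powr (- \<epsilon>)) * exp ((\<epsilon> - Re w - 1) * x
      - 1 * exp x)" for b x
  proof (cases "b \<in> {0<..<a}")
    case True
    then have b: "b > 0" by simp
    have "norm (f b x) = exp (- (Re w + 1) * x - exp x) * exp (- (b * exp (- x)))"
      using True by (simp add: f_def norm_exp_eq_Re norm_mult exp_add[symmetric])
    also have "\<dots> \<le> exp (- (Re w + 1) * x - exp x) * (b * exp (- x)) powr (- \<epsilon>)"
      using b \<epsilon> by (intro mult_left_mono exp_minus_le_powr) auto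
    also have "(b * exp (- x)) powr (- \<epsilon>) = b powr (- \<epsilon>) * exp (\<epsilon> * x)"
      using b by (simp add: powr_mult exp_powr_real mult.commute)
    also have "exp (- (Re w + 1) * x - exp x) * (b powr (- \<epsilon>) * exp (\<epsilon> * x))
        = b powr (- \<epsilon>) * exp ((\<epsilon> - Re w - 1) * x - 1 * exp x)"
      by (simp add: exp_add[symmetric] algebra_simps)
    finally show ?thesis using True by simp
  qed (simp add: f_def)
  note fub = fubini_dominated_by_product[OF mf ip iq le]
  have inner1: "(LINT x|lborel. f b x) = indicator {0<..<a} b * bessel_phi (w + 1) b" for b
    by (simp add: f_def bessel_phi_def)
  have inner2: "(LINT b|lborel. f b x)
      = exp (- w * of_real x - of_real (exp x)) - exp (- w * of_real x - of_real (exp x + a * exp (- x)))" for x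
  proof -
    have "f b x = exp (- (w + 1) * of_real x - of_real (exp x))
        * of_real (indicator {0<..<a} b * exp (- (b * exp (- x))))" for b
      by (simp add: f_def indicator_def exp_of_real[symmetric] exp_add[symmetric] algebra_simps)
    then have "(LINT b|lborel. f b x)
        = exp (- (w + 1) * of_real x - of_real (exp x)) * of_real
            (LINT b|lborel. indicator {0<..<a} b * exp (- (b * exp (- x))))"
      by (simp only: integral_mult_right_zero integral_complex_of_real)
    also have "(LINT b|lborel. indicator {0<..<a} b * exp (- (b * exp (- x))))
        = exp x * (1 - exp (- (a * exp (- x))))"
      using a by (subst integral_exp_minus_linear) (auto simp: exp_minus field_simps)
    also have "exp (- (w + 1) * of_real x - of_real (exp x)) * complex_of_real (exp x * (1 - exp (- (a * exp (- x)))))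
       = exp (- (w + 1) * of_real x - of_real (exp x)) * exp (of_real x) * (1 - exp (- of_real (a * exp (- x))))"
      by (simp add: exp_of_real[symmetric])
    also have "\<dots> = exp (- w * of_real x - of_real (exp x)) * (1 - exp (- of_real (a * exp (- x))))"
    proof -
      have "- (w + 1) * of_real x - of_real (exp x) + of_real x = - w * of_real x - complex_of_real (exp x)"
        by (simp add: algebra_simps)
      then show ?thesis by (simp only: exp_add[symmetric])
    qed
    also have "\<dots> = exp (- w * of_real x - of_real (exp x))
        - exp (- w * of_real x - of_real (exp x + a * exp (- x)))"
    proof -
      have "- w * of_real x - of_real (exp x) + - of_real (a * exp (- x))
          = - w * of_real x - complex_of_real (exp x + a * exp (- x))"
        by simp
      then show ?thesis by (simp only: right_diff_distrib exp_add[symmetric] mult_1_right)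
    qed
    finally show ?thesis .
  qed
  have ia: "integrable lborel (\<lambda>x. exp (- w * of_real x - of_real (exp x + a * exp (- x))))"
    by (rule Bochner_Integration.integrable_bound[OF integrable_bessel_phi_zero[OF w(2)]])
       (use a in \<open>auto intro!: AE_I2\<close>)
  have "(LINT b|lborel. indicator {0<..<a} b * bessel_phi (w + 1) b) = Gamma (- w) - bessel_phi w a"
    using fub(1) integral_Gamma_exp[of "- w"] w ia integrable_bessel_phi_zero[OF w(2)]
    by (simp add: inner1 inner2 bessel_phi_def)
  moreover have "integrable lborel (\<lambda>b. indicator {0<..<a} b * bessel_phi (w + 1) b)"
    using fub(2) by (simp add: inner1)
  ultimately have "((\<lambda>b. bessel_phi (w + 1) b) has_integral (Gamma (- w) - bessel_phi w a)) {0<..<a}"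
    using set_borel_integral_eq_integral[of "{0<..<a}" "bessel_phi (w + 1)"]
    by (simp add: set_integrable_def set_lebesgue_integral_def scaleR_conv_of_real has_integral_iff of_real_indicator)
  then have "((\<lambda>b. of_real b powr (- w - 1) * bessel_phi (- w - 1) b)
      has_integral (Gamma (- w) - bessel_phi w a)) {0<..<a}"
  proof (rule has_integral_eq[rotated])
    show "bessel_phi (w + 1) b = of_real b powr (- w - 1) * bessel_phi (- w - 1) b" if "b \<in> {0<..<a}" for b
      using bessel_phi_reflect[of b "w + 1"] that by simp
  qed
  then show ?thesis by (simp add: has_integral_Icc_iff_Ioo)
qed

section \<open>Power series by Picard iteration\<close>

lemma has_integral_complex_powr:
  fixes p :: complex assumes p: "Re p > - 1" and a: "a \<ge> 0"
  shows "((\<lambda>c. of_real c powr p) has_integral (of_real a powr (p + 1) / (p + 1))) {0..a}"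
proof -
  have p1: "p + 1 \<noteq> 0" using p by (auto simp: complex_eq_iff)
  have "((\<lambda>t. complex_of_real t powr p) has_integral
      (of_real a powr (p + 1) / (p + 1) - of_real 0 powr (p + 1) / (p + 1))) {0..a}"
    using p a p1 by (intro fundamental_theorem_of_calculus_interior)
       (auto intro!: continuous_intros derivative_eq_intros has_vector_derivative_real_field)
  then show ?thesis by simp
qed

definition bessel_series :: "complex \<Rightarrow> real \<Rightarrow> complex" where
  "bessel_series w a = (\<Sum>k. of_real (a ^ k) / (fact k * pochhammer (w + 1) k))"

lemma pochhammer_nonzero:
  fixes w :: complex assumes "Re w > - 1" shows "pochhammer (w + 1) k \<noteq> 0"
proof
  assume "pochhammer (w + 1) k = 0"
  then obtain j where "w + 1 = - of_nat j" by (auto simp: pochhammer_eq_0_iff)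
  then have "Re (w + 1) = - real j" by simp
  then show False using assms by simp
qed

lemma norm_pochhammer_ge:
  fixes w :: complex assumes "\<delta> > 0" "Re w + 1 \<ge> \<delta>"
  shows "\<delta> ^ k \<le> norm (pochhammer (w + 1) k)"
proof (induction k)
  case (Suc k)
  have "\<delta> \<le> Re (w + 1 + of_nat k)" using assms by simp
  also have "\<dots> \<le> norm (w + 1 + of_nat k)" by (rule complex_Re_le_cmod)
  finally have "\<delta> * \<delta> ^ k \<le> norm (w + 1 + of_nat k) * norm (pochhammer (w + 1) k)"
    using Suc assms by (intro mult_mono) auto
  then show ?case by (simp add: pochhammer_Suc norm_mult mult.commute)
qed simp

lemma norm_bessel_term_le:
  fixes w :: complex assumes "\<delta> > 0" "Re w + 1 \<ge> \<delta>" "a \<ge> 0"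
  shows "norm (of_real (a ^ k) / (fact k * pochhammer (w + 1) k)) \<le> (a / \<delta>) ^ k / fact k"
proof -
  have "norm (of_real (a ^ k) / (fact k * pochhammer (w + 1) k)) = a ^ k / (fact k * norm (pochhammer (w + 1) k))"
    using assms by (simp add: norm_divide norm_mult norm_power)
  also have "\<dots> \<le> a ^ k / (fact k * \<delta> ^ k)"
    using assms(1,3) norm_pochhammer_ge[OF assms(1,2), of k]
      less_le_trans[OF zero_less_power[OF assms(1)] norm_pochhammer_ge[OF assms(1,2)], of k]
    by (intro divide_left_mono mult_left_mono mult_pos_pos) (simp_all del: zero_less_norm_iff)
  finally show ?thesis by (simp add: power_divide mult.commute)
qed

lemma summable_exp_real: "summable (\<lambda>k. (x::real) ^ k / fact k)"
  using summable_exp_generic[of x] by (simp add: divide_inverse mult.commute)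

lemma summable_bessel:
  fixes w :: complex assumes "Re w > - 1" "a \<ge> 0"
  shows "summable (\<lambda>k. of_real (a ^ k) / (fact k * pochhammer (w + 1) k))"
proof (rule summable_comparison_test')
  show "summable (\<lambda>k. (a / (Re w + 1)) ^ k / fact k)" by (rule summable_exp_real)
  show "norm (of_real (a ^ k) / (fact k * pochhammer (w + 1) k)) \<le> (a / (Re w + 1)) ^ k / fact k" if "k \<ge> 0"
      for k
    using assms by (intro norm_bessel_term_le) auto
qed

lemma continuous_on_bessel_series:
  assumes a: "a \<ge> 0"
  shows "continuous_on {w. \<bar>Re w\<bar> \<le> 1/2} (\<lambda>w. bessel_series w a)"
proof (rule uniform_limit_theorem)
  show "uniform_limit {w. \<bar>Re w\<bar>
      \<le> 1/2} (\<lambda>n w. \<Sum>k<n. of_real (a ^ k) / (fact k * pochhammer (w + 1) k))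
          (\<lambda>w. bessel_series w a) sequentially"
    unfolding bessel_series_def
  proof (rule Weierstrass_m_test)
    show "summable (\<lambda>k. (a / (1/2)) ^ k / fact k)" by (rule summable_exp_real)
    show "norm (of_real (a ^ k) / (fact k * pochhammer (w + 1) k)) \<le> (a / (1/2)) ^ k / fact k"
      if "w \<in> {w. \<bar>Re w\<bar> \<le> 1/2}" for k and w :: complex
      using that a by (intro norm_bessel_term_le) auto
  qed
  show "\<forall>\<^sub>F n in sequentially. continuous_on {w::complex. \<bar>Re w\<bar>
      \<le> 1/2} (\<lambda>w. \<Sum>k<n. of_real (a ^ k) / (fact k * pochhammer (w + 1) k))"
    using pochhammer_nonzero
    by (intro always_eventually allI continuous_intros) (auto simp: pochhammer_prod intro!: continuous_intros)
qed simp

text \<open>The Picard iterates, started at zero, of the Volterra equation for \<open>bessel_phi w\<close>.\<close>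

definition bessel_phi_partial :: "nat \<Rightarrow> complex \<Rightarrow> real \<Rightarrow> complex" where
  "bessel_phi_partial n w a = Gamma (- w) * (\<Sum>k<n. of_real (a ^ k) / (fact k * pochhammer (w + 1) k))
     + Gamma w * of_real a powr (- w) * (\<Sum>k<n. of_real (a ^ k) / (fact k * pochhammer (- w + 1) k))"

lemma powr_times_power:
  assumes "c > 0" shows "of_real c powr p * of_real (c ^ k) = of_real c powr (p + of_nat k :: complex)"
  using assms by (simp add: powr_add powr_nat')

text \<open>The inner integral \<open>\<integral>\<^sub>0\<^sup>b c^w S(c) dc\<close> of one Picard step, where \<open>S\<close> is the \<open>n\<close>-th iterate.\<close>

definition bessel_phi_inner :: "nat \<Rightarrow> complex \<Rightarrow> real \<Rightarrow> complex" where
  "bessel_phi_inner n w b = Gamma (- w)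
      * (\<Sum>k<n. of_real b powr (w + of_nat k + 1) / (fact k * pochhammer (w + 1) (Suc k)))
      + Gamma w * (\<Sum>k<n. of_real (b ^ Suc k) / (fact (Suc k) * pochhammer (- w + 1) k))"

lemma has_integral_powr_bessel_phi_partial:
  assumes w: "- 1 < Re w" "Re w < 0" and b: "b > 0"
  shows "((\<lambda>c. of_real c powr w * bessel_phi_partial n w c) has_integral bessel_phi_inner n w b) {0..b}"
proof -
  have 1: "((\<lambda>c. of_real c powr (w + of_nat k) * (1 / (fact k * pochhammer (w + 1) k))) has_integral
      (of_real b powr (w + of_nat k + 1) / (fact k * pochhammer (w + 1) (Suc k)))) {0..b}" for k
    using has_integral_mult_left[OF has_integral_complex_powr[of "w
        + of_nat k" b], of "1 / (fact k * pochhammer (w + 1) k)"] w b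
    by (simp add: pochhammer_Suc mult_ac add_ac)
  have 2: "((\<lambda>c. of_real c powr of_nat k * (1 / (fact k * pochhammer (- w + 1) k))) has_integral
      (of_real (b ^ Suc k) / (fact (Suc k) * pochhammer (- w + 1) k))) {0..b}" for k
  proof -
    have "of_real b powr (of_nat k + 1) = complex_of_real (b ^ Suc k)"
      using b powr_nat'[of "of_real b :: complex" "Suc k"] by (simp add: add.commute)
    then show ?thesis
      using has_integral_mult_left[OF has_integral_complex_powr[of "of_nat k" b], of "1 / (fact k * pochhammer (- w
          + 1) k)"] b
      by (simp add: mult_ac add_ac)
  qed
  have "((\<lambda>c. Gamma (- w) * (\<Sum>k<n. of_real c powr (w + of_nat k) * (1 / (fact k * pochhammer (w + 1) k)))
      + Gamma w * (\<Sum>k<n. of_real c powr of_nat k * (1 / (fact k * pochhammer (- w + 1) k)))) has_integral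
          bessel_phi_inner n w b) {0..b}"
    unfolding bessel_phi_inner_def
    by (intro has_integral_add has_integral_mult_right has_integral_sum 1 2) auto
  then show ?thesis
  proof (rule has_integral_spike_finite[of "{0}", rotated 2])
    fix c assume "c \<in> {0..b} - {0}"
    then have c: "c > 0" by simp
    have canc: "of_real c powr w * of_real c powr (- w) = 1"
      using c by (simp add: powr_add[symmetric])
    have s1: "of_real c powr w * (\<Sum>k<n. of_real (c ^ k) / (fact k * pochhammer (w + 1) k))
        = (\<Sum>k<n. of_real c powr (w + of_nat k) * (1 / (fact k * pochhammer (w + 1) k)))"
      unfolding powr_times_power[OF c, symmetric] sum_distrib_left by simp
    have s2: "(\<Sum>k<n. of_real (c ^ k) / (fact k * pochhammer (- w + 1) k))
        = (\<Sum>k<n. of_real c powr of_nat k * (1 / (fact k * pochhammer (- w + 1) k)))"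
      using c by (simp add: powr_nat')
    have "of_real c powr w * bessel_phi_partial n w c =
        Gamma (- w) * (of_real c powr w * (\<Sum>k<n. of_real (c ^ k) / (fact k * pochhammer (w + 1) k)))
        + Gamma w * (of_real c powr w * of_real c powr (- w)) *
            (\<Sum>k<n. of_real (c ^ k) / (fact k * pochhammer (- w + 1) k))"
      unfolding bessel_phi_partial_def by (simp only: ring_distribs mult_ac)
    then show "of_real c powr w * bessel_phi_partial n w c =
      Gamma (- w) * (\<Sum>k<n. of_real c powr (w + of_nat k) * (1 / (fact k * pochhammer (w + 1) k)))
      + Gamma w * (\<Sum>k<n. of_real c powr of_nat k * (1 / (fact k * pochhammer (- w + 1) k)))"
      unfolding canc s1 s2 by simp
  qed simp
qed

lemma has_integral_powr_bessel_phi_inner: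
  assumes w: "- 1 < Re w" "Re w < 0" and a: "a > 0"
  shows "((\<lambda>b. of_real b powr (- w - 1) * (Gamma (w + 1) - bessel_phi_inner n w b)) has_integral
      (Gamma (- w) - bessel_phi_partial (Suc n) w a)) {0..a}"
proof -
  have w0: "w \<noteq> 0" using w by auto
  have 0: "((\<lambda>b. Gamma (w + 1) * of_real b powr (- w - 1))
      has_integral (- Gamma w * of_real a powr (- w))) {0..a}"
  proof -
    have "Gamma (w + 1) = w * Gamma w"
      using w w0 by (intro Gamma_plus1) (auto elim!: nonpos_Ints_cases simp: complex_eq_iff)
    then show ?thesis
      using has_integral_mult_right[OF has_integral_complex_powr[of "- w - 1" a], of "Gamma (w + 1)"] w w0 a by simp
  qed
  have 1: "((\<lambda>b. of_real b powr of_nat k * (1 / (fact k * pochhammer (w + 1) (Suc k)))) has_integral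
      (of_real (a ^ Suc k) / (fact (Suc k) * pochhammer (w + 1) (Suc k)))) {0..a}" for k
  proof -
    have "of_real a powr (of_nat k + 1) = complex_of_real (a ^ Suc k)"
      using a powr_nat'[of "of_real a :: complex" "Suc k"] by (simp add: add.commute)
    then show ?thesis
      using has_integral_mult_left[OF has_integral_complex_powr[of "of_nat k" a], of "1 / (fact k * pochhammer (w
          + 1) (Suc k))"] a
      by (simp add: mult_ac add_ac)
  qed
  have 2: "((\<lambda>b. of_real b powr (- w + of_nat k) * (1 / (fact (Suc k) * pochhammer (- w + 1) k))) has_integral
      (of_real a powr (- w) * (of_real (a ^ Suc k) / (fact (Suc k) * pochhammer (- w + 1) (Suc k))))) {0..a}" for k
  proof -
    have e: "of_real a powr (- w + of_nat k + 1) = of_real a powr (- w) * complex_of_real (a ^ Suc k)"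
      using powr_times_power[OF a, of "- w" "Suc k"] by (simp add: add_ac)
    have P: "pochhammer (- w + 1) (Suc k) = pochhammer (- w + 1) k * (- w + of_nat k + 1)"
      unfolding pochhammer_Suc by (simp only: add_ac)
    have "of_real a powr (- w + of_nat k + 1) / (- w + of_nat k + 1) * (1 / (fact (Suc k) * pochhammer (- w + 1) k))
        = of_real a powr (- w) * (of_real (a ^ Suc k) / (fact (Suc k) * pochhammer (- w + 1) (Suc k)))"
      unfolding e P by (simp only: times_divide_times_eq times_divide_eq_right divide_divide_eq_left mult_1_right
          mult_1_left mult_ac)
    moreover have "Re (- w + of_nat k) > - 1" using w by simp
    ultimately show ?thesis
      using has_integral_mult_left[OF has_integral_complex_powr[of "- w
          + of_nat k" a], of "1 / (fact (Suc k) * pochhammer (- w + 1) k)"] a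
      by (simp only: less_imp_le)
  qed
  have I: "((\<lambda>b. Gamma (w + 1) * of_real b powr (- w - 1) -
        (Gamma (- w) * (\<Sum>k<n. of_real b powr of_nat k * (1 / (fact k * pochhammer (w + 1) (Suc k))))
         + Gamma w * (\<Sum>k<n. of_real b powr (- w + of_nat k) * (1 / (fact (Suc k) * pochhammer (- w + 1) k)))))
             has_integral
      (- Gamma w * of_real a powr (- w) -
        (Gamma (- w) * (\<Sum>k<n. of_real (a ^ Suc k) / (fact (Suc k) * pochhammer (w + 1) (Suc k)))
         + Gamma w * (\<Sum>k<n. of_real a powr (- w) *
             (of_real (a ^ Suc k) / (fact (Suc k) * pochhammer (- w + 1) (Suc k))))))) {0..a}"
    by (intro has_integral_diff has_integral_add has_integral_mult_right has_integral_sum 0 1 2) auto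
  have val: "- Gamma w * of_real a powr (- w) -
        (Gamma (- w) * (\<Sum>k<n. of_real (a ^ Suc k) / (fact (Suc k) * pochhammer (w + 1) (Suc k)))
         + Gamma w * (\<Sum>k<n. of_real a powr (- w) *
             (of_real (a ^ Suc k) / (fact (Suc k) * pochhammer (- w + 1) (Suc k)))))
     = Gamma (- w) - bessel_phi_partial (Suc n) w a"
    unfolding bessel_phi_partial_def sum.lessThan_Suc_shift sum_distrib_left[symmetric] by (simp add: algebra_simps)
  show ?thesis
  proof (rule has_integral_spike_finite[OF _ _ I[unfolded val], of "{0}"])
    fix b assume "b \<in> {0..a} - {0}"
    then have b: "b > 0" by simp
    have e1: "of_real b powr (- w - 1) * of_real b powr (w + of_nat k + 1) = of_real b powr of_nat k" for k
      using b by (simp add: powr_add[symmetric])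
    have e2: "of_real b powr (- w - 1) * of_real (b ^ Suc k) = of_real b powr (- w + of_nat k)" for k
      using powr_times_power[OF b, of "- w - 1" "Suc k"] by simp
    have s1: "of_real b powr (- w - 1)
        * (\<Sum>k<n. of_real b powr (w + of_nat k + 1) / (fact k * pochhammer (w + 1) (Suc k)))
        = (\<Sum>k<n. of_real b powr of_nat k * (1 / (fact k * pochhammer (w + 1) (Suc k))))"
      unfolding sum_distrib_left e1[symmetric] by (simp add: mult.assoc)
    have s2: "of_real b powr (- w - 1) * (\<Sum>k<n. of_real (b ^ Suc k) / (fact (Suc k) * pochhammer (- w + 1) k))
        = (\<Sum>k<n. of_real b powr (- w + of_nat k) * (1 / (fact (Suc k) * pochhammer (- w + 1) k)))"
      unfolding sum_distrib_left e2[symmetric] by (simp add: mult.assoc)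
    show "of_real b powr (- w - 1) * (Gamma (w + 1) - bessel_phi_inner n w b)
        = Gamma (w + 1) * of_real b powr (- w - 1) -
        (Gamma (- w) * (\<Sum>k<n. of_real b powr of_nat k * (1 / (fact k * pochhammer (w + 1) (Suc k))))
         + Gamma w * (\<Sum>k<n. of_real b powr (- w + of_nat k) * (1 / (fact (Suc k) * pochhammer (- w + 1) k))))"
      unfolding bessel_phi_inner_def s1[symmetric] s2[symmetric] by (simp only: ring_distribs mult_ac)
  qed simp
qed

text \<open>One Picard step integrates the error twice, with weights \<open>c^\<sigma>\<close> and \<open>b^(- \<sigma> - 1)\<close> for \<open>\<sigma> = Re w\<close>. On an error of
size \<open>a^n\<close> this produces the factor \<open>a / ((n + 1) (n + 1 + \<sigma>))\<close>, which is at most \<open>a / ((n + 1) (1 + \<sigma>))\<close>.\<close>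

lemma norm_bessel_phi_minus_partial_le:
  assumes w: "- 1 < Re w" "Re w < 0" and a: "a > 0"
  defines "M \<equiv> (LINT x|lborel. exp (- Re w * x - exp x))"
  shows "norm (bessel_phi w a - bessel_phi_partial n w a) \<le> M * (a / (Re w + 1)) ^ n / fact n"
  using a
proof (induction n arbitrary: a)
  case 0
  then show ?case using norm_bessel_phi_le[OF w(2), of a] by (simp add: bessel_phi_partial_def M_def)
next
  case (Suc n)
  define \<delta> where "\<delta> = Re w + 1"
  \<comment> \<open>constant in the bound after the first of the two integrations\<close>
  define K where "K = M / (\<delta> ^ Suc n * fact n)"
  have \<delta>: "\<delta> > 0" using w by (simp add: \<delta>_def)
  have M: "M \<ge> 0" unfolding M_def by (rule Bochner_Integration.integral_nonneg) simp
  have K: "K \<ge> 0" using M \<delta> by (simp add: K_def)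
  define D where "D = (\<lambda>b. bessel_phi (- w - 1) b - (Gamma (w + 1) - bessel_phi_inner n w b))"
  have D: "norm (D b) \<le> K * b powr (real n + \<delta>)" if b: "b > 0" for b
  proof -
    have h1: "((\<lambda>c. of_real c powr w * bessel_phi w c)
        has_integral (Gamma (w + 1) - bessel_phi (- w - 1) b)) {0..b}"
      using has_integral_bessel_phi[of "- w - 1" b] w b by (simp add: add.commute)
    have h2: "((\<lambda>c. of_real c powr w * bessel_phi w c
        - of_real c powr w * bessel_phi_partial n w c) has_integral
        (Gamma (w + 1) - bessel_phi (- w - 1) b - bessel_phi_inner n w b)) {0..b}"
      by (rule has_integral_diff[OF h1 has_integral_powr_bessel_phi_partial[OF w b]])
    have h3: "((\<lambda>c. M / (\<delta> ^ n * fact n) * c powr (real n + Re w)) has_integral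
        (M / (\<delta> ^ n * fact n) * (b powr (real n + Re w + 1) / (real n + Re w + 1)))) {0..b}"
      using w b by (intro has_integral_mult_right has_integral_powr_from_0) auto
    have "norm (integral {0..b} (\<lambda>c. of_real c powr w * bessel_phi w c
        - of_real c powr w * bessel_phi_partial n w c))
       \<le> integral {0..b} (\<lambda>c. M / (\<delta> ^ n * fact n) * c powr (real n + Re w))"
    proof (rule Henstock_Kurzweil_Integration.integral_norm_bound_integral)
      show "norm (of_real c powr w * bessel_phi w c - of_real c powr w * bessel_phi_partial n w c)
          \<le> M / (\<delta> ^ n * fact n) * c powr (real n + Re w)"
        if "c \<in> {0..b}" for c
      proof (cases "c = 0")
        case False
        then have c: "c > 0" using that by simp
        have "norm (of_real c powr w * bessel_phi w c - of_real c powr w * bessel_phi_partial n w c)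
            = c powr Re w * norm (bessel_phi w c - bessel_phi_partial n w c)"
          using c by (simp add: right_diff_distrib[symmetric] norm_mult norm_powr_real_powr)
        also have "\<dots> \<le> c powr Re w * (M * (c / (Re w + 1)) ^ n / fact n)"
          by (intro mult_left_mono Suc.IH c) simp
        also have "\<dots> = M / (\<delta> ^ n * fact n) * c powr (real n + Re w)"
          using c by (simp add: \<delta>_def power_divide powr_add powr_realpow)
        finally show ?thesis .
      qed simp
    qed (use h2 h3 in \<open>auto simp: has_integral_iff\<close>)
    then have "norm (Gamma (w + 1) - bessel_phi (- w - 1) b - bessel_phi_inner n w b)
        \<le> M / (\<delta> ^ n * fact n) * (b powr (real n + \<delta>) / (real n + \<delta>))"
      using h2 h3 by (simp add: has_integral_iff \<delta>_def add_ac)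
    also have "\<dots> \<le> M / (\<delta> ^ n * fact n) * (b powr (real n + \<delta>) / \<delta>)"
      using M \<delta> by (intro mult_left_mono divide_left_mono) auto
    also have "\<dots> = K * b powr (real n + \<delta>)" by (simp add: K_def mult_ac)
    also have "norm (Gamma (w + 1) - bessel_phi (- w - 1) b - bessel_phi_inner n w b) = norm (D b)"
      unfolding D_def by (subst norm_minus_cancel[symmetric]) (simp add: algebra_simps)
    finally show ?thesis .
  qed
  have g1: "((\<lambda>b. of_real b powr (- w - 1) * bessel_phi (- w - 1) b
      - of_real b powr (- w - 1) * (Gamma (w + 1) - bessel_phi_inner n w b)) has_integral
      ((Gamma (- w) - bessel_phi w a) - (Gamma (- w) - bessel_phi_partial (Suc n) w a))) {0..a}"
    by (rule has_integral_diff[OF has_integral_bessel_phi[OF w Suc.prems]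
        has_integral_powr_bessel_phi_inner[OF w Suc.prems]])
  have g2: "((\<lambda>b. K * b powr real n) has_integral (K * (a powr (real n + 1) / (real n + 1)))) {0..a}"
    using Suc.prems by (intro has_integral_mult_right has_integral_powr_from_0) auto
  have "norm (integral {0..a} (\<lambda>b. of_real b powr (- w - 1) * bessel_phi (- w - 1) b
      - of_real b powr (- w - 1) * (Gamma (w + 1) - bessel_phi_inner n w b)))
     \<le> integral {0..a} (\<lambda>b. K * b powr real n)"
  proof (rule Henstock_Kurzweil_Integration.integral_norm_bound_integral)
    show "norm (of_real b powr (- w - 1) * bessel_phi (- w - 1) b
        - of_real b powr (- w - 1) * (Gamma (w + 1) - bessel_phi_inner n w b)) \<le> K * b powr real n"
      if "b \<in> {0..a}" for b
    proof (cases "b = 0")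
      case False
      then have b: "b > 0" using that by simp
      have "norm (of_real b powr (- w - 1) * bessel_phi (- w - 1) b
          - of_real b powr (- w - 1) * (Gamma (w + 1) - bessel_phi_inner n w b)) = b powr (- \<delta>) * norm (D b)"
        using b by (simp add: right_diff_distrib[symmetric] norm_mult norm_powr_real_powr D_def \<delta>_def)
      also have "\<dots> \<le> b powr (- \<delta>) * (K * b powr (real n + \<delta>))"
        by (intro mult_left_mono D b) simp
      also have "\<dots> = K * b powr real n" using b by (simp add: powr_add powr_minus field_simps)
      finally show ?thesis .
    qed (use K in simp)
  qed (use g1 g2 in \<open>auto simp: has_integral_iff\<close>)
  then have "norm (bessel_phi_partial (Suc n) w a - bessel_phi w a) \<le> K * (a powr (real n + 1) / (real n + 1))"
    using g1 g2 by (simp add: has_integral_iff)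
  also have "a powr (real n + 1) = a ^ Suc n" using powr_realpow[OF Suc.prems, of "Suc n"] by (simp add: add.commute)
  also have "K * (a ^ Suc n / (real n + 1)) = M * (a / (Re w + 1)) ^ Suc n / fact (Suc n)"
    by (simp add: K_def \<delta>_def power_divide mult_ac add_ac)
  finally show ?case by (simp add: norm_minus_commute)
qed

section \<open>Identification with the defining quotient\<close>

lemma bessel_phi_eq_bessel_series:
  assumes w: "- 1 < Re w" "Re w < 0" and a: "a > 0"
  shows "bessel_phi w a = Gamma (- w) * bessel_series w a + Gamma w * of_real a powr (- w) * bessel_series (- w) a"
proof -
  define M where "M = (LINT x|lborel. exp (- Re w * x - exp x))"
  have "(\<lambda>n. M * ((a / (Re w + 1)) ^ n / fact n)) \<longlonglongrightarrow> M * 0"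
    by (intro tendsto_mult tendsto_const summable_LIMSEQ_zero summable_exp_real)
  then have lim: "(\<lambda>n. M * ((a / (Re w + 1)) ^ n / fact n)) \<longlonglongrightarrow> 0"
      by (simp only: mult_zero_right)
  have "(\<lambda>n. bessel_phi w a - bessel_phi_partial n w a) \<longlonglongrightarrow> 0"
  proof (rule Lim_null_comparison[OF always_eventually lim], rule allI)
    show "norm (bessel_phi w a - bessel_phi_partial n w a) \<le> M * ((a / (Re w + 1)) ^ n / fact n)" for n
      using norm_bessel_phi_minus_partial_le[OF w a, of n] by (simp only: M_def times_divide_eq_right)
  qed
  then have "(\<lambda>n. bessel_phi w a - (bessel_phi w a - bessel_phi_partial n w a))
      \<longlonglongrightarrow> bessel_phi w a - 0"
    by (intro tendsto_diff tendsto_const)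
  then have 1: "(\<lambda>n. bessel_phi_partial n w a) \<longlonglongrightarrow> bessel_phi w a" by simp
  have "(\<lambda>n. bessel_phi_partial n w a) \<longlonglongrightarrow>
      Gamma (- w) * bessel_series w a + Gamma w * of_real a powr (- w) * bessel_series (- w) a"
    unfolding bessel_phi_partial_def bessel_series_def using w a
    by (intro tendsto_add tendsto_mult tendsto_const summable_LIMSEQ summable_bessel) auto
  with 1 show ?thesis by (rule LIMSEQ_unique)
qed

lemma bessel_I_eq_bessel_series:
  assumes w: "Re w > - 1" and y: "y > 0"
  shows "bessel_I w (of_real y) = exp (w * of_real (ln (y / 2))) * rGamma (w + 1) * bessel_series w (y\<^sup>2 / 4)"
proof -
  have p: "(of_real y / 2) powr w = exp (w * of_real (ln (y / 2)))"
    using y by (simp add: powr_def Ln_of_real[symmetric] mult.commute)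
  have t: "(of_real y / 2) ^ (2 * k) * rGamma (w + of_nat k + 1) / fact k
      = rGamma (w + 1) * (of_real ((y\<^sup>2 / 4) ^ k) / (fact k * pochhammer (w + 1) k))" for k
  proof -
    have "rGamma (w + 1) = pochhammer (w + 1) k * rGamma (w + of_nat k + 1)"
      using pochhammer_rGamma[of "w + 1" k] by (simp add: add_ac)
    moreover have "(of_real y / 2) ^ (2 * k) = complex_of_real ((y\<^sup>2 / 4) ^ k)"
      by (simp add: power_mult power_divide)
    ultimately show ?thesis using pochhammer_nonzero[OF w, of k] by simp
  qed
  have "(\<Sum>k. (of_real y / 2) ^ (2 * k) * rGamma (w + of_nat k + 1) / fact k)
      = rGamma (w + 1) * bessel_series w (y\<^sup>2 / 4)"
    unfolding t bessel_series_def using w by (intro suminf_mult summable_bessel) auto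
  then show ?thesis unfolding bessel_I_def p by simp
qed

lemma sin_pi_nonzero:
  assumes "\<bar>Re w\<bar> < 1" "w \<noteq> 0" shows "sin (of_real pi * w) \<noteq> 0"
proof
  assume "sin (of_real pi * w) = 0"
  then obtain n :: int where "of_real pi * w = of_real (of_int n * pi)" unfolding sin_eq_0 by auto
  then have w: "w = of_int n" by (simp add: mult.commute)
  then have "\<bar>n\<bar> < 1" using assms by simp
  then show False using w assms by simp
qed

definition bessel_quotient :: "real \<Rightarrow> complex \<Rightarrow> complex" where
  "bessel_quotient y w = of_real pi / 2 * (bessel_I (- w) (of_real y)
      - bessel_I w (of_real y)) / sin (of_real pi * w)"

text \<open>The reflection formula identifies the coefficients \<open>Gamma (- w)\<close> and \<open>Gamma w\<close> of the two power series with
those in the quotient.\<close>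

lemma bessel_quotient_left:
  assumes w: "- 1 < Re w" "Re w < 0" and y: "y > 0"
  shows "bessel_quotient y w = macdonald w y"
proof -
  define E where "E = exp (w * of_real (ln (y / 2)))"
  have E: "E \<noteq> 0" "exp (- w * of_real (ln (y / 2))) = 1 / E" by (auto simp: E_def exp_minus inverse_eq_divide)
  have lnq: "ln (y\<^sup>2 / 4) / 2 = ln (y / 2)"
  proof -
    have "ln ((y / 2) ^ 2) = 2 * ln (y / 2)" using y by (subst ln_realpow) auto
    then show ?thesis by (simp add: power_divide)
  qed
  have sq: "2 * sqrt (y\<^sup>2 / 4) = y" using y by (simp add: real_sqrt_divide)
  have sn: "sin (of_real pi * w) \<noteq> 0" using w by (intro sin_pi_nonzero) auto
  have "bessel_phi w (y\<^sup>2 / 4) = 2 * exp (- w * of_real (ln (y / 2))) * macdonald w y"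
    using bessel_phi_eq_macdonald[of "y\<^sup>2 / 4" w] y unfolding lnq sq by simp
  then have mac: "macdonald w y = E / 2 * bessel_phi w (y\<^sup>2 / 4)" using E by simp
  have pw: "of_real (y\<^sup>2 / 4) powr (- w) = 1 / (E * E)"
  proof -
    have "complex_of_real (y\<^sup>2 / 4) powr (- w) = exp (- w * of_real (2 * (ln (y\<^sup>2 / 4) / 2)))"
      using y by (simp add: powr_def Ln_of_real[symmetric])
    also have "\<dots> = exp (- w * of_real (ln (y / 2)) + - w * of_real (ln (y / 2)))"
      unfolding lnq by (simp add: algebra_simps)
    finally show ?thesis unfolding exp_add E by simp
  qed
  have G1: "Gamma w = of_real pi / sin (of_real pi * w) * rGamma (1 - w)"
  proof -
    have "1 - w \<notin> \<int>\<^sub>\<le>\<^sub>0" using w by (auto simp: complex_eq_iff elim!: nonpos_Ints_cases)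
    then have "rGamma (1 - w) \<noteq> 0" by (simp add: rGamma_eq_zero_iff)
    then have "Gamma w * Gamma (1 - w) * rGamma (1 - w) = Gamma w" by (simp add: Gamma_def)
    then show ?thesis unfolding Gamma_reflection_complex by simp
  qed
  have G2: "Gamma (- w) = - of_real pi / sin (of_real pi * w) * rGamma (1 + w)"
  proof -
    have "1 + w \<notin> \<int>\<^sub>\<le>\<^sub>0" using w by (auto simp: complex_eq_iff elim!: nonpos_Ints_cases)
    then have "rGamma (1 + w) \<noteq> 0" by (simp add: rGamma_eq_zero_iff)
    then have "Gamma (- w) * Gamma (1 - (- w)) * rGamma (1 + w) = Gamma (- w)" by (simp add: Gamma_def)
    then show ?thesis unfolding Gamma_reflection_complex by simp
  qed
  have "bessel_quotient y w = of_real pi / 2 * (1 / E * rGamma (1 - w) * bessel_series (- w) (y\<^sup>2 / 4)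
      - E * rGamma (1 + w) * bessel_series w (y\<^sup>2 / 4)) / sin (of_real pi * w)"
    unfolding bessel_quotient_def using w y
    by (simp only: bessel_I_eq_bessel_series[of w y] bessel_I_eq_bessel_series[of "- w" y] E E_def[symmetric]
        uminus_complex.sel)
       (simp add: E add.commute)
  also have "\<dots> = E / 2 * (Gamma (- w) * bessel_series w (y\<^sup>2 / 4)
      + Gamma w * of_real (y\<^sup>2 / 4) powr (- w) * bessel_series (- w) (y\<^sup>2 / 4))"
    unfolding pw G1 G2 using E(1) sn by (simp add: field_simps)
  also have "\<dots> = macdonald w y"
    unfolding mac using bessel_phi_eq_bessel_series[OF w, of "y\<^sup>2 / 4"] y by simp
  finally show ?thesis .
qed

lemma bessel_quotient_minus: "bessel_quotient y (- w) = bessel_quotient y w"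
  unfolding bessel_quotient_def by (simp add: right_diff_distrib diff_divide_distrib)

text \<open>On the imaginary axis the integral defining \<open>Gamma (- w)\<close> diverges and the Picard argument breaks down. Both
sides are continuous in the order, so the identity is inherited from the left; on the right half of the
strip it follows by symmetry.\<close>

lemma bessel_quotient_eq_macdonald:
  assumes w: "\<bar>Re w\<bar> < 1 / 2" "w \<noteq> 0" and y: "y > 0"
  shows "bessel_quotient y w = macdonald w y"
proof -
  consider "Re w < 0" | "Re w > 0" | "Re w = 0" by linarith
  then show ?thesis
  proof cases
    case 1
    then show ?thesis using w y by (intro bessel_quotient_left) auto
  next
    case 2
    then show ?thesis using w y bessel_quotient_left[of "- w" y] by (simp add: bessel_quotient_minus macdonald_minus)
  next
    case 3
    define S where "S = {w::complex. \<bar>Re w\<bar> \<le> 1/2} - {0}"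
    define Q where "Q = (\<lambda>w. of_real pi / 2
        * (exp (- w * of_real (ln (y / 2))) * rGamma (- w + 1) * bessel_series (- w) (y\<^sup>2 / 4)
        - exp (w * of_real (ln (y / 2))) * rGamma (w + 1) * bessel_series w (y\<^sup>2 / 4)) / sin (of_real pi * w))"
    have Q: "bessel_quotient y v = Q v" if "v \<in> S" for v
      unfolding bessel_quotient_def Q_def using that y
      by (simp only: S_def bessel_I_eq_bessel_series[of v y] bessel_I_eq_bessel_series[of "- v" y])
          (auto simp: bessel_I_eq_bessel_series)
    have cs: "continuous_on S (\<lambda>w. bessel_series w (y\<^sup>2 / 4))"
      by (rule continuous_on_subset[OF continuous_on_bessel_series]) (auto simp: S_def)
    have cs': "continuous_on S (\<lambda>w. bessel_series (- w) (y\<^sup>2 / 4))"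
    proof (rule continuous_on_compose2[where g = "\<lambda>w. bessel_series w (y\<^sup>2 / 4)" and f = uminus])
      show "continuous_on {w. \<bar>Re w\<bar> \<le> 1/2} (\<lambda>w. bessel_series w (y\<^sup>2 / 4))"
        by (rule continuous_on_bessel_series) simp
      show "continuous_on S uminus" by (intro continuous_intros)
      show "uminus ` S \<subseteq> {w. \<bar>Re w\<bar> \<le> 1/2}" by (auto simp: S_def)
    qed
    have sn: "sin (of_real pi * w) \<noteq> 0" if "w \<in> S" for w
      by (rule sin_pi_nonzero) (use that in \<open>auto simp: S_def\<close>)
    have cQ: "continuous_on S Q"
    proof -
      have r: "continuous_on S (\<lambda>w. rGamma (w + 1))" "continuous_on S (\<lambda>w. rGamma (- w + 1))"
        by (rule continuous_on_compose2[OF continuous_on_rGamma[of UNIV]]; intro continuous_intros subset_UNIV)+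
      have e: "continuous_on S (\<lambda>w. exp (w * of_real (ln (y / 2))))" "continuous_on S (\<lambda>w. exp (- w
          * of_real (ln (y / 2))))"
        by (intro continuous_intros)+
      have "continuous_on S (\<lambda>w. sin (of_real pi * w))" by (intro continuous_intros)
      then show ?thesis
        unfolding Q_def
        by (rule continuous_on_divide[OF continuous_on_mult[OF continuous_on_const continuous_on_diff[OF
              continuous_on_mult[OF continuous_on_mult[OF e(2) r(2)] cs']
                  continuous_on_mult[OF continuous_on_mult[OF e(1) r(1)] cs]]]])
           (use sn in blast)
    qed
    have cm: "continuous_on S (\<lambda>w. macdonald w y)"
      by (rule continuous_on_subset[OF continuous_on_macdonald[OF y, of "1/2"]]) (auto simp: S_def)
    \<comment> \<open>approach \<open>w\<close> from the left, staying inside the strip\<close>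
    define v where "v = (\<lambda>n. w - of_real (1 / real (n + 3)))"
    have vS: "v n \<in> S" and vR: "- 1 < Re (v n)" "Re (v n) < 0" for n
      using 3 by (auto simp: v_def S_def field_simps complex_eq_iff)
    have vw: "v \<longlonglongrightarrow> w - of_real 0"
      unfolding v_def by (intro tendsto_intros) real_asymp
    then have vw: "v \<longlonglongrightarrow> w" by simp
    have wS: "w \<in> S" using w 3 by (auto simp: S_def)
    have "(\<lambda>n. Q (v n)) \<longlonglongrightarrow> Q w"
      by (rule continuous_on_tendsto_compose[OF cQ vw wS]) (use vS in auto)
    moreover have "(\<lambda>n. macdonald (v n) y) \<longlonglongrightarrow> macdonald w y"
      by (rule continuous_on_tendsto_compose[OF cm vw wS]) (use vS in auto)
    moreover have "Q (v n) = macdonald (v n) y" for n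
      using bessel_quotient_left[OF vR y] Q[OF vS] by simp
    ultimately show ?thesis using Q[OF wS] LIMSEQ_unique by auto
  qed
qed

text \<open>Order zero is the only integer order on the imaginary axis. There the limit in the definition exists because
the integral depends continuously on the order in a full neighbourhood of zero.\<close>

theorem bessel_K_imaginary:
  assumes y: "y > 0"
  shows "bessel_K (\<i> * of_real \<tau>) (of_real y) = macdonald (\<i> * of_real \<tau>) y"
proof (cases "\<tau> = 0")
  case True
  have "(bessel_quotient y \<longlongrightarrow> macdonald 0 y) (at 0)"
  proof (rule Lim_transform_eventually)
    have "continuous_on {w. \<bar>Re w\<bar> \<le> 1} (\<lambda>w. macdonald w y)"
        by (rule continuous_on_macdonald[OF y])
    then have "continuous_on (ball 0 1) (\<lambda>w. macdonald w y)"
      by (rule continuous_on_subset) (auto intro: order.trans[OF abs_Re_le_cmod])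
    then have "isCont (\<lambda>w. macdonald w y) 0" by (rule continuous_on_interior) auto
    then show "((\<lambda>w. macdonald w y) \<longlongrightarrow> macdonald 0 y) (at 0)" by (simp add: isCont_def)
    show "\<forall>\<^sub>F w in at 0. macdonald w y = bessel_quotient y w"
      unfolding eventually_at
    proof (intro exI[of _ "1/2"] conjI ballI impI)
      fix w :: complex assume "w \<noteq> 0 \<and> dist w 0 < 1 / 2"
      then have "w \<noteq> 0" and n: "norm w < 1 / 2" by simp_all
      moreover have "\<bar>Re w\<bar> < 1 / 2" using n abs_Re_le_cmod[of w] by linarith
      ultimately show "macdonald w y = bessel_quotient y w"
        using bessel_quotient_eq_macdonald[OF _ _ y] by simp
    qed simp
  qed
  then have "Lim (at 0) (bessel_quotient y) = macdonald 0 y" by (intro tendsto_Lim) auto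
  then show ?thesis using True by (simp add: bessel_K_def bessel_quotient_def[abs_def])
next
  case False
  have "\<i> * of_real \<tau> \<notin> \<int>" using False by (auto elim!: Ints_cases simp: complex_eq_iff)
  then show ?thesis
    using bessel_quotient_eq_macdonald[of "\<i> * of_real \<tau>" y] y False
    by (simp add: bessel_K_def bessel_quotient_def)
qed

section \<open>The kernel of imaginary order\<close>

text \<open>The kernel of the Kontorovich-Lebedev transform.\<close>

abbreviation KL :: "real \<Rightarrow> real \<Rightarrow> complex" where
  "KL \<tau> y \<equiv> macdonald (\<i> * of_real \<tau>) y"

text \<open>The Macdonald function of order zero as a real number. It majorises the kernels of all imaginary orders.\<close>

definition K0 :: "real \<Rightarrow> real" where
  "K0 y = (LINT u|lborel. exp (- (y * cosh u))) / 2"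

lemma measurable_cosh [measurable (raw)]:
  fixes f :: "'a \<Rightarrow> real" assumes "f \<in> borel_measurable M"
  shows "(\<lambda>x. cosh (f x)) \<in> borel_measurable M"
  using assms unfolding cosh_field_def by measurable

lemma cosh_Complex: "cosh (Complex u t) = Complex (cosh u * cos t) (sinh u * sin t)"
  by (auto simp: complex_eq_iff cosh_field_def sinh_field_def Re_exp Im_exp field_simps)

lemma cosh_complex_of_real: "cosh (complex_of_real u) = of_real (cosh u)"
  using cosh_Complex[of u 0] by (simp flip: complex_of_real_def)

lemma sinh_Complex: "sinh (Complex u t) = Complex (sinh u * cos t) (cosh u * sin t)"
  by (auto simp: complex_eq_iff cosh_field_def sinh_field_def Re_exp Im_exp field_simps)

lemma kl_minus: "KL (- \<tau>) y = KL \<tau> y"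
  using macdonald_minus[of "\<i> * of_real \<tau>" y] by simp

lemma measurable_kl [measurable]: "(\<lambda>p. KL (fst p) (snd p))
    \<in> borel_measurable (borel \<Otimes>\<^sub>M borel)"
  unfolding macdonald_def by measurable

lemma measurable_kl' [measurable (raw)]:
  assumes [measurable]: "f \<in> borel_measurable M" "g \<in> borel_measurable M"
  shows "(\<lambda>x. KL (f x) (g x)) \<in> borel_measurable M"
proof -
  have "(\<lambda>x. (f x, g x)) \<in> M \<rightarrow>\<^sub>M borel \<Otimes>\<^sub>M borel" by measurable
  from measurable_compose[OF this measurable_kl] show ?thesis by simp
qed

lemma integrable_K0:
  fixes y :: real assumes "y > 0" shows "integrable lborel (\<lambda>u. exp (- (y * cosh u)))"
  using integrable_norm[OF integrable_macdonald[OF assms, of 0]] by simp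

lemma norm_kl_le: assumes "y > 0" shows "norm (KL \<tau> y) \<le> K0 y"
proof -
  have "norm (LINT u|lborel. exp (\<i> * of_real \<tau> * of_real u - of_real (y * cosh u)))
      \<le> (LINT u|lborel. exp (- (y * cosh u)))"
    using assms by (intro Bochner_Integration.integral_norm_bound_integral integrable_macdonald integrable_K0) auto
  then show ?thesis by (simp add: macdonald_def K0_def norm_divide)
qed

text \<open>The bound separates the variables, as Fubini's theorem requires. Half of the exponent is kept for the
decay in \<open>y\<close>; the other half is weakened by \<open>exp (- v) \<le> v^(- \<epsilon>)\<close>. The logarithmic singularity of
\<open>K0\<close> at zero is thereby overestimated by an arbitrarily small negative power, which the Mellin integrals
tolerate.\<close>

lemma exp_minus_cosh_le_product:
  fixes y u \<epsilon> :: real assumes y: "y > 0" and \<epsilon>: "0 < \<epsilon>" "\<epsilon> \<le> 1"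
  shows "exp (- (y * cosh u))
      \<le> exp (- (y / 2)) * (y / 4) powr (- \<epsilon>) * exp (- (\<epsilon> * \<bar>u\<bar>))"
proof -
  have c1: "cosh u \<ge> 1" by (rule cosh_real_ge_1)
  have c2: "exp \<bar>u\<bar> / 2 \<le> cosh u"
  proof -
    have "exp \<bar>u\<bar> \<le> 2 * cosh \<bar>u\<bar>" by (simp add: cosh_field_def)
    then show ?thesis by simp
  qed
  have "y / 2 + y / 4 * exp \<bar>u\<bar> \<le> y * cosh u"
  proof -
    have "y / 2 * 1 + y / 2 * (exp \<bar>u\<bar> / 2) \<le> y / 2 * cosh u + y / 2 * cosh u"
      using y c1 c2 by (intro add_mono mult_left_mono) auto
    then show ?thesis by simp
  qed
  then have "exp (- (y * cosh u)) \<le> exp (- (y / 2)) * exp (- (y / 4 * exp \<bar>u\<bar>))"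
    by (simp add: exp_add[symmetric])
  also have "\<dots> \<le> exp (- (y / 2)) * (y / 4 * exp \<bar>u\<bar>) powr (- \<epsilon>)"
    using y \<epsilon> by (intro mult_left_mono exp_minus_le_powr) auto
  also have "(y / 4 * exp \<bar>u\<bar>) powr (- \<epsilon>)
      = (y / 4) powr (- \<epsilon>) * exp (- (\<epsilon> * \<bar>u\<bar>))"
    using y by (simp only: powr_mult exp_powr_real) (simp add: mult.commute)
  finally show ?thesis by (simp add: mult.assoc)
qed

lemma K0_nonneg: "K0 y \<ge> 0"
  unfolding K0_def by (intro divide_nonneg_nonneg Bochner_Integration.integral_nonneg) auto

lemma K0_le:
  fixes \<epsilon> :: real assumes \<epsilon>: "0 < \<epsilon>" "\<epsilon> \<le> 1"
  obtains C where "C \<ge> 0" "\<And>y. y > 0 \<Longrightarrow> K0 y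
      \<le> C * (exp (- (y / 2)) * (y / 4) powr (- \<epsilon>))"
proof (rule that[of "(LINT u|lborel. exp (- (\<epsilon> * \<bar>u\<bar>))) / 2"])
  show "(LINT u|lborel. exp (- (\<epsilon> * \<bar>u\<bar>))) / 2 \<ge> 0"
    by (intro divide_nonneg_nonneg Bochner_Integration.integral_nonneg) auto
  fix y :: real assume y: "y > 0"
  have "(LINT u|lborel. exp (- (y * cosh u)))
      \<le> (LINT u|lborel. exp (- (y / 2)) * (y / 4) powr (- \<epsilon>) * exp (- (\<epsilon> * \<bar>u\<bar>)))"
    using y \<epsilon> by (intro integral_mono integrable_K0 integrable_mult_right integrable_exp_minus_abs
        exp_minus_cosh_le_product) auto
  also have "\<dots> = exp (- (y / 2)) * (y / 4) powr (- \<epsilon>)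
      * (LINT u|lborel. exp (- (\<epsilon> * \<bar>u\<bar>)))"
    by (rule integral_mult_right_zero)
  finally show "K0 y \<le> (LINT u|lborel. exp (- (\<epsilon> * \<bar>u\<bar>))) / 2
      * (exp (- (y / 2)) * (y / 4) powr (- \<epsilon>))"
    by (simp add: K0_def mult_ac)
qed

lemma integrable_moment_K0:
  fixes r c :: real assumes r: "r > 0" and c: "c > 0"
  shows "integrable lborel (\<lambda>x. exp (r * x) * K0 (c * exp x))"
proof -
  \<comment> \<open>\<open>\<epsilon> < r\<close> leaves a positive exponent for \<open>x\<close> tending to minus infinity\<close>
  define \<epsilon> where "\<epsilon> = min (r / 2) 1"
  have \<epsilon>: "0 < \<epsilon>" "\<epsilon> \<le> 1" "\<epsilon> < r" using r
      by (auto simp: \<epsilon>_def min_def)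
  obtain C where C: "C \<ge> 0" "\<And>y. y > 0 \<Longrightarrow> K0 y
      \<le> C * (exp (- (y / 2)) * (y / 4) powr (- \<epsilon>))"
    using K0_le[OF \<epsilon>(1,2)] by blast
  show ?thesis
  proof (rule Bochner_Integration.integrable_bound)
    show "integrable lborel (\<lambda>x. (C * (c / 4) powr (- \<epsilon>)) * exp ((r - \<epsilon>) * x
        - (c / 2) * exp x))"
      using \<epsilon> c by (intro integrable_mult_right integrable_exp_minus_exp) auto
    show "(\<lambda>x. exp (r * x) * K0 (c * exp x)) \<in> borel_measurable lborel" unfolding K0_def by measurable
    show "AE x in lborel. norm (exp (r * x) * K0 (c * exp x))
        \<le> norm ((C * (c / 4) powr (- \<epsilon>)) * exp ((r - \<epsilon>) * x - (c / 2) * exp x))"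
    proof (rule AE_I2)
      fix x :: real
      have "exp (r * x) * K0 (c * exp x)
          \<le> exp (r * x) * (C * (exp (- (c * exp x / 2)) * (c * exp x / 4) powr (- \<epsilon>)))"
        using c by (intro mult_left_mono C(2)) auto
      also have "(c * exp x / 4) powr (- \<epsilon>) = (c / 4) powr (- \<epsilon>) * exp (- (\<epsilon> * x))"
      proof -
        have "c * exp x / 4 = (c / 4) * exp x" by simp
        then show ?thesis using c by (simp only: powr_mult exp_powr_real) (simp add: mult.commute)
      qed
      also have "exp (r * x) * (C
          * (exp (- (c * exp x / 2)) * ((c / 4) powr (- \<epsilon>) * exp (- (\<epsilon> * x)))))
          = (C * (c / 4) powr (- \<epsilon>)) * (exp (r * x) * exp (- (c * exp x / 2)) * exp (- (\<epsilon> * x)))"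
        by (simp only: mult_ac)
      also have "exp (r * x) * exp (- (c * exp x / 2)) * exp (- (\<epsilon> * x))
          = exp ((r - \<epsilon>) * x - (c / 2) * exp x)"
        by (simp add: exp_add[symmetric] algebra_simps)
      finally have "exp (r * x) * K0 (c * exp x)
          \<le> (C * (c / 4) powr (- \<epsilon>)) * exp ((r - \<epsilon>) * x - (c / 2) * exp x)" .
      then show "norm (exp (r * x) * K0 (c * exp x))
          \<le> norm ((C * (c / 4) powr (- \<epsilon>)) * exp ((r - \<epsilon>) * x - (c / 2) * exp x))"
        using C(1) by (simp add: abs_mult K0_nonneg)
    qed
  qed
qed

lemma cos_le_cos_abs:
  assumes "\<bar>t\<bar> \<le> \<theta>" "\<theta> < pi / 2" shows "cos \<theta> \<le> cos t"
proof -
  have "cos \<theta> \<le> cos \<bar>t\<bar>" using assms by (intro cos_monotone_0_pi_le) auto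
  then show ?thesis by simp
qed

text \<open>The real part of \<open>cosh (u + \<i> \<theta>)\<close> is \<open>cosh u cos \<theta>\<close>, so the line of integration may be moved up to, but not
onto, \<open>\<theta> = \<pi> / 2\<close>. On the new line the oscillating factor has modulus \<open>exp (- \<theta> \<tau>)\<close>.\<close>

lemma kl_shift:
  assumes y: "y > 0" and \<theta>: "0 \<le> \<theta>" "\<theta> < pi / 2"
  shows "KL \<tau> y = (LINT u|lborel. exp (\<i> * of_real \<tau> * Complex u \<theta>
      - of_real y * cosh (Complex u \<theta>))) / 2"
proof -
  have c0: "cos \<theta> > 0" using \<theta> by (intro cos_gt_zero_pi) auto
  define f where "f = (\<lambda>w. exp (\<i> * of_real \<tau> * w - of_real y * cosh w))"
  have cosh_holo: "cosh holomorphic_on (UNIV :: complex set)"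
    unfolding cosh_field_def[abs_def] by (intro holomorphic_intros) auto
  have holo: "f holomorphic_on UNIV"
    unfolding f_def by (intro holomorphic_intros cosh_holo)
  have b: "norm (f (Complex u t))
      \<le> exp (\<bar>\<tau>\<bar> * \<theta>) * exp (1 / (y * cos \<theta>)) * exp (- \<bar>u\<bar>)" if "0 \<le>
          t" "t \<le> \<theta>" for u t
  proof -
    have "norm (f (Complex u t)) = exp (- (\<tau> * t)) * exp (- (y * cos t * cosh u))"
      by (simp add: f_def cosh_Complex exp_add[symmetric] algebra_simps)
    also have "\<dots> \<le> exp (\<bar>\<tau>\<bar> * \<theta>) * exp (- (y * cos \<theta> * cosh u))"
    proof -
      have "- (\<tau> * t) \<le> \<bar>\<tau>\<bar> * t" using that
          by (metis abs_ge_minus_self abs_mult abs_of_nonneg)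
      also have "\<dots> \<le> \<bar>\<tau>\<bar> * \<theta>" using that by (intro mult_left_mono) auto
      finally have 1: "- (\<tau> * t) \<le> \<bar>\<tau>\<bar> * \<theta>" .
      have 2: "y * cos \<theta> * cosh u \<le> y * cos t * cosh u"
        using y that \<theta> by (intro mult_right_mono mult_left_mono cos_le_cos_abs) auto
      show ?thesis using 1 2 by (intro mult_mono) auto
    qed
    also have "exp (- (y * cos \<theta> * cosh u))
        \<le> exp (1\<^sup>2 / (y * cos \<theta>)) * exp (- (1 * \<bar>u\<bar>))"
      using y c0 by (intro exp_minus_cosh_le) auto
    finally show ?thesis by (simp add: mult_ac)
  qed
  have "(LINT u|lborel. f (Complex u 0)) = (LINT u|lborel. f (Complex u \<theta>))"
    by (rule integral_horizontal_shift[OF holo \<theta>(1) b])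
  moreover have "f (Complex u 0) = exp (\<i> * of_real \<tau> * of_real u - of_real (y * cosh u))" for u
    by (simp add: f_def cosh_complex_of_real complex_of_real_def[symmetric])
  ultimately show ?thesis by (simp add: macdonald_def f_def)
qed

lemma norm_kl_decay:
  assumes y: "y > 0" and \<theta>: "0 \<le> \<theta>" "\<theta> < pi / 2"
  shows "norm (KL \<tau> y) \<le> exp (- (\<theta> * \<bar>\<tau>\<bar>)) * K0 (y * cos \<theta>)"
proof -
  have c0: "cos \<theta> > 0" using \<theta> by (intro cos_gt_zero_pi) auto
  have *: "norm (KL t y) \<le> exp (- (\<theta> * t)) * K0 (y * cos \<theta>)" for t
  proof -
    have n: "norm (exp (\<i> * of_real t * Complex u \<theta> - of_real y * cosh (Complex u \<theta>)))
        = exp (- (\<theta> * t)) * exp (- ((y * cos \<theta>) * cosh u))" for u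
      by (simp add: cosh_Complex exp_add[symmetric] algebra_simps)
    have i: "integrable lborel (\<lambda>u. exp (- (\<theta> * t)) * exp (- ((y * cos \<theta>) * cosh u)))"
      using y c0 by (intro integrable_mult_right integrable_K0) auto
    have "norm (LINT u|lborel. exp (\<i> * of_real t * Complex u \<theta> - of_real y * cosh (Complex u \<theta>)))
        \<le> (LINT u|lborel. norm
            (exp (\<i> * of_real t * Complex u \<theta> - of_real y * cosh (Complex u \<theta>))))"
      by (rule integral_norm_bound)
    also have "\<dots> = exp (- (\<theta> * t)) * (LINT u|lborel. exp (- ((y * cos \<theta>) * cosh u)))"
      unfolding n by (rule integral_mult_right_zero)
    finally show ?thesis by (subst kl_shift[OF y \<theta>]) (simp add: K0_def norm_divide)
  qed
  show ?thesis
  proof (cases "\<tau> \<ge> 0")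
    case True
    then show ?thesis using *[of \<tau>] by simp
  next
    case False
    then show ?thesis using *[of "- \<tau>"] by (simp add: kl_minus del: of_real_minus)
  qed
qed

text \<open>For each fixed \<open>u\<close> in the integral representation of the kernel, the integral over \<open>x\<close> is a scaled Gamma
integral.\<close>

lemma integral_exp_kl:
  fixes z :: complex and c d :: real
  assumes z: "Re z > 0" and c: "c \<ge> 0" and d: "d > 0"
  shows "(LINT x|lborel. exp (z * of_real x - of_real (c * exp x)) * KL \<tau> (d * exp x))
       = Gamma z / 2 * (LINT u|lborel. exp (\<i> * of_real (\<tau> * u) - z * of_real (ln (c + d * cosh u))))"
proof -
  define \<epsilon> where "\<epsilon> = min (Re z / 2) 1"
  have \<epsilon>: "0 < \<epsilon>" "\<epsilon> \<le> 1" "\<epsilon> < Re z" using z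
      by (auto simp: \<epsilon>_def min_def)
  define f where "f = (\<lambda>x u. exp (\<i> * of_real (\<tau> * u)) * exp (z * of_real x
      - of_real ((c + d * cosh u) * exp x)))"
  have mf [measurable]: "case_prod f \<in> borel_measurable (lborel \<Otimes>\<^sub>M lborel)"
    unfolding f_def cosh_field_def by measurable
  have ip: "integrable lborel (\<lambda>x. (d / 4) powr (- \<epsilon>) * exp ((Re z - \<epsilon>) * x
      - (d / 2) * exp x))"
    using \<epsilon> d by (intro integrable_mult_right integrable_exp_minus_exp) auto
  have iq: "integrable lborel (\<lambda>u. exp (- (\<epsilon> * \<bar>u\<bar>)))"
      by (rule integrable_exp_minus_abs[OF \<epsilon>(1)])
  have le: "norm (f x u) \<le> ((d / 4) powr (- \<epsilon>) * exp ((Re z - \<epsilon>) * x - (d / 2) * exp x))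
      * exp (- (\<epsilon> * \<bar>u\<bar>))" for x u
  proof -
    have "norm (f x u) = exp (Re z * x) * exp (- (c * exp x)) * exp (- ((d * exp x) * cosh u))"
      by (simp add: f_def norm_mult exp_add[symmetric] algebra_simps)
    also have "\<dots> \<le> exp (Re z * x) * 1 * (exp (- ((d * exp x) / 2)) * ((d * exp x) / 4) powr (- \<epsilon>)
        * exp (- (\<epsilon> * \<bar>u\<bar>)))"
      using c d \<epsilon> by (intro mult_mono exp_minus_cosh_le_product mult_nonneg_nonneg) auto
    also have "((d * exp x) / 4) powr (- \<epsilon>) = (d / 4) powr (- \<epsilon>) * exp (- (\<epsilon> * x))"
    proof -
      have "d * exp x / 4 = (d / 4) * exp x" by simp
      then show ?thesis using d by (simp only: powr_mult exp_powr_real) (simp add: mult.commute)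
    qed
    also have "exp (Re z * x) * 1
        * (exp (- ((d * exp x) / 2)) * ((d / 4) powr (- \<epsilon>) * exp (- (\<epsilon> * x))) * exp
            (- (\<epsilon> * \<bar>u\<bar>)))
        = (d / 4) powr (- \<epsilon>) * (exp (Re z * x) * exp (- ((d * exp x) / 2)) * exp (- (\<epsilon> * x))) * exp
            (- (\<epsilon> * \<bar>u\<bar>))"
      by (simp only: mult_1_right mult_ac)
    also have "exp (Re z * x) * exp (- ((d * exp x) / 2)) * exp (- (\<epsilon> * x))
        = exp ((Re z - \<epsilon>) * x - (d / 2) * exp x)"
      by (simp add: exp_add[symmetric] algebra_simps)
    finally show ?thesis .
  qed
  have in1: "(LINT u|lborel. f x u) = 2 * (exp (z * of_real x - of_real (c * exp x)) * KL \<tau> (d * exp x))" for x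
  proof -
    have "f x u = exp (z * of_real x - of_real (c * exp x)) * exp (\<i> * of_real \<tau> * of_real u
        - of_real ((d * exp x) * cosh u))" for u
      by (simp add: f_def exp_add[symmetric] algebra_simps)
    then show ?thesis by (simp add: macdonald_def)
  qed
  have in2: "(LINT x|lborel. f x u)
      = Gamma z * exp (\<i> * of_real (\<tau> * u) - z * of_real (ln (c + d * cosh u)))" for u
  proof -
    have "c + d * cosh u > 0" using c d cosh_real_pos[of u] by (simp add: add_nonneg_pos)
    from integral_Gamma_exp_scaled[OF z this]
    have "(LINT x|lborel. f x u)
        = exp (\<i> * of_real (\<tau> * u)) * (Gamma z * exp (- (z * of_real (ln (c + d * cosh u)))))"
      unfolding f_def by (simp only: integral_mult_right_zero)
    also have "\<dots> = Gamma z * (exp (\<i> * of_real (\<tau> * u)) * exp (- (z * of_real (ln (c + d * cosh u)))))"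
      by (simp only: mult_ac)
    finally show ?thesis by (simp only: exp_add[symmetric] diff_conv_add_uminus)
  qed
  have "(LINT x|lborel. LINT u|lborel. f x u) = (LINT u|lborel. LINT x|lborel. f x u)"
    by (rule fubini_dominated_by_product(1)[OF mf ip iq le, symmetric])
  then have "2 * (LINT x|lborel. exp (z * of_real x - of_real (c * exp x)) * KL \<tau> (d * exp x))
     = Gamma z * (LINT u|lborel. exp (\<i> * of_real (\<tau> * u) - z * of_real (ln (c + d * cosh u))))"
    unfolding in1 in2 by (simp only: integral_mult_right_zero)
  then show ?thesis by (simp add: field_simps)
qed

text \<open>The Mellin transform at \<open>z\<close> of \<open>exp (- y / 2) K(\<tau>, y / 2)\<close>, with \<open>y = exp x\<close>.\<close>

definition kl_mellin :: "complex \<Rightarrow> real \<Rightarrow> complex" where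
  "kl_mellin z \<tau> = (LINT x|lborel. exp (z * of_real x - of_real (1/2 * exp x)) * KL \<tau> (1/2 * exp x))"

text \<open>Since \<open>(1 + cosh u) / 2 = cosh (u / 2)^2\<close>, both sides are Fourier integrals of \<open>cosh (u / 2)^(-2 z)\<close>. The kernel
of order \<open>2 \<i> \<tau>\<close> on the right exhibits a decay in \<open>\<tau>\<close> that is twice as fast as the one visible on the left.\<close>

lemma kl_mellin_doubling:
  assumes z: "Re z > 0"
  shows "Gamma (2 * z) * kl_mellin z \<tau>
      = 2 * Gamma z * (LINT x|lborel. exp (2 * z * of_real x) * KL (2 * \<tau>) (exp x))"
proof -
  define I where "I = (LINT v|lborel. exp (\<i> * of_real (2 * \<tau> * v) - 2 * z * of_real (ln (cosh v))))"
  have "(LINT u|lborel. exp (\<i> * of_real (\<tau> * u) - z * of_real (ln (1/2 + 1/2 * cosh u)))) = 2 * I"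
  proof -
    have e: "exp (\<i> * of_real (\<tau> * (0 + 2 * v)) - z * of_real (ln (1/2 + 1/2 * cosh (0 + 2 * v))))
        = exp (\<i> * of_real (2 * \<tau> * v) - 2 * z * of_real (ln (cosh v)))" for v
    proof -
      have "1/2 + 1/2 * cosh (2 * v) = cosh v ^ 2"
        by (simp add: cosh_double_cosh diff_divide_distrib)
      then have "ln (1/2 + 1/2 * cosh (0 + 2 * v)) = 2 * ln (cosh v)" by (simp add: ln_realpow)
      then show ?thesis by (simp only:) (simp add: mult_ac)
    qed
    have "(LINT u|lborel. exp (\<i> * of_real (\<tau> * u) - z * of_real (ln (1/2 + 1/2 * cosh u))))
        = of_real \<bar>2\<bar> * (LINT v|lborel. exp
            (\<i> * of_real (\<tau> * (0 + 2 * v)) - z * of_real (ln (1/2 + 1/2 * cosh (0 + 2 * v)))))"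
      by (subst lborel_integral_real_affine[where c = 2 and t = 0]) (auto simp: scaleR_conv_of_real)
    then show ?thesis unfolding e I_def by simp
  qed
  then have "kl_mellin z \<tau> = Gamma z / 2 * (2 * I)"
    unfolding kl_mellin_def using integral_exp_kl[OF z, of "1/2" "1/2" \<tau>] by simp
  moreover have "(LINT x|lborel. exp (2 * z * of_real x) * KL (2 * \<tau>) (exp x)) = Gamma (2 * z) / 2 * I"
    using integral_exp_kl[of "2 * z" 0 1 "2 * \<tau>"] z by (simp add: I_def)
  ultimately show ?thesis by (simp only:) simp
qed

section \<open>Index integral of a product of two kernels\<close>

lemma borel_measurable_lborel_continuous:
  fixes f :: "real \<Rightarrow> complex"
  shows "continuous_on UNIV f \<Longrightarrow> f \<in> borel_measurable lborel"
  by (simp add: borel_measurable_continuous_onI)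

lemma holomorphic_on_cosh [holomorphic_intros]:
  "f holomorphic_on A \<Longrightarrow> (\<lambda>w. cosh (f w)) holomorphic_on A"
  unfolding cosh_field_def by (intro holomorphic_intros) auto

lemma holomorphic_on_sinh [holomorphic_intros]:
  "f holomorphic_on A \<Longrightarrow> (\<lambda>w. sinh (f w)) holomorphic_on A"
  unfolding sinh_field_def by (intro holomorphic_intros) auto

lemma sinh_complex_of_real: "sinh (complex_of_real u) = of_real (sinh u)"
  using sinh_Complex[of u 0] by (simp flip: complex_of_real_def)

lemma norm_sinh_Complex_le: "norm (sinh (Complex u t)) \<le> cosh u"
proof -
  have "norm (sinh (Complex u t)) ^ 2 = (sinh u * cos t)\<^sup>2 + (cosh u * sin t)\<^sup>2"
    by (simp add: sinh_Complex cmod_power2)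
  also have "\<dots> = cosh u ^ 2 - (cos t)\<^sup>2"
  proof -
    have 1: "sinh u ^ 2 = cosh u ^ 2 - 1" by (simp add: sinh_square_eq)
    have 2: "(sin t)\<^sup>2 = 1 - (cos t)\<^sup>2" by (simp add: sin_squared_eq)
    show ?thesis unfolding power_mult_distrib 1 2 by (simp add: algebra_simps)
  qed
  also have "\<dots> \<le> cosh u ^ 2" by simp
  finally show ?thesis by (rule power2_le_imp_le) simp
qed

lemma abs_sinh_le_cosh: "\<bar>sinh u\<bar> \<le> cosh (u::real)"
  using norm_sinh_Complex_le[of u 0] by (simp add: sinh_Complex cmod_def)

lemma cosh_times_exp_minus_cosh_le:
  fixes y u :: real assumes y: "y > 0"
  shows "cosh u * exp (- (y * cosh u)) \<le> exp (4 / y) * exp (- \<bar>u\<bar>)"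
proof -
  have "cosh u \<le> exp \<bar>u\<bar>"
  proof -
    have "exp u \<le> exp \<bar>u\<bar>" "exp (- u) \<le> exp \<bar>u\<bar>" by auto
    moreover have "(A + B) / 2 \<le> C" if "A \<le> C" "B \<le> C" for A B C :: real using that by simp
    ultimately show ?thesis unfolding cosh_field_def by blast
  qed
  then have "cosh u * exp (- (y * cosh u))
      \<le> exp \<bar>u\<bar> * (exp (2\<^sup>2 / y) * exp (- (2 * \<bar>u\<bar>)))"
    using y by (intro mult_mono exp_minus_cosh_le) auto
  also have "\<dots> = exp (4 / y) * exp (- \<bar>u\<bar>)"
    by (simp add: exp_add[symmetric])
  finally show ?thesis .
qed

text \<open>The factor \<open>\<tau>\<close> of the index integral arises here, by parts from the derivative of \<open>exp (- y cosh u)\<close>.\<close>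

lemma integral_sinh_exp_cosh:
  assumes y: "y > 0"
  shows "(LINT u|lborel. - of_real (y * sinh u) * exp (\<i> * of_real \<tau> * of_real u - of_real (y * cosh u)))
      = - 2 * \<i> * of_real \<tau> * KL \<tau> y"
proof -
  define E where "E = (\<lambda>u. exp (\<i> * of_real \<tau> * of_real u - of_real (y * cosh u)))"
  have nE: "norm (E u) = exp (- (y * cosh u))" for u by (simp add: E_def)
  have cE: "continuous_on UNIV E" unfolding E_def by (intro continuous_intros)
  have iE: "integrable lborel E" unfolding E_def by (rule integrable_macdonald[OF y])
  have iS: "integrable lborel (\<lambda>u. - of_real (y * sinh u) * E u)"
  proof (rule integrable_dominated_by_exp_abs[of _ 1 "y * exp (4 / y)"])
    have "continuous_on UNIV (\<lambda>u. - of_real (y * sinh u) * E u)" by (intro continuous_intros cE)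
    then show "(\<lambda>u. - of_real (y * sinh u) * E u) \<in> borel_measurable lborel"
      by (rule borel_measurable_lborel_continuous)
    show "norm (- of_real (y * sinh u) * E u) \<le> y * exp (4 / y) * exp (- (1 * \<bar>u\<bar>))" for u
    proof -
      have "\<bar>sinh u\<bar> \<le> cosh u" by (rule abs_sinh_le_cosh)
      then have "y * (\<bar>sinh u\<bar> * exp (- (y * cosh u))) \<le> y * (cosh u * exp (- (y * cosh u)))"
        using y by (intro mult_left_mono mult_right_mono) auto
      also have "\<dots> \<le> y * (exp (4 / y) * exp (- \<bar>u\<bar>))"
        using y by (intro mult_left_mono cosh_times_exp_minus_cosh_le) auto
      finally show ?thesis using y by (simp add: norm_mult nE abs_mult mult_ac)
    qed
  qed simp
  have "(LINT u|lborel. (\<i> * of_real \<tau> - of_real (y * sinh u)) * E u) = 0"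
  proof (rule integral_derivative_eq_zero)
    show "(E has_vector_derivative (\<i> * of_real \<tau> - of_real (y * sinh u)) * E u) (at u)" for u
    proof -
      have "((\<lambda>u. \<i> * of_real \<tau> * of_real u - of_real (y * cosh u))
          has_vector_derivative (\<i> * of_real \<tau> - of_real (y * sinh u))) (at u)"
        by (auto intro!: derivative_eq_intros)
      then show ?thesis unfolding E_def
        by (rule field_vector_diff_chain_at[OF _ DERIV_exp, unfolded o_def])
    qed
    show "continuous_on UNIV (\<lambda>u. (\<i> * of_real \<tau> - of_real (y * sinh u)) * E u)"
      by (intro continuous_intros cE)
    show "integrable lborel (\<lambda>u. (\<i> * of_real \<tau> - of_real (y * sinh u)) * E u)"
      using Bochner_Integration.integrable_add[OF integrable_mult_right[OF iE, of "\<i> * of_real \<tau>"] iS]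
          by (simp add: algebra_simps)
    show "norm (E u) \<le> exp (1\<^sup>2 / y) * exp (- \<bar>u\<bar>)" for u
      using exp_minus_cosh_le[OF y, of u 1] by (simp add: nE)
  qed
  also have "(LINT u|lborel. (\<i> * of_real \<tau> - of_real (y * sinh u)) * E u)
      = (LINT u|lborel. \<i> * of_real \<tau> * E u + - of_real (y * sinh u) * E u)"
    by (simp add: algebra_simps)
  also have "\<dots> = \<i> * of_real \<tau> * (LINT u|lborel. E u) + (LINT u|lborel. - of_real (y * sinh u) * E u)"
    using iE iS by (subst Bochner_Integration.integral_add) auto
  also have "(LINT u|lborel. E u) = 2 * KL \<tau> y" by (simp add: macdonald_def E_def)
  finally show ?thesis unfolding E_def by (simp add: algebra_simps eq_neg_iff_add_eq_0)
qed

text \<open>Along the line \<open>Im = \<theta>\<close> the same Fourier integral acquires the factor \<open>exp (\<theta> \<tau>)\<close>: a part of the growth of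
\<open>sinh (\<pi> \<tau>)\<close> is absorbed by the shift.\<close>

lemma fourier_sinh_exp_cosh_shifted:
  assumes y: "y > 0" and \<theta>: "0 \<le> \<theta>" "\<theta> < pi / 2"
  defines "h \<equiv> \<lambda>u.
      - of_real y * sinh (Complex u \<theta>) * exp (- of_real y * cosh (Complex u \<theta>))"
  shows "(LINT u|lborel. h u * exp (\<i> * of_real (\<tau> * u)))
      = - 2 * \<i> * (of_real (\<tau> * exp (\<theta> * \<tau>)) * KL \<tau> y)"
    and "continuous_on UNIV h"
    and "norm (h u) \<le> y * exp (4 / (y * cos \<theta>)) * exp (- \<bar>u\<bar>)"
proof -
  have c0: "cos \<theta> > 0" using \<theta> by (intro cos_gt_zero_pi) auto
  define f where "f = (\<lambda>w. - of_real y * sinh w * exp (\<i> * of_real \<tau> * w - of_real y * cosh w))"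
  have holo: "f holomorphic_on UNIV" unfolding f_def by (intro holomorphic_intros)
  have b0: "norm (- of_real y * sinh (Complex u t) * exp (- of_real y * cosh (Complex u t)))
      \<le> y * exp (4 / (y * cos \<theta>)) * exp (- \<bar>u\<bar>)"
    if "0 \<le> t" "t \<le> \<theta>" for u t
  proof -
    have "norm (- of_real y * sinh (Complex u t) * exp (- of_real y * cosh (Complex u t)))
        = y * (norm (sinh (Complex u t)) * exp (- (y * cos t * cosh u)))"
      using y by (simp add: norm_mult cosh_Complex mult_ac)
    also have "\<dots> \<le> y * (cosh u * exp (- ((y * cos \<theta>) * cosh u)))"
    proof -
      have "y * cos \<theta> * cosh u \<le> y * cos t * cosh u"
        using y that \<theta> by (intro mult_right_mono mult_left_mono cos_le_cos_abs) auto
      then show ?thesis using y by (intro mult_left_mono mult_mono norm_sinh_Complex_le) auto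
    qed
    also have "\<dots> \<le> y * (exp (4 / (y * cos \<theta>)) * exp (- \<bar>u\<bar>))"
      using y c0 by (intro mult_left_mono cosh_times_exp_minus_cosh_le) auto
    finally show ?thesis by (simp add: mult_ac)
  qed
  show "norm (h u) \<le> y * exp (4 / (y * cos \<theta>)) * exp (- \<bar>u\<bar>)"
    unfolding h_def using b0[of \<theta> u] \<theta> by simp
  have b: "norm (f (Complex u t))
      \<le> exp (\<bar>\<tau>\<bar> * \<theta>) * (y * exp (4 / (y * cos \<theta>))) * exp (- \<bar>u\<bar>)" if "0
          \<le> t" "t \<le> \<theta>" for u t
  proof -
    have "f (Complex u t) = exp (\<i> * of_real \<tau> * Complex u t)
        * (- of_real y * sinh (Complex u t) * exp (- of_real y * cosh (Complex u t)))"
      unfolding f_def diff_conv_add_uminus exp_add by (simp add: mult_ac)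
    then have "norm (f (Complex u t))
        = exp (- (\<tau> * t)) * norm (- of_real y * sinh (Complex u t) * exp (- of_real y * cosh (Complex u t)))"
      by (simp only: norm_mult) simp
    also have "\<dots> \<le> exp (\<bar>\<tau>\<bar> * \<theta>)
        * (y * exp (4 / (y * cos \<theta>)) * exp (- \<bar>u\<bar>))"
    proof -
      have "- (\<tau> * t) \<le> \<bar>\<tau>\<bar> * t" using that
          by (metis abs_ge_minus_self abs_mult abs_of_nonneg)
      also have "\<dots> \<le> \<bar>\<tau>\<bar> * \<theta>" using that by (intro mult_left_mono) auto
      finally show ?thesis using b0[OF that] by (intro mult_mono) auto
    qed
    finally show ?thesis by (simp add: mult_ac)
  qed
  have "(LINT u|lborel. f (Complex u 0)) = (LINT u|lborel. f (Complex u \<theta>))"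
    by (rule integral_horizontal_shift[OF holo \<theta>(1) b])
  moreover have "f (Complex u 0)
      = - of_real (y * sinh u) * exp (\<i> * of_real \<tau> * of_real u - of_real (y * cosh u))" for u
    by (simp add: f_def cosh_complex_of_real sinh_complex_of_real flip: complex_of_real_def)
  moreover have "f (Complex u \<theta>)
      = of_real (exp (- (\<theta> * \<tau>))) * (h u * exp (\<i> * of_real (\<tau> * u)))" for u
  proof -
    have "\<i> * of_real \<tau> * Complex u \<theta> = of_real (- (\<theta> * \<tau>)) + \<i> * of_real (\<tau> * u)"
      by (simp add: complex_eq_iff)
    then show ?thesis
      unfolding f_def h_def diff_conv_add_uminus exp_add exp_of_real[symmetric]
          by (simp only: exp_add) (simp add: mult_ac)
  qed
  ultimately have "of_real (exp (- (\<theta> * \<tau>))) * (LINT u|lborel. h u * exp (\<i> * of_real (\<tau> * u)))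
      = - 2 * \<i> * of_real \<tau> * KL \<tau> y"
    using integral_sinh_exp_cosh[OF y, of \<tau>] by simp
  then have "of_real (exp (\<theta> * \<tau>))
      * (of_real (exp (- (\<theta> * \<tau>))) * (LINT u|lborel. h u * exp (\<i> * of_real (\<tau> * u)))) = of_real
          (exp (\<theta> * \<tau>)) * (- 2 * \<i> * of_real \<tau> * KL \<tau> y)"
    by simp
  moreover have "complex_of_real (exp (\<theta> * \<tau>)) * of_real (exp (- (\<theta> * \<tau>))) = 1"
    by (simp add: exp_minus flip: of_real_mult)
  ultimately show "(LINT u|lborel. h u * exp (\<i> * of_real (\<tau> * u)))
      = - 2 * \<i> * (of_real (\<tau> * exp (\<theta> * \<tau>)) * KL \<tau> y)"
    by (simp add: mult.assoc[symmetric])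
  have ch: "continuous_on UNIV (\<lambda>w::complex. - of_real y * sinh w * exp (- of_real y * cosh w))"
    by (intro holomorphic_on_imp_continuous_on holomorphic_intros)
  have "(\<lambda>u. Complex u \<theta>) = (\<lambda>u. of_real u + \<i> * of_real \<theta>)"
      by (auto simp: complex_eq_iff)
  then have "continuous_on UNIV (\<lambda>u. Complex u \<theta>)" by (simp only:) (intro continuous_intros)
  from continuous_on_compose2[OF ch this] show "continuous_on UNIV h" by (simp add: h_def)
qed

lemma abs_times_exp_le:
  fixes c x :: real assumes "c > 0"
  shows "\<bar>x\<bar> * exp (- (2 * c * \<bar>x\<bar>)) \<le> 1 / c * exp (- (c * \<bar>x\<bar>))"
proof -
  have "1 + c * \<bar>x\<bar> \<le> exp (c * \<bar>x\<bar>)" by (rule exp_ge_add_one_self)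
  then have "c * \<bar>x\<bar> \<le> exp (c * \<bar>x\<bar>)" by linarith
  then have "\<bar>x\<bar> \<le> 1 / c * exp (c * \<bar>x\<bar>)" using assms by (simp add: field_simps)
  then have "\<bar>x\<bar> * exp (- (2 * c * \<bar>x\<bar>))
      \<le> 1 / c * exp (c * \<bar>x\<bar>) * exp (- (2 * c * \<bar>x\<bar>))"
    by (intro mult_right_mono) auto
  also have "\<dots> = 1 / c * exp (- (c * \<bar>x\<bar>))" by (simp add: exp_add[symmetric])
  finally show ?thesis .
qed

lemma cos_two_fifths_pi: "cos (2 * pi / 5) > 0"
  using pi_gt_zero by (intro cos_gt_zero_pi) linarith+

text \<open>Fourier inversion of the preceding transform for \<open>\<theta> = \<pi> / 3\<close> at the point \<open>- 2 v\<close>. In terms of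
\<open>w = v + \<i> \<pi> / 3\<close> the argument \<open>\<i> \<pi> / 3 - 2 v\<close> of the hyperbolic functions is \<open>\<i> \<pi> - 2 w\<close>, hence the form of the
right-hand side.\<close>

lemma
  assumes y: "y > 0"
  defines "B \<equiv> \<lambda>\<tau>. of_real (\<tau> * exp (pi / 3 * \<tau>)) * KL \<tau> y"
  shows integrable_kl_pi_third: "integrable lborel B"
    and fourier_kl_pi_third: "(LINT \<tau>|lborel. B \<tau> * exp (2 * \<i> * of_real (\<tau> * v)))
         = - \<i> * of_real (pi * y) * sinh (2 * Complex v (pi / 3)) * exp
             (of_real y * cosh (2 * Complex v (pi / 3)))"
proof -
  have [measurable]: "B \<in> borel_measurable lborel" unfolding B_def by measurable
  show iB: "integrable lborel B"
  \<comment> \<open>the surplus \<open>2 \<pi> / 5 - \<pi> / 3 = \<pi> / 15\<close> of the decay is shared between the factor \<open>\<tau>\<close> and integrability\<close>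
  proof (rule integrable_dominated_by_exp_abs[of _ "pi / 30" "30 / pi * K0 (y * cos (2 * pi / 5))"])
    fix \<tau> :: real
    have "norm (B \<tau>) = \<bar>\<tau>\<bar> * exp (pi / 3 * \<tau>) * norm (KL \<tau> y)"
      by (simp add: B_def norm_mult abs_mult)
    also have "\<dots> \<le> \<bar>\<tau>\<bar> * exp (pi / 3 * \<bar>\<tau>\<bar>)
        * (exp (- (2 * pi / 5 * \<bar>\<tau>\<bar>)) * K0 (y * cos (2 * pi / 5)))"
      using y by (intro mult_mono norm_kl_decay) (auto intro: mult_left_mono)
    also have "\<dots> = \<bar>\<tau>\<bar> * exp (- (2 * (pi / 30) * \<bar>\<tau>\<bar>))
        * K0 (y * cos (2 * pi / 5))"
      by (simp add: mult.assoc mult_exp_exp)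
    also have "\<dots> \<le> 1 / (pi / 30) * exp (- (pi / 30 * \<bar>\<tau>\<bar>)) * K0 (y * cos (2 * pi / 5))"
      by (intro mult_right_mono abs_times_exp_le K0_nonneg) simp
    finally show "norm (B \<tau>) \<le> 30 / pi * K0 (y * cos (2 * pi / 5)) * exp (- (pi / 30 * \<bar>\<tau>\<bar>))"
      by (simp add: mult_ac)
  qed simp_all
  define h where "h = (\<lambda>u.
      - of_real y * sinh (Complex u (pi / 3)) * exp (- of_real y * cosh (Complex u (pi / 3))))"
  have t: "0 \<le> pi / 3" "pi / 3 < pi / 2" by simp_all
  note F = fourier_sinh_exp_cosh_shifted[OF y t]
  have ch: "continuous_on UNIV h" using F(2) by (simp only: h_def)
  have bound: "norm (h u) \<le> y * exp (4 / (y * cos (pi / 3))) * exp (- (1 * \<bar>u\<bar>))" for u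
    using F(3)[of u] unfolding h_def by (simp only: mult_1)
  have H: "(LINT u|lborel. h u * exp (\<i> * of_real (\<tau> * u))) = - 2 * \<i> * B \<tau>" for \<tau>
    using F(1)[of \<tau>] by (simp only: B_def h_def)
  have "(LINT \<tau>|lborel. (LINT u|lborel. h u * exp (\<i> * of_real (\<tau> * u)))
      * exp (- (\<i> * of_real (\<tau> * (- 2 * v))))) = 2 * of_real pi * h (- 2 * v)"
  proof (rule fourier_inversion[OF ch])
    show "integrable lborel h"
      by (rule integrable_dominated_by_exp_abs[OF borel_measurable_lborel_continuous[OF ch] _ bound]) simp
    show "norm (h u) \<le> y * exp (4 / (y * cos (pi / 3)))" for u
    proof -
      have "y * exp (4 / (y * cos (pi / 3))) * exp (- (1 * \<bar>u\<bar>)) \<le> y * exp (4 / (y * cos (pi / 3))) * 1"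
        using y by (intro mult_left_mono) auto
      then show ?thesis using bound[of u] by linarith
    qed
    show "integrable lborel (\<lambda>\<tau>. LINT u|lborel. h u * exp (\<i> * of_real (\<tau> * u)))"
      unfolding H using iB by simp
  qed
  moreover have "- 2 * \<i> * B \<tau> * exp (- (\<i> * of_real (\<tau> * (- 2 * v))))
      = - 2 * \<i> * (B \<tau> * exp (2 * \<i> * of_real (\<tau> * v)))" for \<tau>
  proof -
    have "- (\<i> * of_real (\<tau> * (- 2 * v))) = 2 * \<i> * complex_of_real (\<tau> * v)" by simp
    then show ?thesis by (simp only: mult.assoc)
  qed
  ultimately have eq: "- 2 * \<i> * (LINT \<tau>|lborel. B \<tau> * exp (2 * \<i> * of_real (\<tau> * v)))
      = 2 * of_real pi * h (- 2 * v)"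
    unfolding H by (simp only: integral_mult_right_zero)
  have cancel: "Z = \<i> * c * W" if "- 2 * \<i> * Z = 2 * c * W" for Z c W :: complex
  proof -
    have "\<i> * (- 2 * \<i> * Z) = \<i> * (2 * c * W)" using that by (simp only:)
    then have "2 * Z = 2 * (\<i> * c * W)" by (simp add: mult_ac)
    then show ?thesis by simp
  qed
  have "(LINT \<tau>|lborel. B \<tau> * exp (2 * \<i> * of_real (\<tau> * v))) = \<i> * of_real pi * h (- 2 * v)"
    by (rule cancel[OF eq])
  also have "h (- 2 * v) = - of_real y * sinh (2 * Complex v (pi / 3))
      * exp (of_real y * cosh (2 * Complex v (pi / 3)))"
  proof -
    have two: "2 * Complex v (pi / 3) = Complex (2 * v) (2 * pi / 3)" by (simp add: complex_eq_iff)
    have c: "cos (2 * pi / 3) = - cos (pi / 3)" and s: "sin (2 * pi / 3) = sin (pi / 3)"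
    proof -
      have "2 * pi / 3 = pi - pi / 3" by simp
      then show "cos (2 * pi / 3) = - cos (pi / 3)" "sin (2 * pi / 3) = sin (pi / 3)"
        by (simp_all only: cos_pi_minus sin_pi_minus)
    qed
    have "sinh (Complex (- 2 * v) (pi / 3)) = sinh (2 * Complex v (pi / 3))"
      unfolding two sinh_Complex c s by simp
    moreover have "cosh (Complex (- 2 * v) (pi / 3)) = - cosh (2 * Complex v (pi / 3))"
      unfolding two cosh_Complex c s by (simp add: complex_eq_iff)
    ultimately show ?thesis unfolding h_def by simp
  qed
  finally show "(LINT \<tau>|lborel. B \<tau> * exp (2 * \<i> * of_real (\<tau> * v)))
         = - \<i> * of_real (pi * y) * sinh (2 * Complex v (pi / 3)) * exp
             (of_real y * cosh (2 * Complex v (pi / 3)))"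
    by (simp add: mult_ac)
qed

text \<open>The integrand is an entire function of \<open>w\<close>, and the line may be moved from \<open>Im w = \<pi> / 3\<close> to \<open>Im w = \<pi> / 2\<close>
because \<open>cos (2 Im w) \<le> - 1/2\<close> in between. There \<open>cosh w\<close> becomes \<open>\<i> sinh v\<close> and \<open>cosh (2 w)\<close> becomes
\<open>- cosh (2 v) = - 1 - 2 (sinh v)^2\<close>. After an integration by parts the substitution \<open>q = sinh v\<close> leaves the
Fourier transform of a Gaussian.\<close>

lemma contour_gaussian:
  assumes y: "y > 0" and a: "a > 0"
  shows "(LINT v|lborel. exp (- of_real a * cosh (Complex v (pi / 3))) * sinh (2 * Complex v (pi / 3))
      * exp (of_real y * cosh (2 * Complex v (pi / 3))))
       = \<i> * of_real (a / (2 * y) * sqrt (pi / (2 * y)) * exp (- y - a\<^sup>2 / (8 * y)))"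
proof -
  define f where "f = (\<lambda>w::complex. exp (- of_real a * cosh w) * sinh (2 * w)
      * exp (of_real y * cosh (2 * w)))"
  have holo: "f holomorphic_on UNIV" unfolding f_def by (intro holomorphic_intros)
  have two: "2 * Complex v t = Complex (2 * v) (2 * t)" for v t by (simp add: complex_eq_iff)
  have le: "norm (f (Complex v t)) \<le> exp (8 / y) * exp (- \<bar>v\<bar>)" if t: "pi / 3 \<le> t" "t \<le> pi / 2"
      for v t
  proof -
    have c1: "cos t \<ge> 0" using t by (intro cos_ge_zero) auto
    have "cos (2 * t) \<le> cos (2 * (pi / 3))" using t by (intro cos_monotone_0_pi_le) auto
    also have "\<dots> = - 1 / 2" by (simp add: cos_120)
    finally have c2: "cos (2 * t) \<le> - 1 / 2" .
    have "norm (f (Complex v t))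
        = exp (- (a * (cosh v * cos t))) * norm (sinh (Complex (2 * v) (2 * t))) * exp
            (y * (cosh (2 * v) * cos (2 * t)))"
      by (simp add: f_def two norm_mult cosh_Complex)
    also have "\<dots> \<le> 1 * cosh (2 * v) * exp (- ((y / 2) * cosh (2 * v)))"
    proof -
      have "cosh (2 * v) * cos (2 * t) \<le> cosh (2 * v) * (- 1 / 2)" by (rule mult_left_mono[OF c2]) simp
      then have "y * (cosh (2 * v) * cos (2 * t)) \<le> y * (cosh (2 * v) * (- 1 / 2))"
          by (rule mult_left_mono) (use y in simp)
      then have "exp (y * (cosh (2 * v) * cos (2 * t))) \<le> exp (- ((y / 2) * cosh (2 * v)))" by simp
      moreover have "exp (- (a * (cosh v * cos t))) \<le> 1" using a c1 by simp
      ultimately show ?thesis by (intro mult_mono norm_sinh_Complex_le) auto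
    qed
    also have "\<dots> \<le> exp (4 / (y / 2)) * exp (- \<bar>2 * v\<bar>)"
      using cosh_times_exp_minus_cosh_le[of "y / 2" "2 * v"] y by simp
    also have "\<dots> \<le> exp (8 / y) * exp (- \<bar>v\<bar>)" by (intro mult_mono) auto
    finally show ?thesis .
  qed
  have "(LINT v|lborel. f (Complex v (pi / 3))) = (LINT v|lborel. f (Complex v (pi / 2)))"
    by (rule integral_horizontal_shift[OF holo _ le]) auto
  define E where "E = (\<lambda>v. exp (- \<i> * of_real (a * sinh v) - of_real (y * cosh (2 * v))))"
  have fE: "f (Complex v (pi / 2)) = - of_real (sinh (2 * v)) * E v" for v
  proof -
    have "cosh (Complex v (pi / 2)) = \<i> * of_real (sinh v)" by (simp add: cosh_Complex complex_eq_iff)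
    moreover have "cosh (2 * Complex v (pi / 2)) = - of_real (cosh (2 * v))" unfolding two
        by (simp add: cosh_Complex complex_eq_iff)
    moreover have "sinh (2 * Complex v (pi / 2)) = - of_real (sinh (2 * v))" unfolding two
        by (simp add: sinh_Complex complex_eq_iff)
    ultimately show ?thesis
      unfolding f_def E_def diff_conv_add_uminus exp_add by (simp add: mult_ac)
  qed
  have nE: "norm (E v) = exp (- (y * cosh (2 * v)))" for v by (simp add: E_def)
  have cE: "continuous_on UNIV E" unfolding E_def by (intro continuous_intros)
  have coshE: "cosh (2 * v) * exp (- (y * cosh (2 * v))) \<le> exp (4 / y) * exp (- (1 * \<bar>v\<bar>))" for v
  proof -
    have "cosh (2 * v) * exp (- (y * cosh (2 * v))) \<le> exp (4 / y) * exp (- \<bar>2 * v\<bar>)"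
      using cosh_times_exp_minus_cosh_le[OF y] .
    also have "\<dots> \<le> exp (4 / y) * exp (- (1 * \<bar>v\<bar>))" by (intro mult_left_mono) auto
    finally show ?thesis .
  qed
  have cosh2: "cosh v \<le> cosh (2 * v)" for v :: real
    by (subst cosh_real_abs[symmetric], subst (2) cosh_real_abs[symmetric], subst cosh_real_nonneg_le_iff) auto
  have iC: "integrable lborel (\<lambda>v. of_real (cosh v) * E v)"
  proof (rule integrable_dominated_by_exp_abs[of _ 1 "exp (4 / y)"])
    have "continuous_on UNIV (\<lambda>v. of_real (cosh v) * E v)" by (intro continuous_intros cE)
    then show "(\<lambda>v. of_real (cosh v) * E v) \<in> borel_measurable lborel"
      by (rule borel_measurable_lborel_continuous)
    show "norm (of_real (cosh v) * E v) \<le> exp (4 / y) * exp (- (1 * \<bar>v\<bar>))" for v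
    proof -
      have "norm (of_real (cosh v) * E v) \<le> cosh (2 * v) * exp (- (y * cosh (2 * v)))"
        using cosh2[of v] by (simp add: norm_mult nE)
      then show ?thesis using coshE[of v] by linarith
    qed
  qed simp
  have iS: "integrable lborel (\<lambda>v. of_real (sinh (2 * v)) * E v)"
  proof (rule integrable_dominated_by_exp_abs[of _ 1 "exp (4 / y)"])
    have "continuous_on UNIV (\<lambda>v. of_real (sinh (2 * v)) * E v)" by (intro continuous_intros cE)
    then show "(\<lambda>v. of_real (sinh (2 * v)) * E v) \<in> borel_measurable lborel"
      by (rule borel_measurable_lborel_continuous)
    show "norm (of_real (sinh (2 * v)) * E v) \<le> exp (4 / y) * exp (- (1 * \<bar>v\<bar>))" for v
    proof -
      have "\<bar>sinh (2 * v)\<bar> \<le> cosh (2 * v)" by (rule abs_sinh_le_cosh)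
      then have "norm (of_real (sinh (2 * v)) * E v) \<le> cosh (2 * v) * exp (- (y * cosh (2 * v)))"
        by (simp add: norm_mult nE)
      then show ?thesis using coshE[of v] by linarith
    qed
  qed simp
  have "(LINT v|lborel. (- \<i> * of_real (a * cosh v) - of_real (y * (2 * sinh (2 * v)))) * E v) = 0"
  proof (rule integral_derivative_eq_zero)
    show "(E has_vector_derivative (- \<i> * of_real (a * cosh v) - of_real (y * (2 * sinh (2 * v)))) * E v) (at v)"
        for v
    proof -
      have "((\<lambda>v. - \<i> * of_real (a * sinh v) - of_real (y * cosh (2 * v)))
          has_vector_derivative (- \<i> * of_real (a * cosh v) - of_real (y * (2 * sinh (2 * v))))) (at v)"
        by (auto intro!: derivative_eq_intros)
      then show ?thesis unfolding E_def
        by (rule field_vector_diff_chain_at[OF _ DERIV_exp, unfolded o_def])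
    qed
    show "continuous_on UNIV (\<lambda>v. (- \<i> * of_real (a * cosh v) - of_real (y * (2 * sinh (2 * v)))) * E v)"
      by (intro continuous_intros cE)
    show "integrable lborel (\<lambda>v. (- \<i> * of_real (a * cosh v) - of_real (y * (2 * sinh (2 * v)))) * E v)"
      using Bochner_Integration.integrable_diff[OF integrable_mult_right[OF iC, of "- \<i>
          * of_real a"] integrable_mult_right[OF iS, of "of_real (2 * y)"]]
      by (simp add: algebra_simps)
    show "norm (E v) \<le> exp (4 / y) * exp (- \<bar>v\<bar>)" for v
    proof -
      have "1 * exp (- (y * cosh (2 * v))) \<le> cosh (2 * v) * exp (- (y * cosh (2 * v)))"
        by (intro mult_right_mono cosh_real_ge_1) auto
      also note coshE[of v]
      finally show ?thesis by (simp only: nE mult_1)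
    qed
  qed
  also have "(LINT v|lborel. (- \<i> * of_real (a * cosh v) - of_real (y * (2 * sinh (2 * v)))) * E v)
      = (LINT v|lborel. - \<i> * of_real a * (of_real (cosh v) * E v) - of_real (2 * y) *
          (of_real (sinh (2 * v)) * E v))"
    by (simp add: algebra_simps)
  also have "\<dots> = - \<i> * of_real a * (LINT v|lborel. of_real (cosh v) * E v)
      - of_real (2 * y) * (LINT v|lborel. of_real (sinh (2 * v)) * E v)"
    using iC iS by (subst Bochner_Integration.integral_diff) auto
  finally have S: "of_real (2 * y) * (LINT v|lborel. of_real (sinh (2 * v)) * E v)
      = - \<i> * of_real a * (LINT v|lborel. of_real (cosh v) * E v)"
    by (simp add: algebra_simps)
  have "(LINT v|lborel. of_real (cosh v) * E v)
      = (LINT q|lborel. of_real (exp (- y)) * exp (\<i> * of_real (- a * q) - of_real (2 * y * q\<^sup>2)))"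
  proof -
    have "E v = of_real (exp (- y)) * exp (\<i> * of_real (- a * sinh v) - of_real (2 * y * (sinh v)\<^sup>2))" for v
    proof -
      have "cosh (2 * v) = 1 + 2 * (sinh v)\<^sup>2" by (simp add: cosh_double cosh_square_eq)
      then have "- \<i> * of_real (a * sinh v) - of_real (y * cosh (2 * v))
          = of_real (- y) + (\<i> * of_real (- a * sinh v) - of_real (2 * y * (sinh v)\<^sup>2))"
        by (simp add: algebra_simps)
      then show ?thesis unfolding E_def exp_of_real[symmetric] exp_add[symmetric] by (simp only:)
    qed
    moreover have "(LINT v|lborel. of_real (cosh v) * (of_real (exp (- y)) * exp (\<i> * of_real (- a * sinh v)
        - of_real (2 * y * (sinh v)\<^sup>2))))
        = (LINT q|lborel. of_real (exp (- y)) * exp (\<i> * of_real (- a * q) - of_real (2 * y * q\<^sup>2)))"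
      by (rule integral_sinh_substitution[where f = "\<lambda>q. of_real (exp (- y)) * exp (\<i> * of_real (- a * q)
          - of_real (2 * y * q\<^sup>2))"])
         (use integrable_gaussian[of "2 * y" "- a"] y in \<open>auto intro!: integrable_mult_right\<close>)
    ultimately show ?thesis by simp
  qed
  also have "\<dots> = of_real (exp (- y)) * of_real (sqrt (pi / (2 * y)) * exp (- (- a)\<^sup>2 / (4 * (2 * y))))"
    using y by (subst integral_mult_right_zero, subst fourier_transform_gaussian) auto
  also have "\<dots> = of_real (sqrt (pi / (2 * y)) * exp (- y - a\<^sup>2 / (8 * y)))"
    unfolding of_real_mult[symmetric] diff_conv_add_uminus exp_add by simp
  finally have C: "(LINT v|lborel. of_real (cosh v) * E v)
      = of_real (sqrt (pi / (2 * y)) * exp (- y - a\<^sup>2 / (8 * y)))" .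
  have "(LINT v|lborel. f (Complex v (pi / 3))) = (LINT v|lborel. f (Complex v (pi / 2)))" by fact
  also have "\<dots> = - (LINT v|lborel. of_real (sinh (2 * v)) * E v)" unfolding fE by simp
  also have "(LINT v|lborel. of_real (sinh (2 * v)) * E v)
      = - \<i> * of_real a * (LINT v|lborel. of_real (cosh v) * E v) / of_real (2 * y)"
    unfolding S[symmetric] using y by simp
  also have "\<dots> = - (\<i> * of_real (a / (2 * y) * sqrt (pi / (2 * y)) * exp (- y - a\<^sup>2 / (8 * y))))"
    unfolding C by simp
  finally show ?thesis by (simp add: f_def)
qed

text \<open>Both kernels are even in \<open>\<tau>\<close>, so \<open>sinh (\<pi> \<tau>)\<close> may be replaced by \<open>exp (\<pi> \<tau>)\<close>. The latter is split into
\<open>exp (\<pi> \<tau> / 3)\<close> for the first kernel and \<open>exp (2 \<pi> \<tau> / 3)\<close> for the second; each factor corresponds to moving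
the line of integration of its kernel by \<open>\<i> \<pi> / 3\<close>. With the integral for the second kernel inserted, the
integral over \<open>\<tau>\<close> is a Fourier inversion.\<close>

lemma integral_kl_kl_double:
  assumes y: "y > 0" and a: "a > 0"
  shows "(LINT \<tau>|lborel. of_real (\<tau> * sinh (pi * \<tau>)) * KL \<tau> y * KL (2 * \<tau>) a)
       = of_real (pi * a / 4 * sqrt (pi / (2 * y)) * exp (- y - a\<^sup>2 / (8 * y)))"
proof -
  define B where "B = (\<lambda>\<tau>. of_real (\<tau> * exp (pi / 3 * \<tau>)) * KL \<tau> y)"
  define Ec where "Ec = (\<lambda>v. exp (- of_real a * cosh (Complex v (pi / 3))))"
  define f where "f = (\<lambda>\<tau> v. B \<tau> * (Ec v * exp (2 * \<i> * of_real (\<tau> * v))))"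
  define X where "X = (\<lambda>\<tau>. of_real (\<tau> * exp (pi * \<tau>)) * KL \<tau> y * KL (2 * \<tau>) a)"
  have iB: "integrable lborel B" unfolding B_def by (rule integrable_kl_pi_third[OF y])
  have [measurable]: "B \<in> borel_measurable borel" using borel_measurable_integrable[OF iB] by simp
  have Ec: "Ec = (\<lambda>v. exp (- of_real a * (of_real (cosh v * cos (pi / 3))
      + \<i> * of_real (sinh v * sin (pi / 3)))))"
    unfolding Ec_def cosh_Complex by (simp add: Complex_eq)
  have [measurable]: "Ec \<in> borel_measurable borel"
    unfolding Ec by (intro borel_measurable_continuous_onI continuous_intros)
  have mf: "case_prod f \<in> borel_measurable (lborel \<Otimes>\<^sub>M lborel)" unfolding f_def by measurable
  have nEc: "norm (Ec v) = exp (- (a / 2 * cosh v))" for v by (simp add: Ec_def cosh_Complex cos_60)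
  have iEc: "integrable lborel (\<lambda>v. norm (Ec v))"
    unfolding nEc using a by (intro integrable_K0) simp
  have le: "norm (f \<tau> v) \<le> norm (B \<tau>) * norm (Ec v)" for \<tau> v by (simp add: f_def norm_mult)
  note fub = fubini_dominated_by_product[OF mf integrable_norm[OF iB] iEc le]
  have in1: "(LINT v|lborel. f \<tau> v) = 2 * X \<tau>" for \<tau>
  proof -
    have t: "0 \<le> pi / 3" "pi / 3 < pi / 2" by simp_all
    have "exp (\<i> * of_real (2 * \<tau>) * Complex v (pi / 3) - of_real a * cosh (Complex v (pi / 3)))
        = of_real (exp (- (2 * pi / 3 * \<tau>))) * (Ec v * exp (2 * \<i> * of_real (\<tau> * v)))" for v
    proof -
      have "\<i> * of_real (2 * \<tau>) * Complex v (pi / 3)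
          = of_real (- (2 * pi / 3 * \<tau>)) + 2 * \<i> * of_real (\<tau> * v)"
        by (simp add: complex_eq_iff)
      then show ?thesis unfolding Ec_def exp_of_real[symmetric] diff_conv_add_uminus
          by (simp only: exp_add) (simp add: mult_ac)
    qed
    then have "2 * KL (2 * \<tau>) a
        = of_real (exp (- (2 * pi / 3 * \<tau>))) * (LINT v|lborel. Ec v * exp (2 * \<i> * of_real (\<tau> * v)))"
      by (subst kl_shift[OF a t]) simp
    then have "B \<tau> * of_real (exp (2 * pi / 3 * \<tau>)) * (2 * KL (2 * \<tau>) a) =
        B \<tau> * of_real (exp (2 * pi / 3 * \<tau>) * exp (- (2 * pi / 3 * \<tau>))) *
            (LINT v|lborel. Ec v * exp (2 * \<i> * of_real (\<tau> * v)))"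
      by (simp only: of_real_mult mult.assoc)
    also have "exp (2 * pi / 3 * \<tau>) * exp (- (2 * pi / 3 * \<tau>)) = 1" by (simp add: exp_minus)
    also have "B \<tau> * of_real 1 * (LINT v|lborel. Ec v * exp (2 * \<i> * of_real (\<tau> * v)))
        = (LINT v|lborel. f \<tau> v)"
      by (simp add: f_def)
    finally have "(LINT v|lborel. f \<tau> v)
        = B \<tau> * of_real (exp (2 * pi / 3 * \<tau>)) * (2 * KL (2 * \<tau>) a)" ..
    also have "B \<tau> * of_real (exp (2 * pi / 3 * \<tau>))
        = of_real (\<tau> * (exp (pi / 3 * \<tau>) * exp (2 * pi / 3 * \<tau>))) * KL \<tau> y"
      unfolding B_def of_real_mult by (simp only: mult_ac)
    also have "exp (pi / 3 * \<tau>) * exp (2 * pi / 3 * \<tau>) = exp (pi * \<tau>)"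
      by (simp add: exp_add[symmetric])
    finally show ?thesis unfolding X_def by (simp only: mult_ac)
  qed
  have in2: "(LINT \<tau>|lborel. f \<tau> v)
      = - \<i> * of_real (pi * y) * (exp (- of_real a * cosh (Complex v (pi / 3))) * sinh (2 * Complex v (pi / 3)) *
          exp (of_real y * cosh (2 * Complex v (pi / 3))))" for v
  proof -
    have "(LINT \<tau>|lborel. f \<tau> v)
        = Ec v * (LINT \<tau>|lborel. B \<tau> * exp (2 * \<i> * of_real (\<tau> * v)))"
      unfolding f_def by (subst integral_mult_right_zero[symmetric]) (simp only: mult_ac)
    also have "(LINT \<tau>|lborel. B \<tau> * exp (2 * \<i> * of_real (\<tau> * v)))
        = - \<i> * of_real (pi * y) * sinh (2 * Complex v (pi / 3)) * exp (of_real y * cosh (2 * Complex v (pi / 3)))"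
      unfolding B_def by (rule fourier_kl_pi_third[OF y])
    finally show ?thesis unfolding Ec_def by (simp only: mult_ac)
  qed
  have iX: "integrable lborel X"
    using integrable_mult_right[OF fub(2), of "1/2"] unfolding in1 by simp
  have "2 * (LINT \<tau>|lborel. X \<tau>) = (LINT \<tau>|lborel. LINT v|lborel. f \<tau> v)" unfolding in1 by simp
  also have "\<dots> = (LINT v|lborel. LINT \<tau>|lborel. f \<tau> v)" by (rule fub(1)[symmetric])
  also have "\<dots> = - \<i> * of_real (pi * y)
      * (\<i> * of_real (a / (2 * y) * sqrt (pi / (2 * y)) * exp (- y - a\<^sup>2 / (8 * y))))"
    unfolding in2 integral_mult_right_zero contour_gaussian[OF y a] ..
  also have "\<dots> = of_real (pi * y * (a / (2 * y) * sqrt (pi / (2 * y)) * exp (- y - a\<^sup>2 / (8 * y))))"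
    by (simp add: mult_ac)
  also have "pi * y * (a / (2 * y) * sqrt (pi / (2 * y)) * exp (- y - a\<^sup>2 / (8 * y)))
      = 2 * (pi * a / 4 * sqrt (pi / (2 * y)) * exp (- y - a\<^sup>2 / (8 * y)))"
    using y by simp
  finally have double: "2 * (LINT \<tau>|lborel. X \<tau>)
      = of_real (2 * (pi * a / 4 * sqrt (pi / (2 * y)) * exp (- y - a\<^sup>2 / (8 * y))))" .
  have "Z = of_real r" if "2 * Z = complex_of_real (2 * r)" for Z r using that by simp
  from this[OF double] have XI: "(LINT \<tau>|lborel. X \<tau>)
      = of_real (pi * a / 4 * sqrt (pi / (2 * y)) * exp (- y - a\<^sup>2 / (8 * y)))" .
  have "of_real (\<tau> * sinh (pi * \<tau>)) * KL \<tau> y * KL (2 * \<tau>) a = (X \<tau> + X (- \<tau>)) / 2"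
      for \<tau>
    using kl_minus[of \<tau> y] kl_minus[of "2 * \<tau>" a]
    by (simp add: X_def sinh_field_def algebra_simps diff_divide_distrib)
  then have "(LINT \<tau>|lborel. of_real (\<tau> * sinh (pi * \<tau>)) * KL \<tau> y * KL (2 * \<tau>) a)
      = (LINT \<tau>|lborel. X \<tau> + X (- \<tau>)) / 2"
    by (simp only: integral_divide_zero)
  moreover have iX': "integrable lborel (\<lambda>\<tau>. X (- \<tau>))"
      and X': "(LINT \<tau>|lborel. X (- \<tau>)) = (LINT \<tau>|lborel. X \<tau>)"
    using lborel_integrable_real_affine[OF iX, of "-1" 0] lborel_integral_real_affine[of "-1" X 0] by simp_all
  ultimately have "(LINT \<tau>|lborel. of_real (\<tau> * sinh (pi * \<tau>)) * KL \<tau> y * KL (2 * \<tau>) a)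
      = (LINT \<tau>|lborel. X \<tau>)"
    by (simp only: Bochner_Integration.integral_add[OF iX iX'] X') simp
  then show ?thesis unfolding XI .
qed

section \<open>Index integral of the Mellin transform\<close>

definition index_kernel :: "real \<Rightarrow> real \<Rightarrow> complex" where
  "index_kernel y \<tau> = of_real (\<tau> * sinh (pi * \<tau>)) * KL \<tau> y"

lemma borel_measurable_index_kernel [measurable]: "index_kernel y \<in> borel_measurable borel"
  unfolding index_kernel_def sinh_field_def by measurable

text \<open>The decay of \<open>K(2 \<tau>, a)\<close> on the line \<open>Im = 2 \<pi> / 5\<close>. The angle must lie strictly between \<open>\<pi> / 3\<close> and \<open>\<pi> / 2\<close>: at
angle \<open>\<theta>\<close> the kernels of orders \<open>\<i> \<tau>\<close> and \<open>2 \<i> \<tau>\<close> together decay like \<open>exp (- 3 \<theta> \<bar>\<tau>\<bar>)\<close>, which has to beat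
\<open>exp (\<pi> \<bar>\<tau>\<bar>)\<close>. The angle \<open>2 \<pi> / 5\<close> leaves a surplus of \<open>\<pi> / 5\<close>.\<close>

abbreviation index_decay :: "real \<Rightarrow> real" where
  "index_decay \<tau> \<equiv> exp (- (4 * pi / 5 * \<bar>\<tau>\<bar>))"

lemma norm_index_kernel_le:
  assumes y: "y > 0"
  shows "norm (index_kernel y \<tau>) * index_decay \<tau>
       \<le> 10 / pi * K0 (y * cos (2 * pi / 5)) * exp (- (pi / 10 * \<bar>\<tau>\<bar>))"
proof -
  have "\<bar>sinh (pi * \<tau>)\<bar> \<le> exp (pi * \<bar>\<tau>\<bar>)"
  proof -
    have "\<bar>sinh (pi * \<tau>)\<bar> = sinh \<bar>pi * \<tau>\<bar>" by (rule sinh_real_abs[symmetric])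
    also have "\<dots> \<le> exp \<bar>pi * \<tau>\<bar>"
    proof -
      have "(A - B) / 2 \<le> A" if "A > 0" "B > 0" for A B :: real using that by simp
      then show ?thesis unfolding sinh_field_def by (metis exp_gt_zero)
    qed
    finally show ?thesis by (simp add: abs_mult)
  qed
  then have "norm (index_kernel y \<tau>) * index_decay \<tau>
      \<le> (\<bar>\<tau>\<bar> * exp (pi * \<bar>\<tau>\<bar>)) *
          (exp (- (2 * pi / 5 * \<bar>\<tau>\<bar>)) * K0 (y * cos (2 * pi / 5))) * index_decay \<tau>"
    unfolding index_kernel_def norm_mult norm_of_real abs_mult using y
    by (intro mult_right_mono mult_mono norm_kl_decay mult_left_mono) auto
  also have "\<dots> = K0 (y * cos (2 * pi / 5))
      * (\<bar>\<tau>\<bar> * (exp (pi * \<bar>\<tau>\<bar>) * exp (- (2 * pi / 5 * \<bar>\<tau>\<bar>)) *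
          index_decay \<tau>))"
    by (simp only: mult_ac)
  \<comment> \<open>half of the surplus \<open>\<pi> / 5\<close> is spent on the factor \<open>\<tau>\<close>\<close>
  also have "exp (pi * \<bar>\<tau>\<bar>) * exp (- (2 * pi / 5 * \<bar>\<tau>\<bar>)) * index_decay \<tau>
      = exp (- (2 * (pi / 10) * \<bar>\<tau>\<bar>))"
    unfolding exp_add[symmetric] by simp
  also have "K0 (y * cos (2 * pi / 5)) * (\<bar>\<tau>\<bar> * exp (- (2 * (pi / 10) * \<bar>\<tau>\<bar>)))
      \<le> K0 (y * cos (2 * pi / 5)) * (1 / (pi / 10) * exp (- (pi / 10 * \<bar>\<tau>\<bar>)))"
    by (intro mult_left_mono abs_times_exp_le K0_nonneg) simp
  finally show ?thesis by (simp add: mult_ac)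
qed

lemma integrable_index_kernel_decay:
  assumes y: "y > 0"
  shows "integrable lborel (\<lambda>\<tau>. norm (index_kernel y \<tau>) * index_decay \<tau>)"
proof (rule Bochner_Integration.integrable_bound)
  show "integrable lborel (\<lambda>\<tau>. 10 / pi * K0 (y * cos (2 * pi / 5))
      * exp (- (pi / 10 * \<bar>\<tau>\<bar>)))"
    by (intro integrable_mult_right integrable_exp_minus_abs) simp
  show "(\<lambda>\<tau>. norm (index_kernel y \<tau>) * index_decay \<tau>) \<in> borel_measurable lborel"
    by measurable
  show "AE \<tau> in lborel. norm (norm (index_kernel y \<tau>) * index_decay \<tau>)
      \<le> norm (10 / pi * K0 (y * cos (2 * pi / 5)) * exp (- (pi / 10 * \<bar>\<tau>\<bar>)))"
  proof (rule AE_I2)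
    fix \<tau> :: real
    have "norm (norm (index_kernel y \<tau>) * index_decay \<tau>)
        = norm (index_kernel y \<tau>) * index_decay \<tau>"
      by (subst real_norm_def, rule abs_of_nonneg) (intro mult_nonneg_nonneg norm_ge_zero exp_ge_zero)
    also note norm_index_kernel_le[OF y]
    finally show "norm (norm (index_kernel y \<tau>) * index_decay \<tau>)
      \<le> norm (10 / pi * K0 (y * cos (2 * pi / 5)) * exp (- (pi / 10 * \<bar>\<tau>\<bar>)))"
      by (rule order.trans) (simp only: real_norm_def abs_ge_self)
  qed
qed

lemma norm_exp_kl_double_le:
  "norm (exp (2 * z * of_real x) * KL (2 * \<tau>) (exp x))
     \<le> index_decay \<tau> * (exp (2 * Re z * x) * K0 (cos (2 * pi / 5) * exp x))"
proof -
  have "norm (KL (2 * \<tau>) (exp x))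
      \<le> exp (- (2 * pi / 5 * \<bar>2 * \<tau>\<bar>)) * K0 (exp x * cos (2 * pi / 5))"
    by (rule norm_kl_decay) simp_all
  then have "exp (2 * Re z * x) * norm (KL (2 * \<tau>) (exp x))
      \<le> exp (2 * Re z * x) * (exp (- (2 * pi / 5 * \<bar>2 * \<tau>\<bar>)) * K0 (exp x * cos (2 * pi / 5)))"
    by (rule mult_left_mono) simp
  moreover have "2 * pi / 5 * \<bar>2 * \<tau>\<bar> = 4 * pi / 5 * \<bar>\<tau>\<bar>" by (simp add: abs_mult)
  moreover have "norm (exp (2 * z * of_real x)) = exp (2 * Re z * x)" by simp
  ultimately show ?thesis by (simp only: norm_mult mult_ac)
qed

lemma integral_exp_gaussian:
  fixes z :: complex and y :: real
  assumes z: "Re z > 0" and y: "y > 0"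
  shows "(LINT x|lborel. exp ((2 * z + 1) * of_real x - of_real ((exp x)\<^sup>2 / (8 * y))))
       = Gamma (z + 1/2) / 2 * exp ((z + 1/2) * of_real (ln (8 * y)))"
proof -
  have sq: "(exp (1 / 2 * x))\<^sup>2 = exp x" for x :: real
    unfolding power2_eq_square exp_add[symmetric] by simp
  have "(LINT x|lborel. exp ((2 * z + 1) * of_real x - of_real ((exp x)\<^sup>2 / (8 * y))))
      = of_real \<bar>1 / 2\<bar> *
          (LINT x|lborel. exp ((2 * z + 1) * of_real (0 + 1 / 2 * x) - of_real
              ((exp (0 + 1 / 2 * x))\<^sup>2 / (8 * y))))"
    by (subst lborel_integral_real_affine[where c = "1/2" and t = 0]) (auto simp: scaleR_conv_of_real)
  also have "\<dots> = 1 / 2 * (LINT x|lborel. exp ((z + 1/2) * of_real x - of_real (1 / (8 * y) * exp x)))"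
    unfolding add_0 sq by (simp add: algebra_simps)
  also have "(LINT x|lborel. exp ((z + 1/2) * of_real x - of_real (1 / (8 * y) * exp x)))
      = Gamma (z + 1/2) * exp (- ((z + 1/2) * of_real (ln (1 / (8 * y)))))"
    using z y by (intro integral_Gamma_exp_scaled) auto
  also have "ln (1 / (8 * y)) = - ln (8 * y)" using y by (simp add: ln_div)
  finally show ?thesis by simp
qed

lemma Gamma_half_line_nonzero:
  fixes z :: complex assumes "Re z > 0" shows "Gamma z \<noteq> 0"
proof -
  have "z \<notin> \<int>\<^sub>\<le>\<^sub>0" using assms by (auto elim!: nonpos_Ints_cases)
  then show ?thesis by (simp add: Gamma_eq_zero_iff)
qed

lemma Gamma_duplication_half_plane:
  fixes z :: complex assumes "Re z > 0"
  shows "Gamma z * Gamma (z + 1/2) = exp ((1 - 2 * z) * of_real (ln 2)) * of_real (sqrt pi) * Gamma (2 * z)"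
proof (rule Gamma_legendre_duplication)
  show "z \<notin> \<int>\<^sub>\<le>\<^sub>0" using assms by (auto elim!: nonpos_Ints_cases)
  show "z + 1/2 \<notin> \<int>\<^sub>\<le>\<^sub>0"
  proof
    assume "z + 1/2 \<in> \<int>\<^sub>\<le>\<^sub>0"
    then obtain n where "z + 1/2 = of_int n" "n \<le> 0" by (auto elim!: nonpos_Ints_cases)
    then have "Re (z + 1/2) \<le> 0" by (simp del: plus_complex.sel)
    then show False using assms by simp
  qed
qed

text \<open>The right-hand side is \<open>\<pi>^2 (2 y)^z exp (- y)\<close>. After doubling and interchange, the product formula for two
kernels leaves a Gaussian moment that contributes \<open>Gamma (z + 1/2)\<close>; together with \<open>Gamma z\<close> it cancels
\<open>Gamma (2 z)\<close> by the duplication formula.\<close>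

lemma index_integral_kl_mellin:
  assumes z: "Re z > 0" and y: "y > 0"
  shows "(LINT \<tau>|lborel. index_kernel y \<tau> * kl_mellin z \<tau>)
       = of_real (pi\<^sup>2 * exp (- y)) * exp (z * of_real (ln (2 * y)))"
proof -
  define W where "W = index_kernel y"
  define f where "f = (\<lambda>\<tau> x. W \<tau> * (exp (2 * z * of_real x) * KL (2 * \<tau>) (exp x)))"
  have [measurable]: "W \<in> borel_measurable borel" unfolding W_def by measurable
  have mf: "case_prod f \<in> borel_measurable (lborel \<Otimes>\<^sub>M lborel)" unfolding f_def by measurable
  have ip: "integrable lborel (\<lambda>\<tau>. norm (W \<tau>) * index_decay \<tau>)"
    unfolding W_def by (rule integrable_index_kernel_decay[OF y])
  have iq: "integrable lborel (\<lambda>x. exp (2 * Re z * x) * K0 (cos (2 * pi / 5) * exp x))"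
    using z by (intro integrable_moment_K0 cos_two_fifths_pi) simp
  have le: "norm (f \<tau> x)
      \<le> (norm (W \<tau>) * index_decay \<tau>) *
          (exp (2 * Re z * x) * K0 (cos (2 * pi / 5) * exp x))" for \<tau> x
    unfolding f_def norm_mult[of "W \<tau>"] mult.assoc[of "norm (W \<tau>)"]
        by (intro mult_left_mono norm_exp_kl_double_le norm_ge_zero)
  define D where "D = of_real (pi / 4 * sqrt (pi / (2 * y)) * exp (- y))
      * (Gamma (z + 1/2) / 2 * exp ((z + 1/2) * of_real (ln (8 * y))))"
  have in1: "2 * Gamma z * (LINT x|lborel. f \<tau> x) = Gamma (2 * z) * (W \<tau> * kl_mellin z \<tau>)" for \<tau>
  proof -
    have "2 * Gamma z * (LINT x|lborel. f \<tau> x)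
        = W \<tau> * (2 * Gamma z * (LINT x|lborel. exp (2 * z * of_real x) * KL (2 * \<tau>) (exp x)))"
      unfolding f_def integral_mult_right_zero by (simp only: mult_ac)
    also have "\<dots> = W \<tau> * (Gamma (2 * z) * kl_mellin z \<tau>)" unfolding kl_mellin_doubling[OF z] ..
    finally show ?thesis by (simp only: mult_ac)
  qed
  have in2: "(LINT \<tau>|lborel. f \<tau> x)
      = of_real (pi / 4 * sqrt (pi / (2 * y)) * exp (- y)) * exp
          ((2 * z + 1) * of_real x - of_real ((exp x)\<^sup>2 / (8 * y)))" for x
  proof -
    have "(LINT \<tau>|lborel. f \<tau> x)
        = exp (2 * z * of_real x) * (LINT \<tau>|lborel. W \<tau> * KL (2 * \<tau>) (exp x))"
      unfolding f_def by (subst integral_mult_right_zero[symmetric]) (simp only: mult_ac)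
    also have "(LINT \<tau>|lborel. W \<tau> * KL (2 * \<tau>) (exp x))
        = of_real (pi * exp x / 4 * sqrt (pi / (2 * y)) * exp (- y - (exp x)\<^sup>2 / (8 * y)))"
      unfolding W_def index_kernel_def by (rule integral_kl_kl_double[OF y]) simp
    also have "pi * exp x / 4 * sqrt (pi / (2 * y)) * exp (- y - (exp x)\<^sup>2 / (8 * y))
        = (pi / 4 * sqrt (pi / (2 * y)) * exp (- y)) * (exp x * exp (- ((exp x)\<^sup>2 / (8 * y))))"
      by (simp only: diff_conv_add_uminus exp_add times_divide_eq_left times_divide_eq_right mult_ac)
    also have "exp (2 * z * of_real x)
        * of_real ((pi / 4 * sqrt (pi / (2 * y)) * exp (- y)) * (exp x * exp (- ((exp x)\<^sup>2 / (8 * y)))))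
        = of_real (pi / 4 * sqrt (pi / (2 * y)) * exp (- y)) *
            (exp (2 * z * of_real x) * (exp (of_real x) * exp (- of_real ((exp x)\<^sup>2 / (8 * y)))))"
      unfolding of_real_mult[of "pi / 4 * sqrt (pi / (2 * y))
          * exp (- y)"] of_real_mult[of "exp x"] exp_of_real[symmetric] of_real_minus by (simp only: mult_ac)
    also have "exp (2 * z * of_real x) * (exp (of_real x) * exp (- of_real ((exp x)\<^sup>2 / (8 * y))))
        = exp ((2 * z + 1) * of_real x - of_real ((exp x)\<^sup>2 / (8 * y)))"
      unfolding exp_add[symmetric] by (simp add: algebra_simps)
    finally show ?thesis .
  qed
  have "Gamma (2 * z) * (LINT \<tau>|lborel. W \<tau> * kl_mellin z \<tau>)
      = 2 * Gamma z * (LINT \<tau>|lborel. LINT x|lborel. f \<tau> x)"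
  proof -
    have "(LINT \<tau>|lborel. 2 * Gamma z * (LINT x|lborel. f \<tau> x))
        = (LINT \<tau>|lborel. Gamma (2 * z) * (W \<tau> * kl_mellin z \<tau>))"
      by (simp only: in1)
    then show ?thesis by (simp only: integral_mult_right_zero)
  qed
  also have "(LINT \<tau>|lborel. LINT x|lborel. f \<tau> x) = (LINT x|lborel. LINT \<tau>|lborel. f \<tau> x)"
    by (rule fubini_dominated_by_product(1)[OF mf ip iq le, symmetric])
  also have "\<dots> = D"
    unfolding in2 integral_mult_right_zero integral_exp_gaussian[OF z y] D_def ..
  also have "2 * Gamma z * D
      = of_real (pi / 4 * sqrt (pi / (2 * y)) * exp (- y)) * (Gamma z * Gamma (z + 1/2)) * exp
          ((z + 1/2) * of_real (ln (8 * y)))"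
    unfolding D_def by (simp add: mult_ac)
  also have "\<dots> = Gamma (2 * z) * (of_real (pi / 4 * sqrt (pi / (2 * y)) * exp (- y) * sqrt pi)
      * (exp ((1 - 2 * z) * of_real (ln 2)) * exp ((z + 1/2) * of_real (ln (8 * y)))))"
    unfolding Gamma_duplication_half_plane[OF z] of_real_mult by (simp only: mult_ac)
  also have "exp ((1 - 2 * z) * of_real (ln 2)) * exp ((z + 1/2) * of_real (ln (8 * y)))
      = of_real (4 * sqrt (2 * y)) * exp (z * of_real (ln (2 * y)))"
  proof -
    have l8: "ln (8 * y) = 2 * ln 2 + ln (2 * y)"
    proof -
      have "ln (8 * y) = ln (2 ^ 2 * (2 * y))" by simp
      also have "\<dots> = ln (2 ^ 2) + ln (2 * y)" using y by (intro ln_mult_pos) auto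
      also have "ln (2 ^ 2) = 2 * ln (2::real)" by (subst ln_realpow) auto
      finally show ?thesis .
    qed
    have "(1 - 2 * z) * of_real (ln 2) + (z + 1/2) * of_real (ln (8 * y))
        = of_real (2 * ln 2 + ln (2 * y) / 2) + z * of_real (ln (2 * y))"
      unfolding l8 by (simp add: field_simps)
    moreover have "exp (2 * ln 2 + ln (2 * y) / 2) = 4 * sqrt (2 * y)"
    proof -
      have "exp (2 * ln 2) = (4::real)" using exp_of_nat_mult[of 2 "ln (2::real)"] by simp
      moreover have "exp (ln (2 * y) / 2) = sqrt (2 * y)" using y powr_half_sqrt[of "2 * y"] by (simp add: powr_def)
      ultimately show ?thesis by (simp only: exp_add)
    qed
    ultimately show ?thesis unfolding exp_add[symmetric] by (simp only: exp_add exp_of_real)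
  qed
  finally have "Gamma (2 * z) * (LINT \<tau>|lborel. W \<tau> * kl_mellin z \<tau>)
     = Gamma (2 * z) * (of_real (pi / 4 * sqrt (pi / (2 * y)) * exp (- y) * sqrt pi) *
         (of_real (4 * sqrt (2 * y)) * exp (z * of_real (ln (2 * y)))))" .
  then have "(LINT \<tau>|lborel. W \<tau> * kl_mellin z \<tau>)
      = of_real ((pi / 4 * sqrt (pi / (2 * y)) * exp (- y) * sqrt pi) * (4 * sqrt (2 * y))) * exp
          (z * of_real (ln (2 * y)))"
    using Gamma_half_line_nonzero[of "2 * z"] z by (simp only: mult_left_cancel of_real_mult mult.assoc) simp
  also have "(pi / 4 * sqrt (pi / (2 * y)) * exp (- y) * sqrt pi) * (4 * sqrt (2 * y))
      = pi * (sqrt pi * sqrt pi) * exp (- y)"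
    using y by (simp add: real_sqrt_divide)
  also have "pi * (sqrt pi * sqrt pi) * exp (- y) = pi\<^sup>2 * exp (- y)" by (simp add: power2_eq_square)
  finally show ?thesis unfolding W_def .
qed

text \<open>The order of growth of \<open>1 / \<bar>Gamma (z + 1/2)\<bar>\<close> on the line \<open>Re z = \<rho>\<close>.\<close>

definition line_weight :: "real \<Rightarrow> real \<Rightarrow> real" where
  "line_weight \<rho> t = exp (pi * \<bar>t\<bar> / 2) * norm (Complex (1/2) t) powr (- \<rho>)"

text \<open>By the doubling and duplication formulas the Mellin transform is, up to a factor of constant modulus,
\<open>1 / Gamma (z + 1/2)\<close> times a moment of the kernel of order \<open>2 \<i> \<tau>\<close>. The lower bound for Gamma controls the first factor and the shifted line the
second.\<close>

lemma kl_mellin_bound: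
  fixes \<rho> :: real
  assumes \<rho>: "0 < \<rho>" "\<rho> < 1"
  obtains A where "A \<ge> 0"
    "\<And>t \<tau>. norm (kl_mellin (Complex \<rho> (- t)) \<tau>)
        \<le> A * line_weight \<rho> t * index_decay \<tau>"
proof -
  obtain C where C: "C > 0"
    "\<And>t. C * (norm (Complex (1/2) t) powr \<rho> * exp (- pi * \<bar>t\<bar> / 2))
        \<le> norm (Gamma (Complex (1/2 + \<rho>) t))"
    using norm_Gamma_lower_bound[OF \<rho>] by blast
  define D where "D = (LINT x|lborel. exp (2 * \<rho> * x) * K0 (cos (2 * pi / 5) * exp x))"
  define L where "L = exp ((1 - 2 * \<rho>) * ln 2) * sqrt pi"
  have D: "D \<ge> 0" unfolding D_def by (intro Bochner_Integration.integral_nonneg mult_nonneg_nonneg K0_nonneg) simp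
  have L: "L \<ge> 0" by (simp add: L_def)
  show ?thesis
  proof (rule that[of "2 * (L / C) * D"])
    show "2 * (L / C) * D \<ge> 0" using C(1) D L by simp
    fix t \<tau> :: real
    define z where "z = Complex \<rho> (- t)"
    define w where "w = norm (Complex (1/2) t)"
    have w: "w > 0" by (simp add: w_def complex_eq_iff)
    have w': "norm (Complex (1/2) (- t)) = w" by (simp add: w_def cmod_def)
    have z: "Re z > 0" using \<rho> by (simp add: z_def)
    have iq: "integrable lborel (\<lambda>x. exp (2 * \<rho> * x) * K0 (cos (2 * pi / 5) * exp x))"
      using \<rho> by (intro integrable_moment_K0 cos_two_fifths_pi) simp
    have le: "norm (exp (2 * z * of_real x) * KL (2 * \<tau>) (exp x))
        \<le> index_decay \<tau> * (exp (2 * \<rho> * x) * K0 (cos (2 * pi / 5) * exp x))" for x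
      using norm_exp_kl_double_le[of z x \<tau>] by (simp add: z_def)
    have iw: "integrable lborel (\<lambda>x. exp (2 * z * of_real x) * KL (2 * \<tau>) (exp x))"
      by (rule Bochner_Integration.integrable_bound[OF integrable_mult_right[OF iq, of "index_decay \<tau>"]])
         (measurable, rule AE_I2, simp only: real_norm_def, rule order.trans[OF le abs_ge_self])
    have n1: "norm (LINT x|lborel. exp (2 * z * of_real x) * KL (2 * \<tau>) (exp x)) \<le> index_decay \<tau> * D"
      unfolding D_def integral_mult_right_zero[symmetric]
      by (intro Bochner_Integration.integral_norm_bound_integral iw integrable_mult_right iq le)
    have "Gamma (2 * z) \<noteq> 0" "Gamma (z + 1/2) \<noteq> 0" using z by (auto intro!: Gamma_half_line_nonzero)
    have ratio: "norm (Gamma z) * norm (Gamma (z + 1/2)) = L * norm (Gamma (2 * z))"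
    proof -
      have "norm (Gamma z * Gamma (z + 1/2))
          = norm (exp ((1 - 2 * z) * of_real (ln 2)) * of_real (sqrt pi) * Gamma (2 * z))"
        unfolding Gamma_duplication_half_plane[OF z] ..
      then show ?thesis by (simp add: norm_mult L_def z_def)
    qed
    have lower: "C * (w powr \<rho> * exp (- pi * \<bar>t\<bar> / 2)) \<le> norm (Gamma (z + 1/2))"
    proof -
      have "z + 1/2 = Complex (1/2 + \<rho>) (- t)" by (simp add: z_def complex_eq_iff)
      then show ?thesis using C(2)[of "- t"] by (simp add: w')
    qed
    have "norm (Gamma (2 * z)) * norm (kl_mellin z \<tau>)
        = 2 * norm (Gamma z) * norm (LINT x|lborel. exp (2 * z * of_real x) * KL (2 * \<tau>) (exp x))"
      using arg_cong[OF kl_mellin_doubling[OF z, of \<tau>], of norm] by (simp add: norm_mult)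
    also have "\<dots> \<le> 2 * norm (Gamma z) * (index_decay \<tau> * D)"
      by (intro mult_left_mono n1) simp
    finally have m: "norm (Gamma (2 * z)) * norm (kl_mellin z \<tau>)
        \<le> 2 * norm (Gamma z) * (index_decay \<tau> * D)" .
    have "norm (Gamma (2 * z)) * (norm (kl_mellin z \<tau>) * norm (Gamma (z + 1/2)))
        \<le> 2 * norm (Gamma z) * (index_decay \<tau> * D) * norm (Gamma (z + 1/2))"
      using mult_right_mono[OF m, of "norm (Gamma (z + 1/2))"] by (simp add: mult.assoc)
    also have "\<dots> = norm (Gamma (2 * z)) * (2 * L * (index_decay \<tau> * D))"
    proof -
      have "2 * norm (Gamma z) * (index_decay \<tau> * D) * norm (Gamma (z + 1/2))
          = 2 * (norm (Gamma z) * norm (Gamma (z + 1/2))) * (index_decay \<tau> * D)"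
        by (simp only: mult_ac)
      then show ?thesis unfolding ratio by (simp only: mult_ac)
    qed
    finally have "norm (kl_mellin z \<tau>) * norm (Gamma (z + 1/2)) \<le> 2 * L * (index_decay \<tau> * D)"
      using \<open>Gamma (2 * z) \<noteq> 0\<close> by simp
    moreover have "norm (kl_mellin z \<tau>) * (C * (w powr \<rho> * exp (- pi * \<bar>t\<bar> / 2)))
        \<le> norm (kl_mellin z \<tau>) * norm (Gamma (z + 1/2))"
      by (intro mult_left_mono lower) simp
    ultimately have b: "norm (kl_mellin z \<tau>) * (C * (w powr \<rho> * exp (- pi * \<bar>t\<bar> / 2)))
        \<le> 2 * L * (index_decay \<tau> * D)"
      by linarith
    have pos: "C * (w powr \<rho> * exp (- pi * \<bar>t\<bar> / 2)) > 0" using C(1) w by simp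
    have "norm (kl_mellin z \<tau>)
        \<le> 2 * L * (index_decay \<tau> * D) / (C * (w powr \<rho> * exp (- pi * \<bar>t\<bar> / 2)))"
      using b pos by (simp only: pos_le_divide_eq)
    also have "\<dots> = 2 * (L / C) * D * (exp (pi * \<bar>t\<bar> / 2) * w powr (- \<rho>)) * index_decay \<tau>"
      using w C(1) by (simp add: powr_minus exp_minus field_simps)
    finally show "norm (kl_mellin (Complex \<rho> (- t)) \<tau>)
        \<le> 2 * (L / C) * D * line_weight \<rho> t * index_decay \<tau>"
      by (simp only: z_def w_def line_weight_def)
  qed
qed

section \<open>Superposition over the vertical line\<close>

text \<open>Members of the function space have densities that are only Lebesgue measurable, whereas the arguments with
product measures use Borel functions.\<close>

lemma borel_representative_complex:
  fixes g :: "real \<Rightarrow> complex"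
  assumes "integrable lebesgue g"
  obtains g' where "g' \<in> borel_measurable borel" "integrable lborel g'" "AE t in lebesgue. g t = g' t"
proof -
  have m: "g \<in> borel_measurable lebesgue" using assms by (rule borel_measurable_integrable)
  have "(\<lambda>t. Re (g t)) \<in> borel_measurable lebesgue" "(\<lambda>t. Im (g t))
      \<in> borel_measurable lebesgue"
    using m by measurable
  from this[THEN completion_ex_borel_measurable_real] obtain a b where
    ab [measurable]: "a \<in> borel_measurable lborel" "b \<in> borel_measurable lborel" and
    ae: "AE t in lborel. Re (g t) = a t" "AE t in lborel. Im (g t) = b t" by auto
  define g' where "g' = (\<lambda>t. of_real (a t) + \<i> * of_real (b t) :: complex)"
  have [measurable]: "g' \<in> borel_measurable lborel" unfolding g'_def by measurable
  have "AE t in lborel. g t = g' t"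
    using ae by eventually_elim (auto simp: g'_def complex_eq_iff)
  then have eq: "AE t in lebesgue. g t = g' t" by (rule AE_completion)
  have "integrable lebesgue g'"
    using assms by (rule integrable_cong_AE_imp) (use eq in \<open>auto intro: measurable_completion\<close>)
  then have "integrable lborel g'" by (subst (asm) integrable_completion) auto
  then show ?thesis using eq by (intro that[of g']) auto
qed

text \<open>The superposition of the powers \<open>y^(- s)\<close>, \<open>s = c0 + \<i> t\<close>, with density \<open>F\<close>.\<close>

definition mellin_density ::
    "real \<Rightarrow> (real \<Rightarrow> complex) \<Rightarrow> real \<Rightarrow> complex" where
  "mellin_density c0 F y = 1 / (2 * of_real pi) * (LINT t|lborel. F t * exp (- (Complex c0 t * of_real (ln y))))"

text \<open>The lower bound on \<open>\<nu>\<close> is used here. The quotient of \<open>line_weight (1 - c0)\<close> and the weight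
\<open>\<bar>s\<bar>^\<nu> exp (\<pi> \<bar>s\<bar> / 2)\<close> of the space is at most a constant times \<open>\<bar>s\<bar>^(- (\<nu> + 1 - c0))\<close>, which is bounded
since the exponent is negative and \<open>c0 \<le> \<bar>s\<bar>\<close>.\<close>

lemma inv_mellin_space_density:
  assumes c0: "0 < c0" "c0 < 1" and \<nu>: "\<nu> > c0 - 1"
    and f: "f \<in> inv_mellin_space (1 / 2) \<nu> c0"
  obtains F :: "real \<Rightarrow> complex" where "F \<in> borel_measurable borel"
    "integrable lborel (\<lambda>t. norm (F t) * line_weight (1 - c0) t)"
    "integrable lborel F"
    "\<And>x. x > 0 \<Longrightarrow> f x = mellin_density c0 F x"
proof -
  from f obtain F0 where
    F0: "integrable lebesgue (\<lambda>t. Complex c0 t powr of_real \<nu>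
        * of_real (exp (pi * (1/2) * norm (Complex c0 t))) * F0 (Complex c0 t))"
    and fx: "\<And>x. x > 0 \<Longrightarrow> f x
        = 1 / (2 * of_real pi * \<i>) * vline_integral c0 (\<lambda>s. F0 s * of_real x powr (- s))"
    unfolding inv_mellin_space_def L1_vline_def by blast
  define den where "den = (\<lambda>t. Complex c0 t powr of_real \<nu>
      * of_real (exp (pi * (1/2) * norm (Complex c0 t))))"
  define r where "r = (\<lambda>t. norm (Complex c0 t))"
  have r: "r t \<ge> c0" for t using complex_Re_le_cmod[of "Complex c0 t"] by (simp add: r_def)
  have r0: "r t > 0" for t using r[of t] c0 by linarith
  have rt: "\<bar>t\<bar> \<le> r t" for t using abs_Im_le_cmod[of "Complex c0 t"] by (simp add: r_def)
  have nden: "norm (den t) = r t powr \<nu> * exp (pi / 2 * r t)" for t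
  proof -
    have "Complex c0 t \<noteq> 0" using c0 by (simp add: complex_eq_iff)
    then have "norm (Complex c0 t powr of_real \<nu>) = r t powr \<nu>"
        by (simp add: norm_powr_real_powr' r_def norm_powr_real)
    then show ?thesis by (simp add: den_def norm_mult r_def)
  qed
  have den0: "den t \<noteq> 0" for t using nden[of t] r0[of t]
      by (metis exp_gt_zero less_irrefl mult_pos_pos norm_zero powr_gt_zero)
  have CE: "Complex c0 t = of_real c0 + \<i> * of_real t" for t by (simp add: complex_eq_iff)
  have "continuous_on UNIV den"
    unfolding den_def CE using c0 by (intro continuous_intros) (auto simp: complex_nonpos_Reals_iff complex_eq_iff)
  then have [measurable]: "den \<in> borel_measurable borel" by (rule borel_measurable_continuous_onI)
  obtain g' where [measurable]: "g' \<in> borel_measurable borel" and ig: "integrable lborel g'" and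
    ae: "AE t in lebesgue. den t * F0 (Complex c0 t) = g' t"
    using borel_representative_complex[OF F0] unfolding den_def by blast
  define F where "F = (\<lambda>t. g' t / den t)"
  have mF [measurable]: "F \<in> borel_measurable borel" unfolding F_def by measurable
  have aeF: "AE t in lebesgue. F0 (Complex c0 t) = F t"
    using ae by eventually_elim (use den0 in \<open>auto simp: F_def field_simps\<close>)
  define \<rho> where "\<rho> = 1 - c0"
  have \<rho>: "0 < \<rho>" "\<rho> < 1" "\<nu> + \<rho> > 0" using c0 \<nu> by (auto simp: \<rho>_def)
  define wt where "wt = line_weight \<rho>"
  have wt_eq: "wt t = exp (pi * \<bar>t\<bar> / 2) * norm (Complex (1/2) t) powr (- \<rho>)" for t
    by (simp add: wt_def line_weight_def)
  have [measurable]: "wt \<in> borel_measurable borel" unfolding wt_eq[abs_def] cmod_def by simp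
  have h0: "norm (Complex (1/2) t) > 0" for t by (simp add: complex_eq_iff)
  \<comment> \<open>the lower bound for Gamma is stated in terms of \<open>\<bar>1/2 + \<i> t\<bar>\<close>, the weight of the space in terms of \<open>\<bar>s\<bar>\<close>\<close>
  have hr: "r t / 2 \<le> norm (Complex (1/2) t)" for t
  proof -
    have "c0\<^sup>2 \<le> 1" using c0 by (simp add: power_le_one)
    moreover have "t\<^sup>2 \<ge> 0" by simp
    ultimately have "c0\<^sup>2 + t\<^sup>2 \<le> 1 + 4 * t\<^sup>2" by linarith
    then have "(c0\<^sup>2 + t\<^sup>2) / 4 \<le> (1/2)\<^sup>2 + t\<^sup>2" by (simp add: power_divide)
    then have "sqrt ((c0\<^sup>2 + t\<^sup>2) / 4) \<le> sqrt ((1/2)\<^sup>2 + t\<^sup>2)" by (rule real_sqrt_le_mono)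
    then show ?thesis by (simp add: r_def cmod_def real_sqrt_divide)
  qed
  have key: "norm (F t) * wt t \<le> (2 powr \<rho> * c0 powr (- (\<nu> + \<rho>))) * norm (g' t)" for t
  proof -
    have 1: "norm (Complex (1/2) t) powr (- \<rho>) \<le> 2 powr \<rho> * r t powr (- \<rho>)"
    proof -
      have "norm (Complex (1/2) t) powr (- \<rho>) \<le> (r t / 2) powr (- \<rho>)"
        using hr[of t] r0[of t] \<rho> by (intro powr_mono2') auto
      also have "\<dots> = 2 powr \<rho> * r t powr (- \<rho>)" using r0[of t]
          by (simp add: powr_divide powr_minus field_simps)
      finally show ?thesis .
    qed
    have 2: "exp (pi * \<bar>t\<bar> / 2) \<le> exp (pi / 2 * r t)" using rt[of t] by simp
    have 3: "r t powr (- (\<nu> + \<rho>)) \<le> c0 powr (- (\<nu> + \<rho>))" using r[of t] c0 \<rho>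
        by (intro powr_mono2') auto
    have "norm (F t) * wt t \<le> norm (F t) * (exp (pi / 2 * r t) * (2 powr \<rho> * r t powr (- \<rho>)))"
      unfolding wt_eq by (intro mult_left_mono mult_mono 1 2) auto
    also have "norm (F t) * (exp (pi / 2 * r t) * (2 powr \<rho> * r t powr (- \<rho>)))
        = norm (g' t) * (r t powr (- \<nu>) * exp (- (pi / 2 * r t))) *
            (exp (pi / 2 * r t) * (2 powr \<rho> * r t powr (- \<rho>)))"
      unfolding F_def norm_divide nden by (simp add: powr_minus exp_minus field_simps)
    also have "norm (g' t) * (r t powr (- \<nu>) * exp (- (pi / 2 * r t)))
        * (exp (pi / 2 * r t) * (2 powr \<rho> * r t powr (- \<rho>)))
        = norm (g' t) * (2 powr \<rho> * (r t powr (- \<nu>) * r t powr (- \<rho>))) *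
            (exp (- (pi / 2 * r t)) * exp (pi / 2 * r t))"
      by (simp only: mult_ac)
    also have "exp (- (pi / 2 * r t)) * exp (pi / 2 * r t) = 1" unfolding exp_add[symmetric] by simp
    also have "r t powr (- \<nu>) * r t powr (- \<rho>) = r t powr (- (\<nu> + \<rho>))" using r0[of t]
        by (simp add: powr_add[symmetric])
    also have "norm (g' t) * (2 powr \<rho> * r t powr (- (\<nu> + \<rho>))) * 1
        \<le> norm (g' t) * (2 powr \<rho> * c0 powr (- (\<nu> + \<rho>))) * 1"
      by (intro mult_right_mono mult_left_mono 3) auto
    finally show ?thesis by (simp add: mult_ac)
  qed
  \<comment> \<open>so that integrability of \<open>F\<close> itself follows from the weighted one\<close>
  have wt1: "wt t \<ge> 1" for t
  proof -
    have "norm (Complex (1/2) t) \<le> \<bar>1/2\<bar> + \<bar>t\<bar>" using cmod_le[of "Complex (1/2) t"] by simp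
    also have "\<dots> \<le> 1 + \<bar>t\<bar>" by simp
    also have "\<dots> \<le> exp \<bar>t\<bar>" by (rule exp_ge_add_one_self)
    finally have "norm (Complex (1/2) t) powr \<rho> \<le> exp \<bar>t\<bar> powr \<rho>" using \<rho>
        by (intro powr_mono2) auto
    also have "\<dots> = exp (\<rho> * \<bar>t\<bar>)" by (simp add: exp_powr_real mult.commute)
    also have "\<dots> \<le> exp (pi * \<bar>t\<bar> / 2)"
    proof -
      have "\<rho> * \<bar>t\<bar> \<le> (pi / 2) * \<bar>t\<bar>" using \<rho> pi_gt3 by (intro mult_right_mono) auto
      then show ?thesis by simp
    qed
    finally have le: "norm (Complex (1/2) t) powr \<rho> \<le> exp (pi * \<bar>t\<bar> / 2)" .
    have "norm (Complex (1/2) t) powr \<rho> * norm (Complex (1/2) t) powr (- \<rho>) \<le> wt t"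
      unfolding wt_eq by (intro mult_right_mono le) simp
    moreover have "norm (Complex (1/2) t) powr \<rho> * norm (Complex (1/2) t) powr (- \<rho>) = 1"
      using h0[of t] by (simp add: powr_add[symmetric])
    ultimately show ?thesis by simp
  qed
  have iFw: "integrable lborel (\<lambda>t. norm (F t) * wt t)"
  proof (rule Bochner_Integration.integrable_bound[OF
      integrable_mult_right[OF integrable_norm[OF ig], of "2 powr \<rho> * c0 powr (- (\<nu> + \<rho>))"]])
    show "AE t in lborel. norm (norm (F t) * wt t)
        \<le> norm (2 powr \<rho> * c0 powr (- (\<nu> + \<rho>)) * norm (g' t))"
    proof (rule AE_I2)
      fix t
      have "norm (norm (F t) * wt t) = norm (F t) * wt t" using wt1[of t] by (simp add: abs_mult)
      also note key[of t]
      finally show "norm (norm (F t) * wt t) \<le> norm (2 powr \<rho> * c0 powr (- (\<nu> + \<rho>)) * norm (g' t))"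
        by (rule order.trans) (simp only: real_norm_def abs_ge_self)
    qed
  qed measurable
  have iF: "integrable lborel F"
  proof (rule Bochner_Integration.integrable_bound[OF iFw])
    show "AE t in lborel. norm (F t) \<le> norm (norm (F t) * wt t)"
    proof (rule AE_I2)
      fix t
      have "norm (F t) * 1 \<le> norm (F t) * wt t" by (intro mult_left_mono wt1) simp
      then show "norm (F t) \<le> norm (norm (F t) * wt t)" using wt1[of t] by (simp add: abs_mult)
    qed
  qed measurable
  show ?thesis
  proof (rule that[OF mF _ iF])
    show "integrable lborel (\<lambda>t. norm (F t) * line_weight (1 - c0) t)"
      using iFw unfolding wt_def \<rho>_def .
    fix x :: real assume x: "x > 0"
    have pw: "of_real x powr (- Complex c0 t) = exp (- (Complex c0 t * of_real (ln x)))" for t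
      using x by (simp add: powr_def Ln_of_real)
    have [measurable]: "(\<lambda>t. F t * exp (- (Complex c0 t * of_real (ln x)))) \<in> borel_measurable borel"
      unfolding CE by measurable
    have F0eq: "F0 (Complex c0 t) = (den t * F0 (Complex c0 t)) / den t" for t using den0[of t] by simp
    have mF0: "(\<lambda>t. F0 (Complex c0 t)) \<in> borel_measurable lebesgue"
    proof -
      have "(\<lambda>t. den t * F0 (Complex c0 t)) \<in> borel_measurable lebesgue"
        using F0 unfolding den_def by (rule borel_measurable_integrable)
      moreover have "den \<in> borel_measurable lebesgue" by (rule measurable_completion) simp
      ultimately have "(\<lambda>t. (den t * F0 (Complex c0 t)) / den t) \<in> borel_measurable lebesgue"
          by (rule borel_measurable_divide)
      then show ?thesis by (simp only: F0eq[symmetric])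
    qed
    have mE: "(\<lambda>t. exp (- (Complex c0 t * of_real (ln x)))) \<in> borel_measurable lebesgue"
      unfolding CE by (rule measurable_completion) measurable
    have "(LINT t|lebesgue. F0 (Complex c0 t) * of_real x powr (- Complex c0 t))
        = (LINT t|lebesgue. F t * exp (- (Complex c0 t * of_real (ln x))))"
      unfolding pw
    proof (rule integral_cong_AE)
      show "(\<lambda>t. F0 (Complex c0 t) * exp (- (Complex c0 t * of_real (ln x)))) \<in> borel_measurable lebesgue"
        by (intro borel_measurable_times mF0 mE)
      show "(\<lambda>t. F t * exp (- (Complex c0 t * of_real (ln x)))) \<in> borel_measurable lebesgue"
        by (rule measurable_completion) simp
      show "AE t in lebesgue. F0 (Complex c0 t) * exp (- (Complex c0 t * of_real (ln x)))
          = F t * exp (- (Complex c0 t * of_real (ln x)))"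
        using aeF by eventually_elim simp
    qed
    also have "\<dots> = (LINT t|lborel. F t * exp (- (Complex c0 t * of_real (ln x))))"
      by (rule integral_completion) simp
    finally show "f x = mellin_density c0 F x"
      unfolding fx[OF x] vline_integral_def mellin_density_def by (simp add: field_simps)
  qed
qed

text \<open>In the variable \<open>x = ln y\<close> the integrand is dominated by a multiple of \<open>exp ((1 - c0) x) K0 (exp x / 2)\<close>,
uniformly in \<open>\<tau>\<close>. This one majorant gives integrability, continuity in \<open>\<tau>\<close> and the interchange with the
integral over \<open>t\<close>.\<close>

lemma kl_mellin_density_transform:
  fixes F :: "real \<Rightarrow> complex" and c0 :: real
  assumes c0: "0 < c0" "c0 < 1" and F [measurable]: "F \<in> borel_measurable borel" and iF: "integrable lborel F"
  defines "f1 \<equiv> mellin_density c0 F"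
  shows "set_integrable lborel {0<..} (\<lambda>y. of_real (exp (- y / 2)) * KL \<tau> (y / 2) * f1 y)"
    and "(LINT y:{0<..}|lborel. of_real (exp (- y / 2)) * KL \<tau> (y / 2) * f1 y)
       = 1 / (2 * of_real pi) * (LINT t|lborel. F t * kl_mellin (Complex (1 - c0) (- t)) \<tau>)"
    and "continuous_on UNIV (\<lambda>\<tau>. LINT y:{0<..}|lborel. of_real (exp (- y / 2)) * KL \<tau> (y / 2)
        * f1 y)"
proof -
  have CE: "Complex c0 t = of_real c0 + \<i> * of_real t" for t by (simp add: complex_eq_iff)
  have mf1 [measurable]: "f1 \<in> borel_measurable borel" unfolding f1_def mellin_density_def[abs_def] CE
      by measurable
  define P where "P = (\<lambda>\<tau> x. of_real (exp x)
      * (of_real (exp (- exp x / 2)) * KL \<tau> (exp x / 2) * f1 (exp x)))"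
  have mP [measurable]: "P \<tau> \<in> borel_measurable borel" for \<tau> unfolding P_def by measurable
  have mh: "(\<lambda>y. of_real (exp (- y / 2)) * KL \<tau> (y / 2) * f1 y) \<in> borel_measurable borel" for \<tau>
      by measurable
  define M where "M = 1 / (2 * pi) * (LINT t|lborel. norm (F t))"
  have M: "M \<ge> 0" unfolding M_def by (intro mult_nonneg_nonneg Bochner_Integration.integral_nonneg) auto
  have nE: "norm (exp (- (Complex c0 t * of_real x))) = exp (- (c0 * x))" for t x by simp
  have f1_le: "norm (f1 (exp x)) \<le> M * exp (- (c0 * x))" for x
  proof -
    have "norm (LINT t|lborel. F t * exp (- (Complex c0 t * of_real x)))
        \<le> (LINT t|lborel. norm (F t * exp (- (Complex c0 t * of_real x))))"
      by (rule integral_norm_bound)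
    also have "\<dots> = (LINT t|lborel. norm (F t)) * exp (- (c0 * x))"
      unfolding norm_mult nE by (rule integral_mult_left_zero)
    finally have "1 / (2 * pi) * norm (LINT t|lborel. F t * exp (- (Complex c0 t * of_real x)))
        \<le> 1 / (2 * pi) * ((LINT t|lborel. norm (F t)) * exp (- (c0 * x)))"
      by (rule mult_left_mono) simp
    then show ?thesis by (simp add: f1_def mellin_density_def M_def norm_mult norm_divide mult_ac)
  qed
  define q where "q = (\<lambda>x. M * (exp ((1 - c0) * x) * K0 (1/2 * exp x)))"
  have iq: "integrable lborel q"
    unfolding q_def using c0 by (intro integrable_mult_right integrable_moment_K0) auto
  have Pq: "norm (P \<tau> x) \<le> q x" for \<tau> x
  proof -
    have "norm (P \<tau> x) = exp x * (exp (- exp x / 2) * norm (KL \<tau> (exp x / 2)) * norm (f1 (exp x)))"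
      by (simp add: P_def norm_mult)
    also have "\<dots> \<le> exp x * (1 * K0 (exp x / 2) * (M * exp (- (c0 * x))))"
      using K0_nonneg M by (intro mult_left_mono mult_mono norm_kl_le f1_le mult_nonneg_nonneg) auto
    also have "\<dots> = M * (exp x * exp (- (c0 * x)) * K0 (1/2 * exp x))" by simp
    also have "exp x * exp (- (c0 * x)) = exp ((1 - c0) * x)" unfolding exp_add[symmetric]
        by (simp add: algebra_simps)
    finally show ?thesis by (simp only: q_def)
  qed
  have iP: "integrable lborel (P \<tau>)" for \<tau>
    by (rule Bochner_Integration.integrable_bound[OF iq])
       (measurable, rule AE_I2, rule order.trans[OF Pq], simp only: real_norm_def abs_ge_self)
  note sub = integral_exp_substitution[OF mh iP[unfolded P_def]]
  show "set_integrable lborel {0<..} (\<lambda>y. of_real (exp (- y / 2)) * KL \<tau> (y / 2) * f1 y)"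
    by (rule sub(1))
  have val: "(LINT y:{0<..}|lborel. of_real (exp (- y / 2)) * KL \<tau> (y / 2) * f1 y)
      = (LINT x|lborel. P \<tau> x)" for \<tau>
    unfolding P_def by (rule sub(2))
  show "continuous_on UNIV (\<lambda>\<tau>. LINT y:{0<..}|lborel. of_real (exp (- y / 2)) * KL \<tau> (y / 2)
      * f1 y)"
    unfolding val
  proof (rule continuous_on_integral_dominated[OF _ iq])
    show "continuous_on UNIV (\<lambda>\<tau>. P \<tau> x)" for x
      unfolding P_def
      by (intro continuous_intros continuous_on_compose2[OF continuous_on_macdonald[of "exp x / 2" 1]]) auto
  qed (use Pq in auto)
  define f where "f = (\<lambda>x t. F t * (exp (Complex (1 - c0) (- t) * of_real x - of_real (1/2 * exp x))
      * KL \<tau> (1/2 * exp x)))"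
  have CE': "Complex (1 - c0) (- t) = of_real (1 - c0) - \<i> * of_real t" for t by (simp add: complex_eq_iff)
  have mf: "case_prod f \<in> borel_measurable (lborel \<Otimes>\<^sub>M lborel)" unfolding f_def CE' by measurable
  have ip: "integrable lborel (\<lambda>x. exp ((1 - c0) * x) * K0 (1/2 * exp x))"
    using c0 by (intro integrable_moment_K0) auto
  have le: "norm (f x t) \<le> (exp ((1 - c0) * x) * K0 (1/2 * exp x)) * norm (F t)" for x t
  proof -
    have "norm (f x t) = norm (F t) * (exp ((1 - c0) * x - 1/2 * exp x) * norm (KL \<tau> (1/2 * exp x)))"
      by (simp add: f_def norm_mult)
    also have "\<dots> \<le> norm (F t) * (exp ((1 - c0) * x) * K0 (1/2 * exp x))"
      by (intro mult_left_mono mult_mono norm_kl_le) auto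
    finally show ?thesis by (simp only: mult_ac)
  qed
  have in1: "(LINT t|lborel. f x t) = 2 * of_real pi * P \<tau> x" for x
  proof -
    have "f x t = (of_real (exp x) * (of_real (exp (- exp x / 2)) * KL \<tau> (exp x / 2)))
        * (F t * exp (- (Complex c0 t * of_real x)))" for t
    proof -
      have "Complex (1 - c0) (- t) * of_real x - of_real (1/2 * exp x)
          = of_real x + of_real (- exp x / 2) + - (Complex c0 t * of_real x)"
        by (simp add: complex_eq_iff algebra_simps)
      then have "exp (Complex (1 - c0) (- t) * of_real x - of_real (1/2 * exp x))
          = of_real (exp x) * of_real (exp (- exp x / 2)) * exp (- (Complex c0 t * of_real x))"
        by (simp only: exp_add exp_of_real)
      then show ?thesis unfolding f_def by (simp add: mult_ac)
    qed
    then have "(LINT t|lborel. f x t)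
        = (of_real (exp x) * (of_real (exp (- exp x / 2)) * KL \<tau> (exp x / 2))) *
            (LINT t|lborel. F t * exp (- (Complex c0 t * of_real x)))"
      by (simp only: integral_mult_right_zero)
    then show ?thesis by (simp add: P_def f1_def mellin_density_def mult_ac)
  qed
  have in2: "(LINT x|lborel. f x t) = F t * kl_mellin (Complex (1 - c0) (- t)) \<tau>" for t
    unfolding f_def kl_mellin_def by (rule integral_mult_right_zero)
  have "2 * of_real pi * (LINT x|lborel. P \<tau> x) = (LINT x|lborel. LINT t|lborel. f x t)"
    unfolding in1 by simp
  also have "\<dots> = (LINT t|lborel. LINT x|lborel. f x t)"
    by (rule fubini_dominated_by_product(1)[OF mf ip integrable_norm[OF iF] le, symmetric])
  also have "\<dots> = (LINT t|lborel. F t * kl_mellin (Complex (1 - c0) (- t)) \<tau>)" unfolding in2 ..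
  finally show "(LINT y:{0<..}|lborel. of_real (exp (- y / 2)) * KL \<tau> (y / 2) * f1 y)
       = 1 / (2 * of_real pi) * (LINT t|lborel. F t * kl_mellin (Complex (1 - c0) (- t)) \<tau>)"
    unfolding val by (simp add: field_simps)
qed

lemma index_inversion_density:
  fixes F :: "real \<Rightarrow> complex" and c0 x :: real
  assumes c0: "0 < c0" "c0 < 1" and F [measurable]: "F \<in> borel_measurable borel"
    and iFw: "integrable lborel (\<lambda>t. norm (F t) * line_weight (1 - c0) t)"
    and x: "x > 0"
  defines "W \<equiv> index_kernel (x / 2)"
  shows "integrable lborel (\<lambda>\<tau>. W \<tau>
      * (LINT t|lborel. F t * kl_mellin (Complex (1 - c0) (- t)) \<tau>))"
    and "(LINT \<tau>|lborel. W \<tau> * (LINT t|lborel. F t * kl_mellin (Complex (1 - c0) (- t)) \<tau>))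
       = of_real (pi\<^sup>2 * exp (- (x / 2)) * x) * (LINT t|lborel. F t * exp (- (Complex c0 t * of_real (ln x))))"
proof -
  have y: "x / 2 > 0" using x by simp
  have \<rho>: "0 < 1 - c0" "1 - c0 < 1" using c0 by auto
  obtain A where A: "A \<ge> 0"
    "\<And>t \<tau>. norm (kl_mellin (Complex (1 - c0) (- t)) \<tau>)
        \<le> A * line_weight (1 - c0) t * index_decay \<tau>"
    using kl_mellin_bound[OF \<rho>] by blast
  define f where "f = (\<lambda>\<tau> t. W \<tau> * (F t * kl_mellin (Complex (1 - c0) (- t)) \<tau>))"
  have CE': "Complex (1 - c0) (- t) = of_real (1 - c0) - \<i> * of_real t" for t by (simp add: complex_eq_iff)
  have [measurable]: "W \<in> borel_measurable borel" unfolding W_def by measurable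
  have mf: "case_prod f \<in> borel_measurable (lborel \<Otimes>\<^sub>M lborel)" unfolding f_def kl_mellin_def CE'
      by measurable
  have ip: "integrable lborel (\<lambda>\<tau>. norm (W \<tau>) * index_decay \<tau>)"
    unfolding W_def by (rule integrable_index_kernel_decay[OF y])
  have iq: "integrable lborel (\<lambda>t. A * (norm (F t) * line_weight (1 - c0) t))"
    by (rule integrable_mult_right[OF iFw])
  have le: "norm (f \<tau> t)
      \<le> (norm (W \<tau>) * index_decay \<tau>) * (A * (norm (F t) * line_weight (1 - c0) t))" for \<tau> t
  proof -
    have "norm (f \<tau> t) = norm (W \<tau>) * norm (F t) * norm (kl_mellin (Complex (1 - c0) (- t)) \<tau>)"
      by (simp add: f_def norm_mult)
    also have "\<dots> \<le> norm (W \<tau>) * norm (F t) * (A * line_weight (1 - c0) t * index_decay \<tau>)"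
      by (intro mult_left_mono A(2)) simp
    finally show ?thesis by (simp only: mult_ac)
  qed
  note fub = fubini_dominated_by_product[OF mf ip iq le]
  have in1: "(LINT t|lborel. f \<tau> t)
      = W \<tau> * (LINT t|lborel. F t * kl_mellin (Complex (1 - c0) (- t)) \<tau>)" for \<tau>
    unfolding f_def by (rule integral_mult_right_zero)
  have in2: "(LINT \<tau>|lborel. f \<tau> t)
      = of_real (pi\<^sup>2 * exp (- (x / 2)) * x) * (F t * exp (- (Complex c0 t * of_real (ln x))))" for t
  proof -
    have "(LINT \<tau>|lborel. f \<tau> t)
        = F t * (LINT \<tau>|lborel. W \<tau> * kl_mellin (Complex (1 - c0) (- t)) \<tau>)"
      unfolding f_def by (subst integral_mult_right_zero[symmetric]) (simp only: mult_ac)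
    also have "(LINT \<tau>|lborel. W \<tau> * kl_mellin (Complex (1 - c0) (- t)) \<tau>)
        = of_real (pi\<^sup>2 * exp (- (x / 2))) * exp (Complex (1 - c0) (- t) * of_real (ln (2 * (x / 2))))"
      unfolding W_def by (rule index_integral_kl_mellin[OF _ y]) (use c0 in simp)
    also have "Complex (1 - c0) (- t) * of_real (ln (2 * (x / 2)))
        = of_real (ln x) + - (Complex c0 t * of_real (ln x))"
      by (simp add: complex_eq_iff algebra_simps)
    also have "exp (of_real (ln x) + - (Complex c0 t * of_real (ln x)))
        = of_real x * exp (- (Complex c0 t * of_real (ln x)))"
      unfolding exp_add exp_of_real using x by simp
    finally show ?thesis by (simp add: mult_ac)
  qed
  show "integrable lborel (\<lambda>\<tau>. W \<tau>
      * (LINT t|lborel. F t * kl_mellin (Complex (1 - c0) (- t)) \<tau>))"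
    using fub(2) unfolding in1 .
  show "(LINT \<tau>|lborel. W \<tau> * (LINT t|lborel. F t * kl_mellin (Complex (1 - c0) (- t)) \<tau>))
       = of_real (pi\<^sup>2 * exp (- (x / 2)) * x) * (LINT t|lborel. F t * exp (- (Complex c0 t * of_real (ln x))))"
    using fub(1)[symmetric] unfolding in1 in2 integral_mult_right_zero .
qed

theorem theorem9:
  fixes c0 \<nu> :: real and f :: "real \<Rightarrow> complex"
  assumes "0 < c0" and "c0 < 1" and "\<nu> > c0 - 1"
    and "f \<in> inv_mellin_space (1 / 2) \<nu> c0"
  shows "(\<forall>\<tau>::real.
            (\<lambda>y. of_real (exp (- y / 2)) * bessel_K (\<i> * of_real \<tau>) (of_real (y / 2)) * f y)
              absolutely_integrable_on {0<..}) \<and>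
         (\<forall>x>0. \<exists>J.
            has_improper_Riemann_integral
              (\<lambda>\<tau>. of_real (\<tau> * sinh (pi * \<tau>)) * bessel_K (\<i> * of_real \<tau>) (of_real (x / 2)) *
                 (LINT y:{0<..}|lebesgue.
                    of_real (exp (- y / 2)) * bessel_K (\<i> * of_real \<tau>) (of_real (y / 2)) * f y)) J \<and>
            f x = of_real (exp (x / 2) / (pi\<^sup>2 * x)) * J)"
proof -
  obtain F where F [measurable]: "F \<in> borel_measurable borel"
    and iFw: "integrable lborel (\<lambda>t. norm (F t) * line_weight (1 - c0) t)"
    and iF: "integrable lborel F"
    and fF: "\<And>x. x > 0 \<Longrightarrow> f x = mellin_density c0 F x"
    by (rule inv_mellin_space_density[OF assms]) (rule that)
  define f1 where "f1 = mellin_density c0 F"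
  note T = kl_mellin_density_transform[OF assms(1,2) F iF, folded f1_def]
  have CE: "Complex c0 t = of_real c0 + \<i> * of_real t" for t by (simp add: complex_eq_iff)
  have mf1 [measurable]: "f1 \<in> borel_measurable borel" unfolding f1_def mellin_density_def[abs_def] CE
      by measurable
  have eq: "indicator {0<..} y *\<^sub>R (of_real (exp (- y / 2))
      * bessel_K (\<i> * of_real \<tau>) (of_real (y / 2)) * f y)
      = indicator {0<..} y *\<^sub>R (of_real (exp (- y / 2)) * KL \<tau> (y / 2) * f1 y)" for \<tau> y
    using bessel_K_imaginary[of "y / 2" \<tau>] fF[of y] by (cases "y > 0") (simp_all add: f1_def)
  have m: "(\<lambda>y. indicator {0<..} y *\<^sub>R (of_real (exp (- y / 2)) * KL \<tau> (y / 2) * f1 y))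
      \<in> borel_measurable lborel" for \<tau>
    by measurable
  have int: "(\<lambda>y. of_real (exp (- y / 2)) * bessel_K (\<i> * of_real \<tau>) (of_real (y / 2))
      * f y) absolutely_integrable_on {0<..}" for \<tau>
    unfolding set_integrable_def eq integrable_completion[OF m] using T(1)[of \<tau>]
        unfolding set_integrable_def f1_def .
  define g where "g = (\<lambda>\<tau>. LINT y:{0<..}|lebesgue. of_real (exp (- y / 2))
      * bessel_K (\<i> * of_real \<tau>) (of_real (y / 2)) * f y)"
  have g: "g \<tau> = (LINT y:{0<..}|lborel. of_real (exp (- y / 2)) * KL \<tau> (y / 2) * f1 y)" for \<tau>
    unfolding g_def set_lebesgue_integral_def eq by (rule integral_completion[OF m])
  have g': "g \<tau> = 1 / (2 * of_real pi) * (LINT t|lborel. F t * kl_mellin (Complex (1 - c0) (- t)) \<tau>)"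
      for \<tau>
    unfolding g using T(2)[of \<tau>] unfolding f1_def .
  have cg: "continuous_on UNIV g"
    unfolding g[abs_def] using T(3) unfolding f1_def .
  have "\<exists>J. has_improper_Riemann_integral (\<lambda>\<tau>. of_real (\<tau> * sinh (pi * \<tau>))
      * bessel_K (\<i> * of_real \<tau>) (of_real (x / 2)) * g \<tau>) J \<and>
            f x = of_real (exp (x / 2) / (pi\<^sup>2 * x)) * J" if x: "x > 0" for x
  proof -
    have y: "x / 2 > 0" using x by simp
    define W where "W = index_kernel (x / 2)"
    define \<Psi> where "\<Psi> = (\<lambda>\<tau>. W \<tau> * g \<tau>)"
    note I = index_inversion_density[OF assms(1,2) F iFw x]
    have \<Psi>: "\<Psi> \<tau>
        = 1 / (2 * of_real pi) * (W \<tau> *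
            (LINT t|lborel. F t * kl_mellin (Complex (1 - c0) (- t)) \<tau>))" for \<tau>
      unfolding \<Psi>_def g' by (simp only: mult_ac)
    have "continuous_on UNIV (\<lambda>\<tau>. KL \<tau> (x / 2))"
      by (rule continuous_on_compose2[OF continuous_on_macdonald[OF y, of 1]]) (auto intro!: continuous_intros)
    then have c\<Psi>: "continuous_on UNIV \<Psi>"
      unfolding \<Psi>_def W_def index_kernel_def by (intro continuous_intros cg)
    have i\<Psi>: "integrable lborel \<Psi>"
      unfolding \<Psi>[abs_def] W_def by (intro integrable_mult_right I(1))
    define J where "J = (LINT \<tau>|lborel. \<Psi> \<tau>)"
    have "J = 1 / (2 * of_real pi)
        * (LINT \<tau>|lborel. W \<tau> * (LINT t|lborel. F t * kl_mellin (Complex (1 - c0) (- t)) \<tau>))"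
      unfolding J_def \<Psi> by (rule integral_mult_right_zero)
    also have "(LINT \<tau>|lborel. W \<tau> * (LINT t|lborel. F t * kl_mellin (Complex (1 - c0) (- t)) \<tau>))
       = of_real (pi\<^sup>2 * exp (- (x / 2)) * x) * (LINT t|lborel. F t * exp (- (Complex c0 t * of_real (ln x))))"
      unfolding W_def by (rule I(2))
    also have "1 / (2 * of_real pi)
        * (of_real (pi\<^sup>2 * exp (- (x / 2)) * x) *
            (LINT t|lborel. F t * exp (- (Complex c0 t * of_real (ln x)))))
       = of_real (pi\<^sup>2 * exp (- (x / 2)) * x) * f x"
      unfolding fF[OF x] mellin_density_def by (simp only: mult_ac)
    finally have J: "J = of_real (pi\<^sup>2 * exp (- (x / 2)) * x) * f x" .
    have "of_real (exp (x / 2) / (pi\<^sup>2 * x)) * J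
        = of_real (exp (x / 2) / (pi\<^sup>2 * x) * (pi\<^sup>2 * exp (- (x / 2)) * x)) * f x"
      unfolding J by (simp only: of_real_mult mult.assoc)
    also have "exp (x / 2) / (pi\<^sup>2 * x) * (pi\<^sup>2 * exp (- (x / 2)) * x) = 1"
      using x by (simp add: exp_minus field_simps)
    finally have "f x = of_real (exp (x / 2) / (pi\<^sup>2 * x)) * J" by simp
    moreover have "has_improper_Riemann_integral \<Psi> J"
      unfolding J_def by (rule has_improper_Riemann_integral_absolutely[OF c\<Psi> i\<Psi>])
    ultimately show ?thesis
      unfolding \<Psi>_def W_def index_kernel_def bessel_K_imaginary[OF y] by blast
  qed
  then show ?thesis using int unfolding g_def by blast
qed

end
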